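(* A map $\mu \colon \mathcal{P}^2_o \to \mathbb{R}^2$ is a measurable valuation satisfying $\mu(\phi P) = \phi\,\mu(P)$ for all $P \in \mathcal{P}^2_o$ and all $\phi \in \mathrm{SL}(2)$ if and only if there exist constants $k_1, k_2 \in \mathbb{R}$ such that \[ \mu(P) = k_1\, m(P) + k_2\, \rho_{\frac{\pi}{2}}\, m(P^* ) \quad \text{for all } P \in \mathcal{P}^2_o . \]
   Context: $\mathcal{P}^n_o$ denotes the set of convex polytopes in $\mathbb{R}^n$ containing the origin in their interiors, equipped with the topology of the Hausdorff metric; "measurable" means measurable with respect to the Borel $\sigma$-algebras. A map $\mu$ on a family $\mathcal{S}$ of sets is a valuation if $\mu(K \cup L) + \mu(K \cap L) = \mu(K) + \mu(L)$ whenever $K, L, K\cup L, K \cap L \in \mathcal{S}$. The moment vector of $P$ is $m(P) = \int_P x \, dx$. The polar body is $P^* = \{ y \in \mathbb{R}^n : y^t x \leq 1 \text{ for all } x \in P\}$. $\rho_{\frac{\pi}{2}}$ denotes the counter-clockwise rotation of $\mathbb{R}^2$ by the angle $\frac{\pi}{2}$. *)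

theory Defs
  imports "HOL-Analysis.Analysis"
begin

text \<open>Hausdorff distance between (nonempty, bounded) sets.\<close>
definition hausdist :: "'a::metric_space set \<Rightarrow> 'a set \<Rightarrow> real" where
  "hausdist S T = max (SUP x\<in>S. infdist x T) (SUP y\<in>T. infdist y S)"

definition polytopes_o :: "(real^2) set set" where
  "polytopes_o = {P. polytope P \<and> 0 \<in> interior P}"

definition hausdorff_open :: "(real^2) set set \<Rightarrow> bool" where
  "hausdorff_open U \<longleftrightarrow> U \<subseteq> polytopes_o \<and>
     (\<forall>K\<in>U. \<exists>e>0. \<forall>L\<in>polytopes_o. hausdist K L < e \<longrightarrow> L \<in> U)"

definition polytopes_o_borel :: "(real^2) set measure" where
  "polytopes_o_borel = sigma polytopes_o {U. hausdorff_open U}"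

definition valuation_on :: "'a set set \<Rightarrow> ('a set \<Rightarrow> 'b::ab_group_add) \<Rightarrow> bool" where
  "valuation_on S \<mu> \<longleftrightarrow> (\<forall>K L. K \<in> S \<longrightarrow> L \<in> S \<longrightarrow> K \<union> L \<in> S \<longrightarrow> K \<inter> L \<in> S \<longrightarrow>
       \<mu> (K \<union> L) + \<mu> (K \<inter> L) = \<mu> K + \<mu> L)"

definition moment :: "(real^2) set \<Rightarrow> real^2" where
  "moment P = integral P (\<lambda>x. x)"

definition polar :: "(real^2) set \<Rightarrow> (real^2) set" where
  "polar P = {y. \<forall>x\<in>P. y \<bullet> x \<le> 1}"

definition rot90 :: "real^2 \<Rightarrow> real^2" where
  "rot90 v = vector [- (v $ 2), v $ 1]"

end

theory Submission
  imports Defs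
begin

text \<open>
  Let a quadrilateral have a diagonal through the origin on the first axis. The valuation property
  makes its value a sum of a term for the upper and a term for the lower vertex. Shearing the upper
  part against the lower one changes the value by a cocycle of the group of shears, which
  measurability forces to be a polynomial with one essential coefficient, the \<^emph>\<open>twist\<close>; by
  separating the two end points of the diagonal, the twist is a constant times
  \<open>1 / a\<^sup>3 + 1 / b\<^sup>3\<close>. If the twist vanishes, the value of a quadrilateral is a sum over
  its edges \<open>p, q\<close> of terms \<open>B2 (det2 p q) p + B1 (det2 p q) q\<close>. Computing a triangle
  in three ways shows that these terms are additive when an edge is subdivided, and the resulting
  functional equation leaves, up to telescoping terms, a single constant. Finally a valuation that
  vanishes on all such quadrilaterals vanishes on all polygons. Hence the space of valuations in
  question is at most two-dimensional, and the two moment vectors are linearly independent because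
  they scale with different exponents.
\<close>

section \<open>Cutting and exchanging\<close>

text \<open>Intersecting a polygon with a half plane bounded by a line through the origin leaves the
  domain, since the origin is no longer interior. A half is therefore never evaluated by itself: an
  apex on the other side is added to it, and only identities in which the apex contributions cancel
  are used. The quadrilaterals on a fixed diagonal obey such a four-term exchange identity, but not
  every upper vertex fits every lower one; splitting the value into two summands works because a
  lower vertex close enough to the origin fits finitely many upper ones at once. The exponent 3 in
  the twist comes from diag(t, 1/t), which conjugates the shear by s into the shear by t^2 s and
  divides second coordinates by t. Measurability of the given map enters at two Cauchy equations,
  one in the shear cocycle and one for the edge coefficients, each along a family of quadrilaterals
  indexed by an open interval. Of the two constants that serve as divisors only nonvanishing has to
  be shown. It follows from the moment vector of a single box and from the scaling exponents 3 and
  -3, so that no moment vector of a general polygon is computed.\<close>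

lemma convex_zero_interiorI:
  fixes C :: "(real^2) set"
  assumes "convex C" and abs: "\<And>x. \<exists>t>0. t *\<^sub>R x \<in> C"
  shows "0 \<in> interior C"
proof -
  have "\<forall>x. \<exists>t>0. t *\<^sub>R x \<in> C" using abs by blast
  then obtain t where t: "\<And>x. t x > 0" "\<And>x. t x *\<^sub>R x \<in> C" by metis
  have C0: "0 \<in> C" using t(2)[of 0] by simp
  define r where "r = min (min (t (axis 1 1)) (t (- axis 1 1))) (min (t (axis 2 1)) (t (- axis 2 1)))"
  have r: "r > 0" by (simp add: r_def t)
  have sc: "s *\<^sub>R x \<in> C" if "0 \<le> s" "s \<le> t x" for s x
  proof -
    have "(s / t x) *\<^sub>R (t x *\<^sub>R x) + (1 - s / t x) *\<^sub>R 0 \<in> C"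
      using that t[of x] C0 \<open>convex C\<close> by (intro convexD) (auto simp: field_simps)
    then show ?thesis using t(1)[of x] by simp
  qed
  have seg: "s *\<^sub>R axis i 1 \<in> C" if "\<bar>s\<bar> \<le> r" for s and i :: 2
  proof (cases "s \<ge> 0")
    case True
    then show ?thesis using that exhaust_2[of i] by (intro sc) (auto simp: r_def)
  next
    case False
    have "(- s) *\<^sub>R (- axis i 1) \<in> C"
      using False that exhaust_2[of i] by (intro sc) (auto simp: r_def)
    then show ?thesis by simp
  qed
  have "ball 0 (r/2) \<subseteq> C"
  proof
    fix x :: "real^2" assume "x \<in> ball 0 (r/2)"
    then have "norm x < r/2" by simp
    then have b: "\<bar>2 * x$i\<bar> \<le> r" for i using component_le_norm_cart[of x i] by simp
    have "(1/2) *\<^sub>R ((2 * x$1) *\<^sub>R axis 1 1) + (1/2) *\<^sub>R ((2 * x$2) *\<^sub>R axis 2 1) \<in> C"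
      using seg b \<open>convex C\<close> by (intro convexD) auto
    also have "(1/2) *\<^sub>R ((2 * x$1) *\<^sub>R axis 1 1) + (1/2) *\<^sub>R ((2 * x$2) *\<^sub>R axis 2 1) = x"
      by (simp add: vec_eq_iff forall_2 axis_def)
    finally show "x \<in> C" .
  qed
  moreover have "0 \<in> ball (0::real^2) (r/2)" using r by simp
  ultimately show ?thesis by (meson interiorI open_ball)
qed

lemma zero_interior_absorbing:
  fixes C :: "(real^2) set"
  assumes "0 \<in> interior C"
  obtains t where "t > 0" "\<And>s. \<bar>s\<bar> \<le> t \<Longrightarrow> s *\<^sub>R x \<in> C"
proof -
  obtain e where e: "e > 0" "ball 0 e \<subseteq> C" using assms mem_interior by blast
  show ?thesis
  proof
    show "e / (norm x + 1) / 2 > 0" using e by (simp add: add_nonneg_pos)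
    fix s assume s: "\<bar>s\<bar> \<le> e / (norm x + 1) / 2"
    have "norm (s *\<^sub>R x) \<le> e / (norm x + 1) / 2 * norm x"
      unfolding norm_scaleR using s by (intro mult_right_mono) auto
    also have "\<dots> = e / 2 * (norm x / (norm x + 1))" by simp
    also have "\<dots> \<le> e/2 * 1"
      using e by (intro mult_left_mono) (auto simp: divide_le_eq add_nonneg_pos)
    finally have "norm (s *\<^sub>R x) < e" using e by simp
    then show "s *\<^sub>R x \<in> C" using e by auto
  qed
qed

lemma polytopes_oD:
  assumes "P \<in> polytopes_o"
  shows "polytope P" "convex P" "compact P" "closed P" "0 \<in> interior P" "0 \<in> P"
  using assms interior_subset polytope_imp_convex polytope_imp_compact polytope_imp_closed
  by (auto simp: polytopes_o_def)

text \<open>A vector \<open>x\<close> is brought onto the line by subtracting a multiple of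
  whichever of \<open>u\<close>, \<open>v\<close> lies on its side. Small multiples of both summands
  lie in \<open>C\<close>, hence so does their midpoint, and \<open>C\<close> absorbs
  \<open>x\<close>.\<close>

lemma zero_interior_two_sidedI:
  fixes C :: "(real^2) set"
  assumes C: "convex C" "0 \<in> C" and uv: "u \<in> C" "v \<in> C" "n \<bullet> u > 0" "n \<bullet> v < 0"
    and line: "\<And>y. n \<bullet> y = 0 \<Longrightarrow> \<exists>t>0. t *\<^sub>R y \<in> C"
  shows "0 \<in> interior C"
proof (rule convex_zero_interiorI[OF C(1)])
  fix x
  have key: "\<exists>t>0. t *\<^sub>R x \<in> C" if w: "w \<in> C" "n \<bullet> w \<noteq> 0" "(n \<bullet> x) / (n \<bullet> w) \<ge> 0" for w
  proof -
    define k where "k = (n \<bullet> x) / (n \<bullet> w)"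
    have k: "k \<ge> 0" using w k_def by simp
    have "n \<bullet> (x - k *\<^sub>R w) = 0" using w by (simp add: k_def inner_diff_right)
    then obtain t where t: "t > 0" "t *\<^sub>R (x - k *\<^sub>R w) \<in> C" using line by blast
    define s where "s = min (t/2) (1 / (2 * (k+1)))"
    have s: "s > 0" "s \<le> t/2" using t k by (auto simp: s_def)
    have "s * k \<le> 1 / (2 * (k+1)) * k" using k by (intro mult_right_mono) (auto simp: s_def)
    also have "\<dots> \<le> 1/2" using k by (simp add: field_simps)
    finally have sk: "s * k \<le> 1/2" .
    have a: "(2 * s) *\<^sub>R (x - k *\<^sub>R w) \<in> C"
    proof -
      have "(2 * s / t) *\<^sub>R (t *\<^sub>R (x - k *\<^sub>R w)) + (1 - 2 * s / t) *\<^sub>R 0 \<in> C"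
        using s t C by (intro convexD) (auto simp: field_simps)
      then show ?thesis using t by simp
    qed
    have b: "(2 * s * k) *\<^sub>R w \<in> C"
    proof -
      have "(2 * s * k) *\<^sub>R w + (1 - 2 * s * k) *\<^sub>R 0 \<in> C"
        using s sk k w C by (intro convexD) auto
      then show ?thesis by simp
    qed
    have "(1/2) *\<^sub>R ((2 * s) *\<^sub>R (x - k *\<^sub>R w)) + (1/2) *\<^sub>R ((2 * s * k) *\<^sub>R w) \<in> C"
      using a b C by (intro convexD) auto
    then have "s *\<^sub>R x \<in> C" by (simp add: algebra_simps)
    then show ?thesis using s by blast
  qed
  show "\<exists>t>0. t *\<^sub>R x \<in> C"
  proof (cases "n \<bullet> x \<ge> 0")
    case True then show ?thesis using key[of u] uv by simp
  next
    case False then show ?thesis using key[of v] uv by (simp add: divide_nonpos_neg)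
  qed
qed

lemma segment_crosses_hyperplane:
  fixes n :: "real^2"
  assumes "n \<bullet> y \<le> 0" "n \<bullet> x \<ge> 0" "z \<in> closed_segment y x" "n \<bullet> z \<ge> 0"
  obtains w where "w \<in> closed_segment y x" "n \<bullet> w = 0" "z \<in> closed_segment w x"
proof -
  have "\<exists>w. w \<in> closed_segment y z \<and> n \<bullet> w = 0"
  proof -
    have "connected ((\<lambda>w. n \<bullet> w) ` closed_segment y z)"
      by (intro connected_continuous_image continuous_intros) auto
    then have "0 \<in> (\<lambda>w. n \<bullet> w) ` closed_segment y z"
      using assms by (meson connectedD_interval ends_in_segment imageI)
    then show ?thesis by auto
  qed
  then obtain w where w: "w \<in> closed_segment y z" "n \<bullet> w = 0" by auto
  have yz: "closed_segment y z \<subseteq> closed_segment y x"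
    using assms(3) by (simp add: subset_closed_segment)
  obtain t where t: "0 \<le> t" "t \<le> 1" "z = (1-t) *\<^sub>R y + t *\<^sub>R x" using assms(3) by (auto simp: in_segment)
  obtain s where s: "0 \<le> s" "s \<le> 1" "w = (1-s) *\<^sub>R y + s *\<^sub>R z" using w by (auto simp: in_segment)
  have "z \<in> closed_segment w x"
  proof (cases "s * t = 1")
    case True
    then have "t = 1" using s t by (metis mult.commute mult_left_le order_antisym)
    then show ?thesis using t by simp
  next
    case False
    have st: "s * t < 1" using False s t by (metis mult_le_one order_less_le)
    define r where "r = (t - s*t) / (1 - s*t)"
    have r: "0 \<le> r" "r \<le> 1" using st s t
      by (auto simp: r_def divide_le_eq mult_left_le_one_le mult_right_le_one_le)
    have r1: "(1 - r) * (1 - s*t) = 1 - t" using st by (simp add: r_def field_simps)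
    have r2: "(1 - r) * (s * t) + r = t"
    proof -
      have "r * (1 - s*t) = t - s*t" using st by (simp add: r_def)
      then show ?thesis by (simp add: algebra_simps)
    qed
    have w': "w = (1 - s*t) *\<^sub>R y + (s*t) *\<^sub>R x"
      unfolding s(3) t(3) by (simp add: algebra_simps)
    have "(1-r) *\<^sub>R w + r *\<^sub>R x = ((1 - r) * (1 - s*t)) *\<^sub>R y + ((1 - r) * (s * t) + r) *\<^sub>R x"
      unfolding w' by (simp add: algebra_simps)
    also have "\<dots> = z" unfolding r1 r2 t(3) by simp
    finally show ?thesis using r by (auto simp: in_segment intro!: exI[of _ r])
  qed
  then show ?thesis using that w yz by blast
qed

text \<open>A point of the hull lies on a segment from \<open>u\<close> to some \<open>y\<close>
  below the line. That segment meets the line inside \<open>X\<close>, and a point above the line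
  lies between this crossing and \<open>u\<close>. This is what identifies the overlap of the two
  pieces of a cut.\<close>

lemma hull_half_insert:
  fixes n :: "real^2"
  assumes X: "convex X" "u \<in> X" "n \<bullet> u \<ge> 0" "X \<inter> {x. n \<bullet> x \<le> 0} \<noteq> {}"
    and z: "z \<in> convex hull (insert u (X \<inter> {x. n \<bullet> x \<le> 0}))" "n \<bullet> z \<ge> 0"
  shows "z \<in> convex hull (insert u (X \<inter> {x. n \<bullet> x = 0}))"
proof -
  have "convex (X \<inter> {x. n \<bullet> x \<le> 0})"
    using X convex_halfspace_le by (intro convex_Int) auto
  then obtain y where y: "y \<in> X" "n \<bullet> y \<le> 0" "z \<in> closed_segment u y"
    using z X by (auto simp: convex_hull_insert_segments hull_same)
  then obtain w where w: "w \<in> closed_segment y u" "n \<bullet> w = 0" "z \<in> closed_segment w u"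
    using segment_crosses_hyperplane[of n y u z] X z by (metis closed_segment_commute)
  have "w \<in> X" using w y X by (meson convex_contains_segment subsetD)
  then have "w \<in> convex hull (insert u (X \<inter> {x. n \<bullet> x = 0}))" "u \<in> convex hull (insert u (X \<inter> {x. n \<bullet> x = 0}))"
    using w by (auto intro!: hull_inc)
  then show ?thesis using w by (meson convex_contains_segment convex_convex_hull subsetD)
qed

lemma polytope_hull_Un_finite:
  fixes X :: "(real^2) set"
  assumes "polytope X" "finite F"
  shows "polytope (convex hull (X \<union> F))"
proof -
  obtain V where "finite V" "X = convex hull V" using assms by (auto simp: polytope_def)
  then have "convex hull (X \<union> F) = convex hull (V \<union> F)"
    by (metis hull_Un_left)
  then show ?thesis using \<open>finite V\<close> assms by (metis finite_Un polytope_convex_hull)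
qed

text \<open>The apexes \<open>u\<close> and \<open>v\<close> keep the origin interior to all three
  pieces. \<open>A\<close> and \<open>B\<close> cover \<open>X\<close> because each contains one
  half; that they overlap only in \<open>C\<close> is the preceding hull computation, used with
  \<open>n\<close> above the line and with \<open>-n\<close> below it.\<close>

lemma valuation_cut:
  fixes \<mu> :: "(real^2) set \<Rightarrow> real^2"
  assumes val: "valuation_on polytopes_o \<mu>" and X: "X \<in> polytopes_o"
    and u: "u \<in> X" "n \<bullet> u > 0" and v: "v \<in> X" "n \<bullet> v < 0"
  defines "A \<equiv> convex hull (insert v (X \<inter> {x. n \<bullet> x \<ge> 0}))"
    and "B \<equiv> convex hull (insert u (X \<inter> {x. n \<bullet> x \<le> 0}))"
    and "C \<equiv> convex hull (insert u (insert v (X \<inter> {x. n \<bullet> x = 0})))"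
  shows "A \<in> polytopes_o" "B \<in> polytopes_o" "C \<in> polytopes_o" "\<mu> X + \<mu> C = \<mu> A + \<mu> B"
proof -
  note Xp = polytopes_oD[OF X]
  have ABX: "A \<subseteq> X" "B \<subseteq> X"
    unfolding A_def B_def using u v Xp(2) by (intro hull_minimal; auto)+
  have "C \<subseteq> A" "C \<subseteq> B"
    using u v unfolding A_def B_def C_def
    by (intro hull_minimal; auto intro!: hull_inc)+
  have 0: "0 \<in> C" using Xp by (auto simp: C_def intro!: hull_inc)
  have uv: "u \<in> C" "v \<in> C" by (auto simp: C_def intro!: hull_inc)
  have line: "\<exists>t>0. t *\<^sub>R y \<in> C" if "n \<bullet> y = 0" for y
  proof -
    obtain t where "t > 0" "\<And>s. \<bar>s\<bar> \<le> t \<Longrightarrow> s *\<^sub>R y \<in> X" using zero_interior_absorbing[OF Xp(5), of y] by blast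
    then have "t *\<^sub>R y \<in> X \<inter> {x. n \<bullet> x = 0}" using that by simp
    then show ?thesis using \<open>t>0\<close> unfolding C_def by (meson hull_inc insertI2)
  qed
  have iC: "0 \<in> interior C"
    by (rule zero_interior_two_sidedI[OF _ 0 uv u(2) v(2) line]) (auto simp: C_def)
  have iAB: "0 \<in> interior A" "0 \<in> interior B"
    using iC \<open>C \<subseteq> A\<close> \<open>C \<subseteq> B\<close> interior_mono by blast+
  have pA: "polytope (X \<inter> {x. n \<bullet> x \<ge> 0})" "polytope (X \<inter> {x. n \<bullet> x \<le> 0})" "polytope (X \<inter> {x. n \<bullet> x = 0})"
    using Xp by (auto intro!: polytope_Int_polyhedron polyhedron_halfspace_ge polyhedron_halfspace_le polyhedron_hyperplane)
  show A: "A \<in> polytopes_o" and B: "B \<in> polytopes_o" and C: "C \<in> polytopes_o"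
    using polytope_hull_Un_finite[OF pA(1), of "{v}"] polytope_hull_Un_finite[OF pA(2), of "{u}"]
      polytope_hull_Un_finite[OF pA(3), of "{u,v}"] iC iAB
    by (auto simp: A_def B_def C_def polytopes_o_def)
  have un: "A \<union> B = X"
  proof
    show "X \<subseteq> A \<union> B"
    proof
      fix x assume "x \<in> X"
      then show "x \<in> A \<union> B"
        by (cases "n \<bullet> x \<ge> 0") (auto simp: A_def B_def intro: hull_inc)
    qed
  qed (use ABX in auto)
  have int: "A \<inter> B = C"
  proof
    show "A \<inter> B \<subseteq> C"
    proof
      fix z assume z: "z \<in> A \<inter> B"
      show "z \<in> C"
      proof (cases "n \<bullet> z \<ge> 0")
        case True
        have "z \<in> convex hull (insert u (X \<inter> {x. n \<bullet> x = 0}))"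
          using True z Xp u v by (intro hull_half_insert) (auto simp: B_def)
        moreover have "convex hull (insert u (X \<inter> {x. n \<bullet> x = 0})) \<subseteq> C"
          unfolding C_def by (intro hull_mono) auto
        ultimately show ?thesis by auto
      next
        case False
        have "z \<in> convex hull (insert v (X \<inter> {x. (-n) \<bullet> x = 0}))"
          using False z Xp u v by (intro hull_half_insert) (auto simp: A_def)
        moreover have "convex hull (insert v (X \<inter> {x. (-n) \<bullet> x = 0})) \<subseteq> C"
          unfolding C_def by (intro hull_mono) auto
        ultimately show ?thesis by auto
      qed
    qed
  qed (use \<open>C \<subseteq> A\<close> \<open>C \<subseteq> B\<close> in auto)
  show "\<mu> X + \<mu> C = \<mu> A + \<mu> B"
    using val[unfolded valuation_on_def, rule_format, of A B] A B C X un int by simp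
qed

text \<open>All four polygons are cut along the same line with the same apexes, two short multiples
  of the normal. Their sections with the line agree, so the middle piece of every cut is the same
  polygon and its value \<open>c\<close> cancels.\<close>

lemma valuation_exchange:
  fixes \<mu> :: "(real^2) set \<Rightarrow> real^2"
  assumes val: "valuation_on polytopes_o \<mu>"
    and in_o: "P \<in> polytopes_o" "Q \<in> polytopes_o" "R \<in> polytopes_o" "S \<in> polytopes_o"
    and R: "R \<inter> {x. n \<bullet> x \<ge> 0} = P \<inter> {x. n \<bullet> x \<ge> 0}" "R \<inter> {x. n \<bullet> x \<le> 0} = Q \<inter> {x. n \<bullet> x \<le> 0}"
    and S: "S \<inter> {x. n \<bullet> x \<ge> 0} = Q \<inter> {x. n \<bullet> x \<ge> 0}" "S \<inter> {x. n \<bullet> x \<le> 0} = P \<inter> {x. n \<bullet> x \<le> 0}"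
  shows "\<mu> P + \<mu> Q = \<mu> R + \<mu> S"
proof (cases "n = 0")
  case True
  then show ?thesis using R S by (simp add: algebra_simps)
next
  case False
  have "0 \<in> interior (P \<inter> Q \<inter> R \<inter> S)" using in_o polytopes_oD by simp
  then obtain t where t: "t > 0" "\<And>s. \<bar>s\<bar> \<le> t \<Longrightarrow> s *\<^sub>R n \<in> P \<inter> Q \<inter> R \<inter> S"
    using zero_interior_absorbing by blast
  define u where "u = t *\<^sub>R n"
  define v where "v = (-t) *\<^sub>R n"
  have u: "u \<in> P" "u \<in> Q" "u \<in> R" "u \<in> S" "n \<bullet> u > 0" and v: "v \<in> P" "v \<in> Q" "v \<in> R" "v \<in> S" "n \<bullet> v < 0"
    using t t(2)[of t] t(2)[of "-t"] False by (auto simp: u_def v_def)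
  have zero': "X \<inter> {x. n \<bullet> x = 0} = (X \<inter> {x. n \<bullet> x \<ge> 0}) \<inter> {x. n \<bullet> x = 0}"
    "X \<inter> {x. n \<bullet> x = 0} = (X \<inter> {x. n \<bullet> x \<le> 0}) \<inter> {x. n \<bullet> x = 0}" for X by auto
  have z: "P \<inter> {x. n \<bullet> x = 0} = R \<inter> {x. n \<bullet> x = 0}" "Q \<inter> {x. n \<bullet> x = 0} = R \<inter> {x. n \<bullet> x = 0}"
    "S \<inter> {x. n \<bullet> x = 0} = R \<inter> {x. n \<bullet> x = 0}"
    using R S zero' by metis+
  note cP = valuation_cut(4)[OF val in_o(1) u(1,5) v(1,5)]
  note cQ = valuation_cut(4)[OF val in_o(2) u(2,5) v(2,5)]
  note cR = valuation_cut(4)[OF val in_o(3) u(3,5) v(3,5)]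
  note cS = valuation_cut(4)[OF val in_o(4) u(4,5) v(4,5)]
  define c where "c = \<mu> (convex hull insert u (insert v (R \<inter> {x. n \<bullet> x = 0})))"
  have "(\<mu> P + c) + (\<mu> Q + c) = (\<mu> R + c) + (\<mu> S + c)"
    unfolding c_def using cP cQ cR cS unfolding z R S by (simp add: algebra_simps)
  then show ?thesis by (simp add: algebra_simps)
qed

section \<open>Polygons glued along the first axis\<close>

definition pt :: "real \<Rightarrow> real \<Rightarrow> real^2" where
  "pt x y = vector [x, y]"

lemma pt_nth [simp]: "pt x y $ 1 = x" "pt x y $ 2 = y"
  by (simp_all add: pt_def)

lemma real2_eq_iff: "u = v \<longleftrightarrow> u $ 1 = v $ 1 \<and> u $ 2 = v $ 2" for u v :: "real^2"
  by (simp add: vec_eq_iff forall_2)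

lemma pt_collapse [simp]: "pt (u $ 1) (u $ 2) = u"
  by (simp add: real2_eq_iff)

lemma inner_real2: "u \<bullet> v = u $ 1 * v $ 1 + u $ 2 * v $ 2" for u v :: "real^2"
  by (simp add: inner_vec_def sum_2)

definition lin :: "real \<Rightarrow> real \<Rightarrow> real \<Rightarrow> real \<Rightarrow> real^2 \<Rightarrow> real^2" where
  "lin a b c d x = pt (a * x $ 1 + b * x $ 2) (c * x $ 1 + d * x $ 2)"

lemma lin_nth [simp]:
  "lin a b c d x $ 1 = a * x $ 1 + b * x $ 2" "lin a b c d x $ 2 = c * x $ 1 + d * x $ 2"
  by (simp_all add: lin_def)

lemma lin_pt: "lin a b c d (pt x y) = pt (a * x + b * y) (c * x + d * y)"
  by (simp add: lin_def)

lemma linear_lin: "linear (lin a b c d)"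
  by (rule linearI) (simp_all add: real2_eq_iff algebra_simps)

lemma lin_simps:
  "lin a b c d (x + y) = lin a b c d x + lin a b c d y"
  "lin a b c d (x - y) = lin a b c d x - lin a b c d y"
  "lin a b c d (t *\<^sub>R x) = t *\<^sub>R lin a b c d x"
  by (simp_all add: real2_eq_iff algebra_simps)

abbreviation shear :: "real \<Rightarrow> real^2 \<Rightarrow> real^2" where
  "shear s \<equiv> lin 1 s 0 1"

lemma lin_image_hull: "lin a b c d ` (convex hull S) = convex hull (lin a b c d ` S)"
  by (simp add: convex_hull_linear_image linear_lin)

lemma lin_inverse:
  assumes "a * d - b * c = 1"
  shows "lin a b c d (lin d (-b) (-c) a x) = x" "lin d (-b) (-c) a (lin a b c d x) = x"
proof -
  have *: "a * d = 1 + b * c" using assms by simp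
  have "a * (d * x$1 - b * x$2) + b * (a * x$2 - c * x$1) = (a * d) * x$1 - b * c * x$1"
    "c * (d * x$1 - b * x$2) + d * (a * x$2 - c * x$1) = (a * d) * x$2 - b * c * x$2"
    "d * (a * x$1 + b * x$2) - b * (c * x$1 + d * x$2) = (a * d) * x$1 - b * c * x$1"
    "a * (c * x$1 + d * x$2) - c * (a * x$1 + b * x$2) = (a * d) * x$2 - b * c * x$2"
    by (simp_all add: algebra_simps)
  then show "lin a b c d (lin d (-b) (-c) a x) = x" "lin d (-b) (-c) a (lin a b c d x) = x"
    unfolding * by (simp_all add: real2_eq_iff algebra_simps)
qed

lemma polytopes_o_lin:
  assumes "P \<in> polytopes_o" "a * d - b * c = 1"
  shows "lin a b c d ` P \<in> polytopes_o"
proof -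
  have "0 \<in> interior (lin a b c d ` P)"
  proof (rule convex_zero_interiorI)
    show "convex (lin a b c d ` P)"
      using polytopes_oD(2)[OF assms(1)] linear_lin by (intro convex_linear_image) auto
    fix x
    obtain t where "t > 0" "\<And>s. \<bar>s\<bar> \<le> t \<Longrightarrow> s *\<^sub>R lin d (-b) (-c) a x \<in> P"
      using zero_interior_absorbing[OF polytopes_oD(5)[OF assms(1)]] by blast
    then have "t > 0" "t *\<^sub>R lin d (-b) (-c) a x \<in> P" by auto
    moreover have "t *\<^sub>R x = lin a b c d (t *\<^sub>R lin d (-b) (-c) a x)"
      unfolding lin_simps lin_inverse[OF assms(2)] ..
    ultimately show "\<exists>t>0. t *\<^sub>R x \<in> lin a b c d ` P" by blast
  qed
  then show ?thesis
    using polytope_linear_image[OF linear_lin polytopes_oD(1)[OF assms(1)]] by (simp add: polytopes_o_def)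
qed

text \<open>The union \<open>?C\<close> of \<open>convex hull T\<close> with the part of the big
  hull below the line is convex: a segment joining the two parts crosses the line at a point that by
  hypothesis belongs to \<open>convex hull T\<close>, and stays there afterwards. It contains
  \<open>S\<close>, hence the hull of \<open>S\<close>.\<close>

lemma hull_halfspace:
  fixes n :: "real^2"
  assumes J: "\<And>x. x \<in> convex hull S \<Longrightarrow> n \<bullet> x = 0 \<Longrightarrow> x \<in> convex hull T"
    and T: "T \<subseteq> convex hull S" "\<And>x. x \<in> T \<Longrightarrow> n \<bullet> x \<ge> 0"
    and ST: "\<And>x. x \<in> S \<Longrightarrow> n \<bullet> x > 0 \<Longrightarrow> x \<in> T"
  shows "convex hull S \<inter> {x. n \<bullet> x \<ge> 0} = convex hull T"
proof
  show "convex hull T \<subseteq> convex hull S \<inter> {x. n \<bullet> x \<ge> 0}"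
    using T by (intro hull_minimal) (auto intro!: convex_Int convex_halfspace_ge)
  let ?C = "convex hull T \<union> (convex hull S \<inter> {x. n \<bullet> x < 0})"
  have TS: "convex hull T \<subseteq> convex hull S" using T by (simp add: hull_minimal)
  have cross: "z \<in> ?C" if x: "x \<in> convex hull T" and y: "y \<in> convex hull S" "n \<bullet> y < 0"
    and z: "z \<in> closed_segment y x" for x y z
  proof (cases "n \<bullet> z < 0")
    case True
    moreover have "z \<in> convex hull S"
      using x y z TS by (meson closed_segment_subset convex_convex_hull subsetD)
    ultimately show ?thesis by simp
  next
    case False
    have "n \<bullet> x \<ge> 0"
      using x T(2) hull_minimal[of T "{x. n \<bullet> x \<ge> 0}" convex] convex_halfspace_ge[of 0 n] by auto
    then obtain w where w: "w \<in> closed_segment y x" "n \<bullet> w = 0" "z \<in> closed_segment w x"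
      using segment_crosses_hyperplane[of n y x z] False y z by auto
    have "w \<in> convex hull S"
      using x y w TS by (meson closed_segment_subset convex_convex_hull subsetD)
    then have "w \<in> convex hull T" using J w by blast
    then show ?thesis using x w by (meson UnI1 closed_segment_subset convex_convex_hull subsetD)
  qed
  have "convex ?C"
  proof (rule convex_contains_segment[THEN iffD2], intro ballI)
    fix x y assume xy: "x \<in> ?C" "y \<in> ?C"
    consider "x \<in> convex hull T" "y \<in> convex hull T" | "x \<in> convex hull T" "y \<in> convex hull S \<inter> {x. n \<bullet> x < 0}"
      | "y \<in> convex hull T" "x \<in> convex hull S \<inter> {x. n \<bullet> x < 0}"
      | "x \<in> convex hull S \<inter> {x. n \<bullet> x < 0}" "y \<in> convex hull S \<inter> {x. n \<bullet> x < 0}" using xy by blast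
    then show "closed_segment x y \<subseteq> ?C"
    proof cases
      case 1 then show ?thesis by (meson closed_segment_subset convex_convex_hull le_supI1)
    next
      case 2 then show ?thesis using cross by (auto simp: closed_segment_commute[of x y])
    next
      case 3 then show ?thesis using cross by auto
    next
      case 4
      have "convex (convex hull S \<inter> {x. n \<bullet> x < 0})"
        by (intro convex_Int convex_halfspace_lt) auto
      then show ?thesis using 4 by (meson closed_segment_subset le_supI2)
    qed
  qed
  moreover have "S \<subseteq> ?C"
  proof
    fix x assume x: "x \<in> S"
    then have xS: "x \<in> convex hull S" by (simp add: hull_inc)
    consider "n \<bullet> x < 0" | "n \<bullet> x = 0" | "n \<bullet> x > 0" by linarith
    then show "x \<in> ?C"
    proof cases
      case 1 then show ?thesis using xS by simp
    next
      case 2 then show ?thesis using xS J by blast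
    next
      case 3 then have "x \<in> convex hull T" using ST x hull_inc by metis
      then show ?thesis by blast
    qed
  qed
  ultimately have "convex hull S \<subseteq> ?C" by (simp add: hull_minimal)
  then show "convex hull S \<inter> {x. n \<bullet> x \<ge> 0} \<subseteq> convex hull T" by auto
qed

section \<open>Polygons with a prescribed section on the first axis\<close>

definition glued :: "real \<Rightarrow> real \<Rightarrow> (real^2) set \<Rightarrow> (real^2) set \<Rightarrow> (real^2) set" where
  "glued a b U V = convex hull ({pt b 0, pt (-a) 0} \<union> U \<union> V)"

text \<open>
  The two lines through \<open>pt b 0\<close> and \<open>pt (-a) 0\<close> witness that the hull meets the first axis
  exactly in the segment between these two points.
\<close>
definition glueable :: "real \<Rightarrow> real \<Rightarrow> (real^2) set \<Rightarrow> (real^2) set \<Rightarrow> bool" where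
  "glueable a b U V \<longleftrightarrow> 0 < a \<and> 0 < b \<and> finite U \<and> finite V \<and> U \<noteq> {} \<and> V \<noteq> {} \<and>
     (\<forall>x\<in>U. x $ 2 > 0) \<and> (\<forall>x\<in>V. x $ 2 < 0) \<and>
     (\<exists>s. \<forall>x\<in>U \<union> V. x $ 1 + s * x $ 2 \<le> b) \<and> (\<exists>s. \<forall>x\<in>U \<union> V. - a \<le> x $ 1 + s * x $ 2)"

lemma axis_segment_hull:
  assumes "0 < a" "0 < b" "- a \<le> x" "x \<le> b" "{pt b 0, pt (-a) 0} \<subseteq> S"
  shows "pt x 0 \<in> convex hull S"
proof -
  have "((x + a) / (a + b)) *\<^sub>R pt b 0 + ((b - x) / (a + b)) *\<^sub>R pt (-a) 0 \<in> convex hull S"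
    using assms by (intro convexD[OF convex_convex_hull])
      (auto intro!: hull_inc simp: add_divide_distrib[symmetric])
  also have "((x + a) / (a + b)) *\<^sub>R pt b 0 + ((b - x) / (a + b)) *\<^sub>R pt (-a) 0 = pt x 0"
    using assms by (simp add: real2_eq_iff divide_simps) (simp add: algebra_simps)
  finally show ?thesis .
qed

lemma halfplane_hull:
  fixes S :: "(real^2) set"
  assumes "\<And>x. x \<in> S \<Longrightarrow> n \<bullet> x \<le> c" "x \<in> convex hull S"
  shows "n \<bullet> x \<le> c"
  using assms hull_minimal[of S "{x. n \<bullet> x \<le> c}" convex] convex_halfspace_le[of n c] by auto

lemma glued_section:
  assumes "glueable a b U V" "x \<in> glued a b U V" "x $ 2 = 0"
  shows "- a \<le> x $ 1" "x $ 1 \<le> b"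
proof -
  obtain s where s: "\<forall>x\<in>U \<union> V. x $ 1 + s * x $ 2 \<le> b" using assms(1) by (auto simp: glueable_def)
  obtain r where r: "\<forall>x\<in>U \<union> V. - a \<le> x $ 1 + r * x $ 2" using assms(1) by (auto simp: glueable_def)
  have ab: "a > 0" "b > 0" using assms(1) by (auto simp: glueable_def)
  have x: "x \<in> convex hull ({pt b 0, pt (-a) 0} \<union> U \<union> V)" using assms(2) by (simp add: glued_def)
  have "pt 1 s \<bullet> x \<le> b"
    by (rule halfplane_hull[OF _ x]) (use s ab in \<open>auto simp: inner_real2\<close>)
  moreover have "pt (-1) (-r) \<bullet> x \<le> a"
  proof (rule halfplane_hull[OF _ x])
    fix y assume "y \<in> {pt b 0, pt (-a) 0} \<union> U \<union> V"
    then consider "y = pt b 0" | "y = pt (-a) 0" | "y \<in> U \<union> V" by auto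
    then show "pt (-1) (-r) \<bullet> y \<le> a"
    proof cases
      case 3
      then have "- a \<le> y $ 1 + r * y $ 2" using r by blast
      then show ?thesis by (simp add: inner_real2)
    qed (use ab in \<open>auto simp: inner_real2\<close>)
  qed
  ultimately have "pt 1 s \<bullet> x \<le> b" "pt (-1) (-r) \<bullet> x \<le> a" by auto
  then show "- a \<le> x $ 1" "x $ 1 \<le> b" using assms(3) by (auto simp: inner_real2)
qed

lemma glued_upper:
  assumes "glueable a b U V"
  shows "glued a b U V \<inter> {x. pt 0 1 \<bullet> x \<ge> 0} = convex hull ({pt b 0, pt (-a) 0} \<union> U)"
  unfolding glued_def
proof (rule hull_halfspace)
  fix x assume "x \<in> convex hull ({pt b 0, pt (-a) 0} \<union> U \<union> V)" "pt 0 1 \<bullet> x = 0"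
  then have x: "x \<in> glued a b U V" "x $ 2 = 0" by (auto simp: glued_def inner_real2)
  have "pt (x$1) 0 \<in> convex hull ({pt b 0, pt (-a) 0} \<union> U)"
    using glued_section[OF assms x] assms by (intro axis_segment_hull[of a b]) (auto simp: glueable_def)
  then show "x \<in> convex hull ({pt b 0, pt (-a) 0} \<union> U)" using x by (metis pt_collapse)
qed (use assms in \<open>force simp: glueable_def inner_real2 intro!: hull_inc\<close>)+

lemma glued_lower:
  assumes "glueable a b U V"
  shows "glued a b U V \<inter> {x. pt 0 1 \<bullet> x \<le> 0} = convex hull ({pt b 0, pt (-a) 0} \<union> V)"
proof -
  have "glued a b U V \<inter> {x. pt 0 (-1) \<bullet> x \<ge> 0} = convex hull ({pt b 0, pt (-a) 0} \<union> V)"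
    unfolding glued_def
  proof (rule hull_halfspace)
    fix x assume "x \<in> convex hull ({pt b 0, pt (-a) 0} \<union> U \<union> V)" "pt 0 (-1) \<bullet> x = 0"
    then have x: "x \<in> glued a b U V" "x $ 2 = 0" by (auto simp: glued_def inner_real2)
    have "pt (x$1) 0 \<in> convex hull ({pt b 0, pt (-a) 0} \<union> V)"
      using glued_section[OF assms x] assms by (intro axis_segment_hull[of a b]) (auto simp: glueable_def)
    then show "x \<in> convex hull ({pt b 0, pt (-a) 0} \<union> V)" using x by (metis pt_collapse)
  qed (use assms in \<open>force simp: glueable_def inner_real2 intro!: hull_inc\<close>)+
  then show ?thesis by (simp add: inner_real2)
qed

lemma hull_in_polytopes_o:
  assumes "0 < a" "0 < b" "finite S" "{pt b 0, pt (-a) 0, u, v} \<subseteq> S" "u $ 2 > 0" "v $ 2 < 0"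
  shows "convex hull S \<in> polytopes_o"
proof -
  have S0: "pt x 0 \<in> convex hull S" if "- a \<le> x" "x \<le> b" for x
    using that assms by (intro axis_segment_hull[of a b]) auto
  have "0 \<in> interior (convex hull S)"
  proof (rule zero_interior_two_sidedI)
    show "0 \<in> convex hull S"
    proof -
      have "0 = pt 0 0" by (simp add: real2_eq_iff)
      then show ?thesis using S0[of 0] assms by simp
    qed
    show "u \<in> convex hull S" "v \<in> convex hull S" using assms by (auto intro: hull_inc)
    show "pt 0 1 \<bullet> u > 0" "pt 0 1 \<bullet> v < 0" using assms by (auto simp: inner_real2)
    fix y assume "pt 0 1 \<bullet> y = 0"
    then have y: "y $ 2 = 0" by (simp add: inner_real2)
    define t where "t = min a b / (\<bar>y $ 1\<bar> + 1)"
    have t: "t > 0" using assms by (simp add: t_def add_nonneg_pos)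
    have "\<bar>t * y $ 1\<bar> \<le> min a b"
    proof -
      have "\<bar>t * y $ 1\<bar> = min a b * (\<bar>y $ 1\<bar> / (\<bar>y $ 1\<bar> + 1))" using assms by (simp add: t_def abs_mult)
      also have "\<dots> \<le> min a b * 1"
        using assms by (intro mult_left_mono) (auto simp: divide_le_eq)
      finally show ?thesis by simp
    qed
    then have "pt (t * y $ 1) 0 \<in> convex hull S" by (intro S0) auto
    moreover have "t *\<^sub>R y = pt (t * y $ 1) 0" using y by (simp add: real2_eq_iff)
    ultimately show "\<exists>t>0. t *\<^sub>R y \<in> convex hull S" using t by auto
  qed auto
  then show ?thesis using assms polytope_convex_hull by (auto simp: polytopes_o_def)
qed

lemma glued_in_polytopes_o:
  assumes "glueable a b U V"
  shows "glued a b U V \<in> polytopes_o"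
proof -
  obtain u v where "u \<in> U" "v \<in> V" using assms by (auto simp: glueable_def)
  then show ?thesis
    unfolding glued_def using assms
    by (intro hull_in_polytopes_o[of a b _ u v]) (auto simp: glueable_def)
qed

locale sl2_valuation =
  fixes \<mu> :: "(real^2) set \<Rightarrow> real^2"
  assumes valuation: "valuation_on polytopes_o \<mu>"
    and measurable: "\<mu> \<in> measurable polytopes_o_borel borel"
    and equivariant: "\<And>A P. det A = 1 \<Longrightarrow> P \<in> polytopes_o \<Longrightarrow> \<mu> ((\<lambda>x. A *v x) ` P) = A *v \<mu> P"
begin

lemma lin_equivariant:
  assumes "P \<in> polytopes_o" "a * d - b * c = 1"
  shows "\<mu> (lin a b c d ` P) = lin a b c d (\<mu> P)"
proof -
  define A :: "real^2^2" where "A = vector [vector [a, b], vector [c, d]]"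
  have "det A = 1" using assms by (simp add: det_2 A_def)
  moreover have "(\<lambda>x. A *v x) = lin a b c d"
    by (simp add: fun_eq_iff real2_eq_iff matrix_vector_mult_def sum_2 A_def)
  ultimately show ?thesis using equivariant[of A P] assms by (simp add: fun_eq_iff)
qed

lemma lin_equivariant_hull:
  assumes "convex hull S \<in> polytopes_o" "a * d - b * c = 1"
  shows "\<mu> (convex hull (lin a b c d ` S)) = lin a b c d (\<mu> (convex hull S))"
  using lin_equivariant[OF assms] by (simp add: lin_image_hull)

lemma glued_exchange:
  assumes "glueable a b U V" "glueable a b U V'" "glueable a b U' V" "glueable a b U' V'"
  shows "\<mu> (glued a b U V) + \<mu> (glued a b U' V') = \<mu> (glued a b U V') + \<mu> (glued a b U' V)"
  using assms
  by (intro valuation_exchange[OF valuation, where n="pt 0 1"])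
    (simp_all add: glued_in_polytopes_o glued_upper glued_lower)

end

text \<open>A shear by \<open>s\<close> along the first axis fixes the diagonal and turns a witness
  line with parameter \<open>r\<close> into one with parameter \<open>r - s\<close>.\<close>

lemma glueable_shear_iff [simp]:
  "glueable a b (shear s ` U) (shear s ` V) \<longleftrightarrow> glueable a b U V"
proof -
  have *: "(\<exists>r. \<forall>x\<in>shear s ` U \<union> shear s ` V. x $ 1 + r * x $ 2 \<le> b) \<longleftrightarrow> (\<exists>r. \<forall>x\<in>U \<union> V. x $ 1 + r * x $ 2 \<le> b)"
    (is "?L \<longleftrightarrow> ?R")
  proof
    assume ?L
    then obtain r where r: "\<forall>x\<in>shear s ` U \<union> shear s ` V. x $ 1 + r * x $ 2 \<le> b" ..
    show ?R by (rule exI[of _ "s + r"]) (use r in \<open>auto simp: ball_Un algebra_simps\<close>)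
  next
    assume ?R
    then obtain r where r: "\<forall>x\<in>U \<union> V. x $ 1 + r * x $ 2 \<le> b" ..
    show ?L by (rule exI[of _ "r - s"]) (use r in \<open>auto simp: ball_Un algebra_simps\<close>)
  qed
  have **: "(\<exists>r. \<forall>x\<in>shear s ` U \<union> shear s ` V. - a \<le> x $ 1 + r * x $ 2) \<longleftrightarrow> (\<exists>r. \<forall>x\<in>U \<union> V. - a \<le> x $ 1 + r * x $ 2)"
    (is "?L \<longleftrightarrow> ?R")
  proof
    assume ?L
    then obtain r where r: "\<forall>x\<in>shear s ` U \<union> shear s ` V. - a \<le> x $ 1 + r * x $ 2" ..
    show ?R by (rule exI[of _ "s + r"]) (use r in \<open>auto simp: ball_Un algebra_simps\<close>)
  next
    assume ?R
    then obtain r where r: "\<forall>x\<in>U \<union> V. - a \<le> x $ 1 + r * x $ 2" ..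
    show ?L by (rule exI[of _ "r - s"]) (use r in \<open>auto simp: ball_Un algebra_simps\<close>)
  qed
  have "inj_on (shear s) W" for W
    by (rule inj_onI) (auto simp: real2_eq_iff)
  then have "finite (shear s ` W) = finite W" for W by (simp add: finite_image_iff)
  then show ?thesis unfolding glueable_def * ** by auto
qed

lemma (in sl2_valuation) glued_shear:
  assumes "glueable a b U V"
  shows "\<mu> (glued a b (shear s ` U) (shear s ` V)) = shear s (\<mu> (glued a b U V))"
proof -
  have "shear s ` glued a b U V = glued a b (shear s ` U) (shear s ` V)"
    by (simp add: glued_def lin_image_hull image_Un lin_pt)
  then show ?thesis using lin_equivariant[OF glued_in_polytopes_o[OF assms], of 1 1 s 0] by simp
qed

text \<open>The parameters \<open>-s\<close> on the right and \<open>s\<close> on the left put the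
  upper vertex on the correct side of each line whatever \<open>a\<close> and \<open>b\<close> are;
  only the condition \<open>s * e \<le> min a b\<close> for the lower vertex remains.\<close>

lemma glueable_small:
  assumes "0 < a" "0 < b" "u $ 2 > 0" "0 < e" "e * \<bar>u $ 1\<bar> \<le> min a b * u $ 2"
  shows "glueable a b {u} {pt 0 (-e)}"
proof -
  define s where "s = \<bar>u $ 1\<bar> / u $ 2"
  have s1: "s * u $ 2 = \<bar>u $ 1\<bar>" using assms by (simp add: s_def)
  have "s * e = (e * \<bar>u $ 1\<bar>) / u $ 2" by (simp add: s_def)
  also have "\<dots> \<le> min a b" using assms(3,5) by (metis pos_divide_le_eq)
  finally have s: "s * e \<le> min a b" .
  have "\<exists>r. \<forall>x\<in>{u} \<union> {pt 0 (-e)}. x $ 1 + r * x $ 2 \<le> b"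
    using assms s s1 by (intro exI[of _ "-s"]) auto
  moreover have "\<exists>r. \<forall>x\<in>{u} \<union> {pt 0 (-e)}. - a \<le> x $ 1 + r * x $ 2"
    using assms s s1 by (intro exI[of _ s]) auto
  ultimately show ?thesis unfolding glueable_def using assms by auto
qed

lemma glueable_small_upper:
  assumes "0 < a" "0 < b" "v $ 2 < 0" "0 < e" "e * \<bar>v $ 1\<bar> \<le> min a b * (- v $ 2)"
  shows "glueable a b {pt 0 e} {v}"
proof -
  define s where "s = \<bar>v $ 1\<bar> / v $ 2"
  have s1: "s * v $ 2 = \<bar>v $ 1\<bar>" using assms by (simp add: s_def)
  have "- s * e = (e * \<bar>v $ 1\<bar>) / (- v $ 2)" by (simp add: s_def)
  also have "\<dots> \<le> min a b" using assms(3,5) by (metis pos_divide_le_eq neg_0_less_iff_less)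
  finally have s: "- s * e \<le> min a b" .
  have "\<exists>r. \<forall>x\<in>{pt 0 e} \<union> {v}. x $ 1 + r * x $ 2 \<le> b"
    using assms s s1 by (intro exI[of _ "-s"]) auto
  moreover have "\<exists>r. \<forall>x\<in>{pt 0 e} \<union> {v}. - a \<le> x $ 1 + r * x $ 2"
    using assms s s1 by (intro exI[of _ s]) auto
  ultimately show ?thesis unfolding glueable_def using assms by auto
qed

text \<open>Supplies the common lower vertex through which several upper vertices on the same
  diagonal can be compared.\<close>

lemma glueable_small_ex:
  assumes "0 < a" "0 < b" "finite F" "\<And>u. u \<in> F \<Longrightarrow> u $ 2 > 0"
  obtains e where "e > 0" "\<And>u. u \<in> F \<Longrightarrow> glueable a b {u} {pt 0 (-e)}"
proof -
  have "\<exists>e>0. \<forall>u\<in>F. e * \<bar>u $ 1\<bar> \<le> min a b * u $ 2"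
    using assms(3,4)
  proof (induction F rule: finite_induct)
    case empty
    then show ?case by (auto intro: exI[of _ 1])
  next
    case (insert u F)
    then obtain e where e: "e > 0" "\<forall>u\<in>F. e * \<bar>u $ 1\<bar> \<le> min a b * u $ 2" by auto
    have u: "u $ 2 > 0" using insert by auto
    define d where "d = min e (min a b * u $ 2 / (\<bar>u $ 1\<bar> + 1))"
    have "d > 0" using e u assms by (simp add: d_def add_nonneg_pos)
    moreover have "d * \<bar>u $ 1\<bar> \<le> min a b * u $ 2"
    proof -
      have "d * \<bar>u $ 1\<bar> \<le> (min a b * u $ 2 / (\<bar>u $ 1\<bar> + 1)) * (\<bar>u $ 1\<bar> + 1)"
        using \<open>d > 0\<close> u assms by (intro mult_mono) (auto simp: d_def)
      then show ?thesis by simp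
    qed
    moreover have "d * \<bar>w $ 1\<bar> \<le> min a b * w $ 2" if "w \<in> F" for w
    proof -
      have "d * \<bar>w $ 1\<bar> \<le> e * \<bar>w $ 1\<bar>" by (intro mult_right_mono) (auto simp: d_def)
      then show ?thesis using e that by (meson order_trans)
    qed
    ultimately show ?case by auto
  qed
  then show ?thesis using that glueable_small assms by metis
qed

lemma glueable_small_upper_ex:
  assumes "0 < a" "0 < b" "v $ 2 < 0"
  obtains e where "e > 0" "\<And>d. 0 < d \<Longrightarrow> d \<le> e \<Longrightarrow> glueable a b {pt 0 d} {v}"
proof
  show "min a b * (- v $ 2) / (\<bar>v $ 1\<bar> + 1) > 0" using assms
    by (intro divide_pos_pos mult_pos_pos) auto
  fix d assume d: "0 < d" "d \<le> min a b * (- v $ 2) / (\<bar>v $ 1\<bar> + 1)"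
  have "d * \<bar>v $ 1\<bar> \<le> (min a b * (- v $ 2) / (\<bar>v $ 1\<bar> + 1)) * (\<bar>v $ 1\<bar> + 1)"
    using d assms by (intro mult_mono) auto
  then have "d * \<bar>v $ 1\<bar> \<le> min a b * (- v $ 2)" by simp
  then show "glueable a b {pt 0 d} {v}" using glueable_small_upper assms d by simp
qed

text \<open>On a full product the exchange identity alone gives the splitting. Here \<open>R\<close>
  is only a partial relation, so \<open>g u\<close> is read off against the base point
  \<open>u0\<close> at a second argument \<open>w u\<close> compatible with both; exchange makes the
  result independent of that choice. A second argument common to \<open>u\<close>,
  \<open>p v\<close> and \<open>u0\<close> then transfers the splitting to an arbitrary related
  pair.\<close>

lemma decouple:
  fixes f :: "'a \<Rightarrow> 'b \<Rightarrow> 'c::ab_group_add"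
  assumes exch: "\<And>u u' v v'. R u v \<Longrightarrow> R u v' \<Longrightarrow> R u' v \<Longrightarrow> R u' v' \<Longrightarrow> f u v + f u' v' = f u v' + f u' v"
    and common: "\<And>u v u' v' u'' v''. R u v \<Longrightarrow> R u' v' \<Longrightarrow> R u'' v'' \<Longrightarrow> \<exists>w. R u w \<and> R u' w \<and> R u'' w"
  shows "\<exists>g h. \<forall>u v. R u v \<longrightarrow> f u v = g u + h v"
proof (cases "\<exists>u v. R u v")
  case False
  then show ?thesis by blast
next
  case True
  then obtain u0 v0 where uv0: "R u0 v0" by blast
  define w where "w u = (SOME v. R u v \<and> R u0 v)" for u
  have w: "R u (w u)" "R u0 (w u)" if "R u v" for u v
    using someI_ex[of "\<lambda>v. R u v \<and> R u0 v"] common[OF that uv0 uv0] by (auto simp: w_def)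
  define g where "g u = f u (w u) - f u0 (w u)" for u
  have g: "g u = f u v - f u0 v" if "R u v" "R u0 v" for u v
    using exch[OF that(1) w(1)[OF that(1)] that(2) w(2)[OF that(1)]] by (simp add: g_def algebra_simps)
  define p where "p v = (SOME u. R u v)" for v
  have p: "R (p v) v" if "R u v" for u v using someI[of "\<lambda>u. R u v", OF that] by (simp add: p_def)
  have "f u v = g u + (f (p v) v - g (p v))" if uv: "R u v" for u v
  proof -
    obtain z where z: "R u z" "R (p v) z" "R u0 z" using common[OF uv p[OF uv] uv0] by blast
    have "g u - g (p v) = f u z - f (p v) z" using g[OF z(1,3)] g[OF z(2,3)] by simp
    also have "\<dots> = f u v - f (p v) v" using exch[OF uv z(1) p[OF uv] z(2)] by (simp add: algebra_simps)
    finally show ?thesis by (simp add: algebra_simps)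
  qed
  then show ?thesis by (intro exI[of _ g] exI[of _ "\<lambda>v. f (p v) v - g (p v)"]) blast
qed

section \<open>Measurability and additive functions\<close>

lemma additive_of_nat:
  fixes f :: "real \<Rightarrow> real"
  assumes add: "\<And>x y. f (x + y) = f x + f y"
  shows "f (of_nat n * x) = of_nat n * f x"
proof (induction n)
  case 0
  have "f (0 + 0) = f 0 + f 0" by (rule add)
  then show ?case by simp
next
  case (Suc n)
  have "f (of_nat (Suc n) * x) = f (x + of_nat n * x)" by (simp add: algebra_simps)
  then show ?case using Suc by (simp add: add algebra_simps)
qed

lemma additive_bounded_linear:
  fixes f :: "real \<Rightarrow> real"
  assumes add: "\<And>x y. f (x + y) = f x + f y"
    and bd: "d > 0" "\<And>x. \<bar>x\<bar> < d \<Longrightarrow> \<bar>f x\<bar> \<le> M"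
  shows "f x = f 1 * x"
proof -
  have f0: "f 0 = 0" using add[of 0 0] by simp
  have fneg: "f (- x) = - f x" for x using add[of x "-x"] f0 by simp
  note fn = additive_of_nat[of f, OF add]
  have fint: "f (of_int k) = f 1 * of_int k" for k
  proof (cases "k \<ge> 0")
    case True
    then show ?thesis using fn[of "nat k" 1] by simp
  next
    case False
    then have "f (- of_int k) = f 1 * (- of_int k)" using fn[of "nat (-k)" 1] by simp
    then show ?thesis using fneg[of "of_int k"] by simp
  qed
  have bound: "\<bar>f x - f 1 * x\<bar> \<le> (M + \<bar>f 1\<bar> * d) / of_nat n" if n: "n > 0" for n
  proof -
    \<comment> \<open>The denominator \<open>m\<close> makes the remainder \<open>r\<close> so short
      that even \<open>n\<close> copies of it stay within distance \<open>d\<close> of 0, and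
      additivity turns the bound \<open>M\<close> for the copies into \<open>M / n\<close> for
      \<open>f r\<close>. On the fraction \<open>of_int k / of_nat m\<close> the function is linear
      anyway.\<close>
    obtain m :: nat where m: "m > 0" "of_nat n / d < of_nat m"
      using reals_Archimedean2[of "of_nat n / d"] bd n
      by (metis divide_pos_pos of_nat_0_less_iff order.strict_trans)
    define k where "k = \<lfloor>x * of_nat m\<rfloor>"
    define r where "r = x - of_int k / of_nat m"
    have "of_int k \<le> x * of_nat m" "x * of_nat m < of_int k + 1" unfolding k_def by linarith+
    moreover have rm: "r * of_nat m = x * of_nat m - of_int k" using m by (simp add: r_def left_diff_distrib)
    ultimately have "0 \<le> r * of_nat m" "r * of_nat m < 1" by auto
    then have r: "0 \<le> r" "r * of_nat m < 1" using m by (auto simp: zero_le_mult_iff)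
    have "of_nat m * f (of_int k / of_nat m) = f (of_nat m * (of_int k / of_nat m))"
      by (rule fn[symmetric])
    then have q: "f (of_int k / of_nat m) = f 1 * (of_int k / of_nat m)" using m fint[of k] by (simp add: field_simps)
    have "x = r + of_int k / of_nat m" by (simp add: r_def)
    then have "f x = f r + f 1 * (of_int k / of_nat m)" "f 1 * x = f 1 * r + f 1 * (of_int k / of_nat m)"
      using add[of r "of_int k / of_nat m"] q by (auto simp: distrib_left)
    then have "f x - f 1 * x = f r - f 1 * r" by simp
    moreover have nr: "of_nat n * r < d"
    proof -
      have "of_nat n < d * of_nat m" using m bd by (simp add: field_simps)
      then have "of_nat n * r \<le> (d * of_nat m) * r" using r by (intro mult_right_mono) auto
      also have "\<dots> = d * (r * of_nat m)" by simp
      also have "\<dots> < d * 1" using r bd by (intro mult_strict_left_mono) auto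
      finally show ?thesis by simp
    qed
    moreover have "\<bar>f (of_nat n * r)\<bar> \<le> M" using nr r by (intro bd) auto
    then have "\<bar>of_nat n * f r\<bar> \<le> M" using fn[of n r] by simp
    moreover have "\<bar>of_nat n * (f 1 * r)\<bar> \<le> \<bar>f 1\<bar> * d"
    proof -
      have "\<bar>of_nat n * (f 1 * r)\<bar> = \<bar>f 1\<bar> * (of_nat n * r)" using r by (simp add: abs_mult)
      also have "\<dots> \<le> \<bar>f 1\<bar> * d" using nr by (intro mult_left_mono) auto
      finally show ?thesis .
    qed
    ultimately have "\<bar>of_nat n * (f x - f 1 * x)\<bar> \<le> M + \<bar>f 1\<bar> * d"
      by (simp add: right_diff_distrib)
    then have "of_nat n * \<bar>f x - f 1 * x\<bar> \<le> M + \<bar>f 1\<bar> * d" by (simp only: abs_mult abs_of_nat)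
    then show ?thesis using n by (simp add: pos_le_divide_eq mult.commute)
  qed
  have "f x - f 1 * x = 0"
  proof (rule ccontr)
    assume ne: "f x - f 1 * x \<noteq> 0"
    have "(\<lambda>n. (M + \<bar>f 1\<bar> * d) / of_nat n) \<longlonglongrightarrow> 0" by (rule lim_const_over_n)
    then have "\<forall>\<^sub>F n in sequentially. (M + \<bar>f 1\<bar> * d) / of_nat n < \<bar>f x - f 1 * x\<bar>"
      using ne by (intro order_tendstoD) auto
    then have "\<forall>\<^sub>F n in sequentially. n > 0 \<and> (M + \<bar>f 1\<bar> * d) / of_nat n < \<bar>f x - f 1 * x\<bar>"
      using eventually_gt_at_top[of 0] by eventually_elim auto
    then obtain n :: nat where "n > 0" "(M + \<bar>f 1\<bar> * d) / of_nat n < \<bar>f x - f 1 * x\<bar>"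
      using eventually_happens[of _ sequentially] by auto
    then show False using bound[of n] by auto
  qed
  then show ?thesis by simp
qed

text \<open>Steinhaus' argument: \<open>K\<close> has an open neighbourhood \<open>T\<close> of
  measure less than twice its own. For small \<open>t\<close> both \<open>K\<close> and its
  translate lie in \<open>T\<close>, so they cannot be disjoint.\<close>

lemma compact_translate_meets:
  fixes K :: "real set"
  assumes K: "compact K" "\<not> negligible K"
  obtains d where "d > 0" "\<And>t. \<bar>t\<bar> < d \<Longrightarrow> \<exists>x\<in>K. x + t \<in> K"
proof -
  have Kl: "K \<in> lmeasurable" using K lmeasurable_compact by blast
  have Kpos: "measure lebesgue K > 0"
    using K Kl by (simp add: negligible_iff_measure0 zero_less_measure_iff)
  then obtain T where T: "open T" "K \<subseteq> T" "T - K \<in> lmeasurable" "emeasure lebesgue (T - K) < ennreal (measure lebesgue K)"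
    using sets_lebesgue_outer_open[OF fmeasurableD[OF Kl]] by blast
  have Tl: "T \<in> lmeasurable"
    using T Kl by (metis Diff_partition fmeasurable.Un)
  have "measure lebesgue (T - K) < measure lebesgue K"
    using T Kpos by (metis emeasure_eq_measure2 ennreal_leI not_less)
  then have TK: "measure lebesgue T < measure lebesgue K + measure lebesgue K"
    using T Tl Kl by (simp add: measurable_measure_Diff fmeasurableD)
  obtain d where d: "d > 0" "(\<Union>x\<in>K. ball x d) \<subseteq> T"
    using compact_subset_open_imp_ball_epsilon_subset[OF K(1) T(1,2)] by blast
  show ?thesis
  proof
    show "d > 0" by fact
    fix t :: real assume t: "\<bar>t\<bar> < d"
    show "\<exists>x\<in>K. x + t \<in> K"
    proof (rule ccontr)
      assume "\<not> ?thesis"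
      then have dis: "(+) t ` K - K = (+) t ` K" by (auto simp: add.commute)
      have tl: "(+) t ` K \<in> lmeasurable" using Kl by (simp add: measurable_translation)
      have "K \<union> (+) t ` K \<subseteq> T"
      proof -
        have "t + x \<in> ball x d" for x using t by (simp add: dist_real_def)
        then show ?thesis using T(2) d(2) by blast
      qed
      then have "measure lebesgue (K \<union> (+) t ` K) \<le> measure lebesgue T"
        using Tl Kl tl by (intro measure_mono_fmeasurable) auto
      moreover have "measure lebesgue (K \<union> (+) t ` K) = measure lebesgue K + measure lebesgue K"
        unfolding measure_Un2[OF Kl tl] dis by (simp add: measure_translation)
      ultimately show False using TK by simp
    qed
  qed
qed

lemma nonnegligible_compact_subset:
  fixes A :: "real set"
  assumes "A \<in> sets borel" "\<not> negligible A"
  obtains K where "compact K" "K \<subseteq> A" "\<not> negligible K"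
proof -
  have "A \<in> sets lebesgue" using assms by (simp add: sets_completionI_sets)
  then obtain C T where CT: "fsigma C" "T \<in> null_sets lebesgue" "C \<union> T = A"
    using lebesgue_set_almost_fsigma by metis
  then obtain F :: "nat \<Rightarrow> real set" where F: "range F \<subseteq> Collect compact" "C = \<Union>(F ` UNIV)"
    using fsigma_Union_compact by metis
  have "\<not> negligible C" using CT assms by (metis negligible_Un negligible_iff_null_sets)
  then obtain n where "\<not> negligible (F n)"
    using F negligible_Union_nat[of F] by (metis image_cong)
  then show ?thesis using that[of "F n"] F CT by auto
qed

text \<open>The sets where \<open>\<bar>f x\<bar> \<le> real n\<close> exhaust \<open>S\<close>, so
  one of them contains a compact set of positive measure. Its differences fill a neighbourhood of 0,
  on which additivity bounds \<open>f\<close> by \<open>2 * real n\<close>. Measurability is asked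
  for on \<open>S\<close> alone because the quadrilaterals that provide it exist only for a limited
  range of the parameter.\<close>

lemma additive_measurable_linear:
  fixes f :: "real \<Rightarrow> real"
  assumes add: "\<And>x y. f (x + y) = f x + f y"
    and S: "open S" "S \<noteq> {}" and f: "f \<in> borel_measurable (restrict_space borel S)"
  shows "f x = f 1 * x"
proof -
  define A where "A n = {x \<in> S. \<bar>f x\<bar> \<le> real n}" for n
  have "A n \<in> sets borel" for n
  proof -
    have "{x \<in> space (restrict_space borel S). \<bar>f x\<bar> \<le> real n} \<in> sets (restrict_space borel S)"
      using f by measurable
    then show ?thesis using S by (auto simp: sets_restrict_space_iff A_def space_restrict_space)
  qed
  moreover have "\<exists>n. \<not> negligible (A n)"
  proof (rule ccontr)
    assume "\<not> ?thesis"
    then have "negligible (\<Union>n. A n)" by (intro negligible_Union_nat) auto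
    moreover have "(\<Union>n. A n) = S" by (auto simp: A_def real_arch_simple)
    ultimately show False using open_not_negligible[OF S] by simp
  qed
  ultimately obtain n K where K: "compact K" "K \<subseteq> A n" "\<not> negligible K"
    using nonnegligible_compact_subset by metis
  obtain d where d: "d > 0" "\<And>t. \<bar>t\<bar> < d \<Longrightarrow> \<exists>x\<in>K. x + t \<in> K"
    using compact_translate_meets[OF K(1,3)] by blast
  have "\<bar>f t\<bar> \<le> 2 * real n" if t: "\<bar>t\<bar> < d" for t
  proof -
    obtain x where "x \<in> K" "x + t \<in> K" using d(2)[OF t] by blast
    then have "\<bar>f x\<bar> \<le> real n" "\<bar>f (x + t)\<bar> \<le> real n" using K by (auto simp: A_def)
    then show ?thesis using add[of x t] by simp
  qed
  then show ?thesis using additive_bounded_linear[OF add d(1)] by blast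
qed

section \<open>Hausdorff continuity of convex hulls of moving points\<close>

lemma hull_close:
  fixes P Q :: "'i \<Rightarrow> real^2"
  assumes "\<And>i. i \<in> I \<Longrightarrow> dist (P i) (Q i) \<le> d" "x \<in> convex hull (P ` I)"
  obtains y where "y \<in> convex hull (Q ` I)" "dist x y \<le> d"
proof -
  \<comment> \<open>The closed \<open>d\<close>-neighbourhood of the second hull, written as a
    Minkowski sum of two convex sets to make its convexity visible.\<close>
  let ?C = "\<Union>y\<in>convex hull (Q ` I). \<Union>z\<in>cball 0 d. {y + z}"
  have "convex ?C" by (intro convex_sums) auto
  moreover have "P ` I \<subseteq> ?C"
  proof (rule image_subsetI)
    fix i assume "i \<in> I"
    then have "Q i \<in> convex hull (Q ` I)" "P i - Q i \<in> cball 0 d" "P i = Q i + (P i - Q i)"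
      using assms(1) by (auto simp: hull_inc dist_norm norm_minus_commute)
    then show "P i \<in> ?C" by blast
  qed
  ultimately have "convex hull (P ` I) \<subseteq> ?C" by (intro hull_minimal)
  then have "x \<in> ?C" using assms(2) by (rule subsetD)
  then obtain y z where "y \<in> convex hull (Q ` I)" "z \<in> cball 0 d" "x = y + z" by (elim UN_E singletonE)
  then show ?thesis using that[of y] by (simp add: dist_norm)
qed

lemma hausdist_leI:
  fixes S T :: "(real^2) set"
  assumes "S \<noteq> {}" "T \<noteq> {}" "\<And>x. x \<in> S \<Longrightarrow> \<exists>y\<in>T. dist x y \<le> d" "\<And>x. x \<in> T \<Longrightarrow> \<exists>y\<in>S. dist x y \<le> d"
  shows "hausdist S T \<le> d"
proof -
  have "infdist x T \<le> d" if x: "x \<in> S" for x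
    using assms(3)[OF x] infdist_le2 by blast
  moreover have "infdist x S \<le> d" if x: "x \<in> T" for x
    using assms(4)[OF x] infdist_le2 by blast
  ultimately show ?thesis
    unfolding hausdist_def using assms(1,2) by (intro max.boundedI cSUP_least) auto
qed

lemma space_polytopes_o_borel [simp]: "space polytopes_o_borel = polytopes_o"
  by (auto simp: polytopes_o_borel_def space_measure_of_conv)

lemma measurable_polytopes_oI:
  assumes S: "open (S :: real set)" and f: "\<And>s. s \<in> S \<Longrightarrow> f s \<in> polytopes_o"
    and cont: "\<And>s e. s \<in> S \<Longrightarrow> e > 0 \<Longrightarrow> \<exists>d>0. \<forall>t\<in>S. dist s t < d \<longrightarrow> hausdist (f s) (f t) < e"
  shows "f \<in> measurable (restrict_space borel S) polytopes_o_borel"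
  unfolding polytopes_o_borel_def
proof (rule measurable_measure_of)
  show "{U. hausdorff_open U} \<subseteq> Pow polytopes_o" by (auto simp: hausdorff_open_def)
  show "f \<in> space (restrict_space borel S) \<rightarrow> polytopes_o" using f by (auto simp: space_restrict_space)
  fix U assume "U \<in> {U. hausdorff_open U}"
  then have U: "hausdorff_open U" by simp
  have "open (f -` U \<inter> S)"
    unfolding open_dist
  proof
    fix s assume s: "s \<in> f -` U \<inter> S"
    then obtain e where e: "e > 0" "\<forall>L\<in>polytopes_o. hausdist (f s) L < e \<longrightarrow> L \<in> U"
      using U by (auto simp: hausdorff_open_def)
    obtain d where d: "d > 0" "\<forall>t\<in>S. dist s t < d \<longrightarrow> hausdist (f s) (f t) < e" using cont s e by blast
    obtain c where c: "c > 0" "\<forall>t. dist t s < c \<longrightarrow> t \<in> S" using S s by (auto simp: open_dist)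
    show "\<exists>r>0. \<forall>t. dist t s < r \<longrightarrow> t \<in> f -` U \<inter> S"
      using c d e f by (intro exI[of _ "min c d"]) (auto simp: dist_commute)
  qed
  then show "f -` U \<inter> space (restrict_space borel S) \<in> sets (restrict_space borel S)"
    using S by (auto simp: sets_restrict_space_iff space_restrict_space)
qed

lemma measurable_hull_curves:
  fixes CS :: "(real \<Rightarrow> real^2) set"
  assumes S: "open (S :: real set)" and CS: "finite CS" "CS \<noteq> {}"
    and o: "\<And>s. s \<in> S \<Longrightarrow> convex hull ((\<lambda>c. c s) ` CS) \<in> polytopes_o"
    and cont: "\<And>c. c \<in> CS \<Longrightarrow> continuous_on S c"
  shows "(\<lambda>s. convex hull ((\<lambda>c. c s) ` CS)) \<in> measurable (restrict_space borel S) polytopes_o_borel"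
proof (rule measurable_polytopes_oI[OF S o])
  fix s e :: real assume s: "s \<in> S" and e: "e > 0"
  have "\<forall>c\<in>CS. \<exists>d>0. \<forall>t\<in>S. dist t s < d \<longrightarrow> dist (c t) (c s) < e/2"
    using cont s e by (meson continuous_on_iff half_gt_zero)
  then obtain d where d: "\<And>c. c \<in> CS \<Longrightarrow> d c > 0"
    "\<And>c t. c \<in> CS \<Longrightarrow> t \<in> S \<Longrightarrow> dist t s < d c \<Longrightarrow> dist (c t) (c s) < e/2" by metis
  have "hausdist (convex hull ((\<lambda>c. c s) ` CS)) (convex hull ((\<lambda>c. c t) ` CS)) < e"
    if t: "t \<in> S" "dist s t < Min (d ` CS)" for t
  proof -
    have cl: "dist (c t) (c s) \<le> e/2" if "c \<in> CS" for c
      using d(2)[of c t] t that CS by (auto simp: dist_commute intro!: less_imp_le)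
    have "hausdist (convex hull ((\<lambda>c. c s) ` CS)) (convex hull ((\<lambda>c. c t) ` CS)) \<le> e/2"
    proof (rule hausdist_leI)
      fix x
      show "\<exists>y\<in>convex hull ((\<lambda>c. c t) ` CS). dist x y \<le> e/2" if "x \<in> convex hull ((\<lambda>c. c s) ` CS)"
        using hull_close[of CS "\<lambda>c. c s" "\<lambda>c. c t" "e/2" x] that cl by (metis dist_commute)
      show "\<exists>y\<in>convex hull ((\<lambda>c. c s) ` CS). dist x y \<le> e/2" if "x \<in> convex hull ((\<lambda>c. c t) ` CS)"
        using hull_close[of CS "\<lambda>c. c t" "\<lambda>c. c s" "e/2" x] that cl by metis
    qed (use CS in auto)
    then show ?thesis using e by simp
  qed
  moreover have "Min (d ` CS) > 0" using CS d(1) by simp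
  ultimately show "\<exists>d>0. \<forall>t\<in>S. dist s t < d \<longrightarrow> hausdist (convex hull ((\<lambda>c. c s) ` CS)) (convex hull ((\<lambda>c. c t) ` CS)) < e"
    by blast
qed

lemma (in sl2_valuation) measurable_quad_curves:
  assumes S: "open (S :: real set)" and o: "\<And>s. s \<in> S \<Longrightarrow> glueable (a s) (b s) {u s} {v s}"
    and cont: "continuous_on S a" "continuous_on S b" "continuous_on S u" "continuous_on S v"
  shows "(\<lambda>s. \<mu> (glued (a s) (b s) {u s} {v s}) $ i) \<in> borel_measurable (restrict_space borel S)"
proof -
  define CS where "CS = {\<lambda>s. pt (b s) 0, \<lambda>s. pt (- a s) 0, u, v}"
  have gl: "glued (a s) (b s) {u s} {v s} = convex hull ((\<lambda>c. c s) ` CS)" for s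
    by (simp add: glued_def CS_def insert_commute)
  have pt: "pt x y = x *\<^sub>R axis 1 1 + y *\<^sub>R axis 2 1" for x y by (simp add: real2_eq_iff axis_def)
  have "(\<lambda>s. convex hull ((\<lambda>c. c s) ` CS)) \<in> measurable (restrict_space borel S) polytopes_o_borel"
  proof (rule measurable_hull_curves[OF S])
    show "convex hull ((\<lambda>c. c s) ` CS) \<in> polytopes_o" if "s \<in> S" for s
      using glued_in_polytopes_o[OF o[OF that]] by (simp add: gl)
    show "continuous_on S c" if "c \<in> CS" for c
      using that cont by (auto simp: CS_def pt intro!: continuous_intros)
  qed (auto simp: CS_def)
  from measurable_compose[OF this measurable]
  have "(\<lambda>s. \<mu> (glued (a s) (b s) {u s} {v s})) \<in> borel_measurable (restrict_space borel S)"
    by (simp add: gl)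
  then show ?thesis
    using measurable_compose[of _ _ borel "\<lambda>x. x $ i" borel] borel_measurable_nth by blast
qed

section \<open>Shearing the upper part\<close>

lemma shear_shear [simp]: "shear s (shear t x) = shear (s + t) x"
  by (simp add: real2_eq_iff algebra_simps)

lemma glueable_shear_singleton [simp]:
  "glueable a b {shear s u} {shear s v} \<longleftrightarrow> glueable a b {u} {v}"
  using glueable_shear_iff[of a b s "{u}" "{v}"] by simp

lemma glueableD:
  assumes "glueable a b U V"
  shows "0 < a" "0 < b" "\<And>x. x \<in> U \<Longrightarrow> x $ 2 > 0" "\<And>x. x \<in> V \<Longrightarrow> x $ 2 < 0"
  using assms by (auto simp: glueable_def)

text \<open>The vectors \<open>pt (k * s^2 / 2) (k * s)\<close> form a cocycle of the one-parameter
  group of shears; as coboundaries have second coordinate 0, it is a coboundary only for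
  \<open>k = 0\<close>. The two summands carry it with opposite signs, since shearing both vertices
  together is plain equivariance.\<close>

definition shear_split :: "((real^2) set \<Rightarrow> real^2) \<Rightarrow> real \<Rightarrow> real \<Rightarrow> real \<Rightarrow>
    (real^2 \<Rightarrow> real^2) \<Rightarrow> (real^2 \<Rightarrow> real^2) \<Rightarrow> bool" where
  "shear_split \<mu> a b k g h \<longleftrightarrow>
     (\<forall>u v. glueable a b {u} {v} \<longrightarrow> \<mu> (glued a b {u} {v}) = g u + h v) \<and>
     (\<forall>u s. u $ 2 > 0 \<longrightarrow> g (shear s u) = shear s (g u) + pt (k * s^2 / 2) (k * s)) \<and>
     (\<forall>v s. v $ 2 < 0 \<longrightarrow> h (shear s v) = shear s (h v) - pt (k * s^2 / 2) (k * s))"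

lemma shear_splitD:
  assumes "shear_split \<mu> a b k g h"
  shows "glueable a b {u} {v} \<Longrightarrow> \<mu> (glued a b {u} {v}) = g u + h v"
    "u $ 2 > 0 \<Longrightarrow> g (shear s u) = shear s (g u) + pt (k * s^2 / 2) (k * s)"
    "v $ 2 < 0 \<Longrightarrow> h (shear s v) = shear s (h v) - pt (k * s^2 / 2) (k * s)"
  using assms by (auto simp: shear_split_def)

context sl2_valuation
begin

lemma glued_decouple:
  assumes "0 < a" "0 < b"
  obtains g h where "\<And>u v. glueable a b {u} {v} \<Longrightarrow> \<mu> (glued a b {u} {v}) = g u + h v"
proof -
  have "\<exists>g h. \<forall>u v. glueable a b {u} {v} \<longrightarrow> \<mu> (glued a b {u} {v}) = g u + h v"
  proof (rule decouple)
    fix u v u' v' u'' v''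
    assume "glueable a b {u} {v}" "glueable a b {u'} {v'}" "glueable a b {u''} {v''}"
    then have "\<And>x. x \<in> {u, u', u''} \<Longrightarrow> x $ 2 > 0" by (auto simp: glueable_def)
    then show "\<exists>w. glueable a b {u} {w} \<and> glueable a b {u'} {w} \<and> glueable a b {u''} {w}"
      using glueable_small_ex[OF assms, of "{u, u', u''}"] by (metis finite.emptyI finite_insert insertCI)
  qed (rule glued_exchange)
  then show ?thesis using that by blast
qed

text \<open>
  Sliding the upper part along the first axis relative to the lower part changes the value by a
  1-cocycle of the group of shears, and measurable cocycles of this group are polynomials.
\<close>
lemma shear_split_ex:
  assumes ab: "0 < a" "0 < b"
  shows "\<exists>k g h. shear_split \<mu> a b k g h"
proof -
  obtain g h where gh: "\<And>u v. glueable a b {u} {v} \<Longrightarrow> \<mu> (glued a b {u} {v}) = g u + h v"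
    using glued_decouple[OF ab] by blast
  have sh: "g (shear s u) + h (shear s v) = shear s (g u) + shear s (h v)" if "glueable a b {u} {v}" for u v s
    using glued_shear[OF that, of s] gh[OF that] gh[of "shear s u" "shear s v"] that by (simp add: lin_simps)
  define c where "c s = g (shear s (pt 0 1)) - shear s (g (pt 0 1))" for s
  have cg: "g (shear s u) - shear s (g u) = c s" if "u $ 2 > 0" for u s
  proof -
    have "\<And>x. x \<in> {u, pt 0 1} \<Longrightarrow> x $ 2 > 0" using that by auto
    then obtain v where "glueable a b {u} {v}" "glueable a b {pt 0 1} {v}"
      using glueable_small_ex[OF ab, of "{u, pt 0 1}"] by (metis finite.emptyI finite_insert insertCI)
    then have "g (shear s u) - shear s (g u) = shear s (h v) - h (shear s v)"
      "g (shear s (pt 0 1)) - shear s (g (pt 0 1)) = shear s (h v) - h (shear s v)"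
      using sh[of u v s] sh[of "pt 0 1" v s] by (simp_all add: algebra_simps)
    then show ?thesis by (simp add: c_def)
  qed
  have ch: "h (shear s v) - shear s (h v) = - c s" if v: "v $ 2 < 0" for v s
  proof -
    obtain e where e: "e > 0" "\<And>d. 0 < d \<Longrightarrow> d \<le> e \<Longrightarrow> glueable a b {pt 0 d} {v}"
      using glueable_small_upper_ex[OF ab v] by blast
    then have "glueable a b {pt 0 e} {v}" by simp
    then have "h (shear s v) - shear s (h v) = - (g (shear s (pt 0 e)) - shear s (g (pt 0 e)))"
      using sh[of "pt 0 e" v s] by (simp add: algebra_simps)
    then show ?thesis using cg[of "pt 0 e" s] e(1) by simp
  qed
  have cc: "c (s + t) = c s + shear s (c t)" for s t
  proof -
    have "g (shear (s + t) (pt 0 1)) = shear s (g (shear t (pt 0 1))) + c s"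
      using cg[of "shear t (pt 0 1)" s] by (simp add: algebra_simps)
    moreover have "g (shear t (pt 0 1)) = shear t (g (pt 0 1)) + c t"
      using cg[of "pt 0 1" t] by (simp add: algebra_simps)
    ultimately show ?thesis using cg[of "pt 0 1" "s + t"] by (simp add: lin_simps algebra_simps)
  qed
  have c2: "c (s + t) $ 2 = c s $ 2 + c t $ 2" and c1: "c (s + t) $ 1 = c s $ 1 + c t $ 1 + s * c t $ 2" for s t
    using cc[of s t] by simp_all
  define k where "k = c 1 $ 2"
  \<comment> \<open>Shears commute, so the first coordinate of the cocycle identity may be read in
    both orders. This alone makes the second coordinate linear; the first coordinate, freed of its
    quadratic term, is merely additive and has to be treated by measurability.\<close>
  have ck: "c s $ 2 = k * s" for s
  proof -
    have "1 * c s $ 2 = s * c 1 $ 2" using c1[of 1 s] c1[of s 1] by (simp add: add.commute)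
    then show ?thesis by (simp add: k_def mult.commute)
  qed
  define l where "l s = c s $ 1 - k * s^2 / 2" for s
  have l_add: "l (s + t) = l s + l t" for s t
    using c1[of s t] by (simp add: l_def ck power2_eq_square field_simps)
  have "l \<in> borel_measurable (restrict_space borel {-1<..<1})"
  proof -
    \<comment> \<open>With this height the lower vertex fits the sheared apex for every parameter
      between -1 and 1, which gives the open interval on which measurability is tested.\<close>
    define e where "e = min a b"
    have e: "e > 0" using ab by (simp add: e_def)
    have ok: "glueable a b {shear s (pt 0 1)} {pt 0 (-e)}" if "s \<in> {-1<..<1}" for s
    proof (rule glueable_small[OF ab _ e])
      have "e * \<bar>s\<bar> \<le> e * 1" using e that by (intro mult_left_mono) auto
      then show "e * \<bar>shear s (pt 0 1) $ 1\<bar> \<le> min a b * shear s (pt 0 1) $ 2" by (simp add: e_def)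
    qed simp
    have "shear s (pt 0 1) = pt 0 1 + s *\<^sub>R axis 1 1" for s by (simp add: real2_eq_iff axis_def)
    then have cont: "continuous_on {-1<..<1} (\<lambda>s. shear s (pt 0 1))"
      by (simp add: continuous_intros)
    have M: "(\<lambda>s. \<mu> (glued a b {shear s (pt 0 1)} {pt 0 (-e)}) $ 1) \<in> borel_measurable (restrict_space borel {-1<..<1})"
      using ok cont by (intro measurable_quad_curves) (auto intro!: continuous_intros)
    define p where "p s = h (pt 0 (-e)) $ 1 + (g (pt 0 1) $ 1 + s * g (pt 0 1) $ 2) + k * s^2 / 2" for s
    have "p \<in> borel_measurable borel" unfolding p_def by measurable
    then have "(\<lambda>s. \<mu> (glued a b {shear s (pt 0 1)} {pt 0 (-e)}) $ 1 - p s) \<in> borel_measurable (restrict_space borel {-1<..<1})"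
      using M by (intro borel_measurable_diff) (auto intro: measurable_restrict_space1)
    moreover have "l s = \<mu> (glued a b {shear s (pt 0 1)} {pt 0 (-e)}) $ 1 - p s" if "s \<in> {-1<..<1}" for s
      using gh[OF ok[OF that]] by (simp add: l_def c_def p_def)
    ultimately show ?thesis
      by (subst measurable_cong[where g="\<lambda>s. \<mu> (glued a b {shear s (pt 0 1)} {pt 0 (-e)}) $ 1 - p s"])
        (auto simp: space_restrict_space)
  qed
  then have l: "l s = l 1 * s" for s
    using additive_measurable_linear[OF l_add, of "{-1<..<1}" s] by auto
  have c: "c s = pt (l 1 * s + k * s^2 / 2) (k * s)" for s
    using l[of s] ck[of s] by (simp add: real2_eq_iff l_def)
  \<comment> \<open>Shifting \<open>g\<close> and \<open>h\<close> by opposite constants leaves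
    their sum unchanged and removes the linear term of the cocycle, which is the coboundary of
    \<open>pt 0 (l 1)\<close>.\<close>
  have "shear_split \<mu> a b k (\<lambda>u. g u + pt 0 (l 1)) (\<lambda>v. h v - pt 0 (l 1))"
    unfolding shear_split_def
  proof (intro conjI allI impI)
    fix u v assume "glueable a b {u} {v}"
    then show "\<mu> (glued a b {u} {v}) = g u + pt 0 (l 1) + (h v - pt 0 (l 1))" using gh by simp
  next
    fix u :: "real^2" and s assume "u $ 2 > 0"
    then show "g (shear s u) + pt 0 (l 1) = shear s (g u + pt 0 (l 1)) + pt (k * s^2 / 2) (k * s)"
      using cg[of u s] c[of s] by (simp add: real2_eq_iff algebra_simps)
  next
    fix v :: "real^2" and s assume "v $ 2 < 0"
    then show "h (shear s v) - pt 0 (l 1) = shear s (h v - pt 0 (l 1)) - pt (k * s^2 / 2) (k * s)"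
      using ch[of v s] c[of s] by (simp add: real2_eq_iff algebra_simps)
  qed
  then show ?thesis by blast
qed

end

section \<open>Diagonal matrices and the central reflection acting on split quadrilaterals\<close>

lemma glueable_diag:
  assumes "glueable a b {u} {v}" "t > 0"
  shows "glueable (t * a) (t * b) {lin t 0 0 (1/t) u} {lin t 0 0 (1/t) v}"
proof -
  obtain s where s: "u $ 1 + s * u $ 2 \<le> b" "v $ 1 + s * v $ 2 \<le> b"
    using assms(1) by (auto simp: glueable_def)
  obtain r where r: "- a \<le> u $ 1 + r * u $ 2" "- a \<le> v $ 1 + r * v $ 2"
    using assms(1) by (auto simp: glueable_def)
  have e: "t * x $ 1 + (t^2 * q) * (x $ 2 / t) = t * (x $ 1 + q * x $ 2)" for x :: "real^2" and q
    using assms(2) by (simp add: power2_eq_square algebra_simps)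
  have "t * u $ 1 + (t^2 * s) * (u $ 2 / t) \<le> t * b" "t * v $ 1 + (t^2 * s) * (v $ 2 / t) \<le> t * b"
    unfolding e using s assms(2) by (auto intro!: mult_left_mono)
  moreover have "t * (- a) \<le> t * u $ 1 + (t^2 * r) * (u $ 2 / t)" "t * (- a) \<le> t * v $ 1 + (t^2 * r) * (v $ 2 / t)"
    unfolding e using r assms(2) by (intro mult_left_mono; simp)+
  ultimately show ?thesis
    using glueableD[OF assms(1)] assms(2) unfolding glueable_def
    by (auto simp: divide_less_0_iff intro: exI[of _ "t^2 * s"] exI[of _ "t^2 * r"])
qed

lemma glueable_uminus:
  assumes "glueable a b {u} {v}"
  shows "glueable b a {- v} {- u}"
proof -
  obtain s where s: "u $ 1 + s * u $ 2 \<le> b" "v $ 1 + s * v $ 2 \<le> b"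
    using assms(1) by (auto simp: glueable_def)
  obtain r where r: "- a \<le> u $ 1 + r * u $ 2" "- a \<le> v $ 1 + r * v $ 2"
    using assms(1) by (auto simp: glueable_def)
  have "\<exists>q. \<forall>x\<in>{- v} \<union> {- u}. x $ 1 + q * x $ 2 \<le> a"
    using r by (intro exI[of _ r]) auto
  moreover have "\<exists>q. \<forall>x\<in>{- v} \<union> {- u}. - b \<le> x $ 1 + q * x $ 2"
    using s by (intro exI[of _ s]) auto
  ultimately show ?thesis
    using glueableD[OF assms(1)] unfolding glueable_def by auto
qed

context sl2_valuation
begin

lemma glued_diag:
  assumes "glueable a b {u} {v}" "t > 0"
  shows "\<mu> (glued (t * a) (t * b) {lin t 0 0 (1/t) u} {lin t 0 0 (1/t) v}) = lin t 0 0 (1/t) (\<mu> (glued a b {u} {v}))"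
proof -
  have "lin t 0 0 (1/t) ` glued a b {u} {v} = glued (t * a) (t * b) {lin t 0 0 (1/t) u} {lin t 0 0 (1/t) v}"
    by (simp add: glued_def lin_image_hull lin_pt)
  then show ?thesis
    using lin_equivariant[OF glued_in_polytopes_o[OF assms(1)], of t "1/t" 0 0] assms by simp
qed

lemma glued_uminus:
  assumes "glueable a b {u} {v}"
  shows "\<mu> (glued b a {- v} {- u}) = - \<mu> (glued a b {u} {v})"
proof -
  have m: "lin (-1) 0 0 (-1) x = - x" for x by (simp add: real2_eq_iff)
  have "lin (-1) 0 0 (-1) ` glued a b {u} {v} = glued b a {- v} {- u}"
  proof -
    have "- pt x y = pt (- x) (- y)" for x y by (simp add: real2_eq_iff)
    then have "lin (-1) 0 0 (-1) ` ({pt b 0, pt (-a) 0} \<union> {u} \<union> {v}) = {pt a 0, pt (-b) 0} \<union> {- v} \<union> {- u}"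
      by (auto simp: m)
    then show ?thesis by (simp only: glued_def lin_image_hull)
  qed
  then show ?thesis
    using lin_equivariant[OF glued_in_polytopes_o[OF assms(1)], of "-1" "-1" 0 0] by (simp add: m)
qed

text \<open>The matrix diag(t, 1/t) conjugates the shear by 1 into the shear by \<open>t^2\<close>
  and divides second coordinates by \<open>t\<close>. Comparing second coordinates gives
  \<open>k / t = k' * t^2\<close>.\<close>

lemma shear_split_scale:
  assumes D: "shear_split \<mu> a b k g h" "shear_split \<mu> (t * a) (t * b) k' g' h'" and pos: "0 < a" "0 < b" "0 < t"
  shows "k' = k / t^3"
proof -
  define e where "e = min a b"
  have e: "e > 0" using pos by (simp add: e_def)
  have ok: "glueable a b {pt 0 1} {pt 0 (-e)}" "glueable a b {shear 1 (pt 0 1)} {pt 0 (-e)}"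
    by (rule glueable_small; use pos e in \<open>simp add: e_def\<close>)+
  let ?L = "lin t 0 0 (1/t)"
  have L: "?L (shear 1 (pt 0 1)) = shear (t^2) (?L (pt 0 1))"
    using pos by (simp add: real2_eq_iff power2_eq_square)
  have "?L (g (shear 1 (pt 0 1)) + h (pt 0 (-e))) = g' (shear (t^2) (?L (pt 0 1))) + h' (?L (pt 0 (-e)))"
    using glued_diag[OF ok(2) pos(3)] shear_splitD(1)[OF D(1) ok(2)]
      shear_splitD(1)[OF D(2) glueable_diag[OF ok(2) pos(3)]] by (simp add: L)
  moreover have "?L (g (pt 0 1) + h (pt 0 (-e))) = g' (?L (pt 0 1)) + h' (?L (pt 0 (-e)))"
    using glued_diag[OF ok(1) pos(3)] shear_splitD(1)[OF D(1) ok(1)]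
      shear_splitD(1)[OF D(2) glueable_diag[OF ok(1) pos(3)]] by simp
  ultimately have "?L (g (shear 1 (pt 0 1)) - g (pt 0 1)) $ 2 = (g' (shear (t^2) (?L (pt 0 1))) - g' (?L (pt 0 1))) $ 2"
    by (simp add: lin_simps real2_eq_iff algebra_simps)
  moreover have "g (shear 1 (pt 0 1)) $ 2 = g (pt 0 1) $ 2 + k"
    using shear_splitD(2)[OF D(1), of "pt 0 1" 1] by simp
  moreover have "g' (shear (t^2) (?L (pt 0 1))) $ 2 = g' (?L (pt 0 1)) $ 2 + k' * t^2"
    using shear_splitD(2)[OF D(2), of "?L (pt 0 1)" "t^2"] pos by simp
  ultimately have "k / t = k' * t^2" by simp
  then show ?thesis using pos by (simp add: field_simps power2_eq_square power3_eq_cube)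
qed

text \<open>The central reflection interchanges the upper and the lower vertex and also the two ends
  of the diagonal. The sign it puts on the value is compensated by the opposite signs of the cocycle
  in \<open>g\<close> and in \<open>h\<close>.\<close>

lemma shear_split_swap:
  assumes D: "shear_split \<mu> a b k g h" "shear_split \<mu> b a k' g' h'" and pos: "0 < a" "0 < b"
  shows "k' = k"
proof -
  define e where "e = min a b"
  have e: "e > 0" using pos by (simp add: e_def)
  have ok: "glueable a b {pt 0 1} {pt 0 (-e)}" "glueable a b {shear 1 (pt 0 1)} {pt 0 (-e)}"
    by (rule glueable_small; use pos e in \<open>simp add: e_def\<close>)+
  have "- (g (shear 1 (pt 0 1)) + h (pt 0 (-e))) = g' (- pt 0 (-e)) + h' (- shear 1 (pt 0 1))"
    using glued_uminus[OF ok(2)] shear_splitD(1)[OF D(1) ok(2)]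
      shear_splitD(1)[OF D(2) glueable_uminus[OF ok(2)]] by simp
  moreover have "- (g (pt 0 1) + h (pt 0 (-e))) = g' (- pt 0 (-e)) + h' (- pt 0 1)"
    using glued_uminus[OF ok(1)] shear_splitD(1)[OF D(1) ok(1)]
      shear_splitD(1)[OF D(2) glueable_uminus[OF ok(1)]] by simp
  ultimately have "(- g (shear 1 (pt 0 1)) + g (pt 0 1)) $ 2 = (h' (- shear 1 (pt 0 1)) - h' (- pt 0 1)) $ 2"
    by (simp add: real2_eq_iff algebra_simps)
  moreover have "g (shear 1 (pt 0 1)) $ 2 = g (pt 0 1) $ 2 + k"
    using shear_splitD(2)[OF D(1), of "pt 0 1" 1] by simp
  moreover have "- shear 1 (pt 0 1) = shear 1 (- pt 0 1)" by (simp add: real2_eq_iff)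
  moreover have "h' (shear 1 (- pt 0 1)) $ 2 = h' (- pt 0 1) $ 2 - k'"
    using shear_splitD(3)[OF D(2), of "- pt 0 1" 1] by simp
  ultimately show ?thesis by simp
qed

text \<open>Shearing the whole polygon is governed by equivariance. Moving the lower vertex from
  \<open>shear s v\<close> back to \<open>v\<close> is an exchange against a quadrilateral with a
  low apex \<open>u\<close>, where the split evaluates the change. In this way \<open>U\<close> may
  consist of several vertices although the split speaks of single ones only.\<close>

lemma glued_shear_upper:
  assumes D: "shear_split \<mu> a b k g h" and ok: "glueable a b U {v}" "glueable a b (shear s ` U) {v}"
  shows "\<mu> (glued a b (shear s ` U) {v}) = shear s (\<mu> (glued a b U {v})) + pt (k * s^2 / 2 - s * h v $ 2) (k * s)"
proof -
  have pos: "0 < a" "0 < b" "v $ 2 < 0" using glueableD[OF ok(1)] by auto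
  obtain d where d: "d > 0" "\<And>x. 0 < x \<Longrightarrow> x \<le> d \<Longrightarrow> glueable a b {pt 0 x} {v}"
    using glueable_small_upper_ex[OF pos] by blast
  obtain e where e: "e > 0" "\<And>x. 0 < x \<Longrightarrow> x \<le> e \<Longrightarrow> glueable a b {pt 0 x} {shear s v}"
    using glueable_small_upper_ex[OF pos(1,2), of "shear s v"] pos by auto
  define u where "u = pt 0 (min d e)"
  have u: "glueable a b {u} {v}" "glueable a b {u} {shear s v}" using d e by (auto simp: u_def)
  have ok': "glueable a b (shear s ` U) {shear s v}" using glueable_shear_iff[of a b s U "{v}"] ok by simp
  have "\<mu> (glued a b (shear s ` U) {v}) + \<mu> (glued a b {u} {shear s v})
      = \<mu> (glued a b (shear s ` U) {shear s v}) + \<mu> (glued a b {u} {v})"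
    by (rule glued_exchange) fact+
  moreover have "\<mu> (glued a b (shear s ` U) {shear s v}) = shear s (\<mu> (glued a b U {v}))"
    using glued_shear[OF ok(1), of s] by simp
  moreover have "\<mu> (glued a b {u} {v}) = g u + h v" "\<mu> (glued a b {u} {shear s v}) = g u + h (shear s v)"
    using shear_splitD(1)[OF D] u by auto
  moreover have "h (shear s v) = shear s (h v) - pt (k * s^2 / 2) (k * s)"
    using shear_splitD(3)[OF D pos(3)] .
  ultimately show ?thesis by (simp add: real2_eq_iff algebra_simps)
qed

end

text \<open>Since \<open>\<bar>s\<bar> < w\<close>, the top edge at height 1 passes over the second
  axis, and the section with that axis is the segment from \<open>pt 0 (-1)\<close> to
  \<open>pt 0 1\<close> for all admissible \<open>a\<close>, \<open>b\<close>, \<open>s\<close>. The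
  right half does not see \<open>a\<close> and the left half does not see \<open>b\<close>.\<close>

lemma flat_top_halves:
  assumes "0 < a" "0 < b" "\<bar>s\<bar> < w" "w + \<bar>s\<bar> < min a b"
  shows "glued a b {pt (s + w) 1, pt (s - w) 1} {pt 0 (-1)} \<inter> {x. pt 1 0 \<bullet> x \<ge> 0}
      = convex hull {pt b 0, pt (s + w) 1, pt 0 1, pt 0 (-1)}"
    "glued a b {pt (s + w) 1, pt (s - w) 1} {pt 0 (-1)} \<inter> {x. pt 1 0 \<bullet> x \<le> 0}
      = convex hull {pt (-a) 0, pt (s - w) 1, pt 0 1, pt 0 (-1)}"
proof -
  let ?S = "{pt b 0, pt (-a) 0} \<union> {pt (s + w) 1, pt (s - w) 1} \<union> {pt 0 (-1)}"
  have bounds: "\<bar>x $ 2\<bar> \<le> 1" if "x \<in> convex hull ?S" for x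
  proof -
    have "pt 0 1 \<bullet> x \<le> 1" "pt 0 (-1) \<bullet> x \<le> 1"
      by (rule halfplane_hull[OF _ that]; auto simp: inner_real2)+
    then show ?thesis by (simp add: inner_real2)
  qed
  have axis: "x \<in> convex hull T" if x: "x \<in> convex hull ?S" "x $ 1 = 0" and T: "{pt 0 1, pt 0 (-1)} \<subseteq> T" for x T
  proof -
    have "((1 + x $ 2) / 2) *\<^sub>R pt 0 1 + ((1 - x $ 2) / 2) *\<^sub>R pt 0 (-1) \<in> convex hull T"
      using bounds[OF x(1)] T by (intro convexD[OF convex_convex_hull] hull_inc) (auto simp: add_divide_distrib[symmetric])
    moreover have "((1 + x $ 2) / 2) *\<^sub>R pt 0 1 + ((1 - x $ 2) / 2) *\<^sub>R pt 0 (-1) = x"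
      using x by (simp add: real2_eq_iff field_simps)
    ultimately show ?thesis by simp
  qed
  have top: "pt 0 1 \<in> convex hull ?S"
  proof -
    have "((w - s) / (2 * w)) *\<^sub>R pt (s + w) 1 + ((w + s) / (2 * w)) *\<^sub>R pt (s - w) 1 \<in> convex hull ?S"
      using assms by (intro convexD[OF convex_convex_hull] hull_inc) (auto simp: add_divide_distrib[symmetric])
    moreover have "((w - s) / (2 * w)) *\<^sub>R pt (s + w) 1 + ((w + s) / (2 * w)) *\<^sub>R pt (s - w) 1 = pt 0 1"
      using assms by (simp add: real2_eq_iff field_simps)
    ultimately show ?thesis by simp
  qed
  show "glued a b {pt (s + w) 1, pt (s - w) 1} {pt 0 (-1)} \<inter> {x. pt 1 0 \<bullet> x \<ge> 0}
      = convex hull {pt b 0, pt (s + w) 1, pt 0 1, pt 0 (-1)}"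
    unfolding glued_def
  proof (rule hull_halfspace)
    show "x \<in> convex hull {pt b 0, pt (s + w) 1, pt 0 1, pt 0 (-1)}" if "x \<in> convex hull ?S" "pt 1 0 \<bullet> x = 0" for x
      using that by (intro axis[OF that(1)]) (auto simp: inner_real2)
    show "{pt b 0, pt (s + w) 1, pt 0 1, pt 0 (-1)} \<subseteq> convex hull ?S" using top by (auto intro: hull_inc)
  qed (use assms in \<open>auto simp: inner_real2\<close>)
  have "glued a b {pt (s + w) 1, pt (s - w) 1} {pt 0 (-1)} \<inter> {x. pt (-1) 0 \<bullet> x \<ge> 0}
      = convex hull {pt (-a) 0, pt (s - w) 1, pt 0 1, pt 0 (-1)}"
    unfolding glued_def
  proof (rule hull_halfspace)
    show "x \<in> convex hull {pt (-a) 0, pt (s - w) 1, pt 0 1, pt 0 (-1)}" if "x \<in> convex hull ?S" "pt (-1) 0 \<bullet> x = 0" for x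
      using that by (intro axis[OF that(1)]) (auto simp: inner_real2)
    show "{pt (-a) 0, pt (s - w) 1, pt 0 1, pt 0 (-1)} \<subseteq> convex hull ?S" using top by (auto intro: hull_inc)
  qed (use assms in \<open>auto simp: inner_real2\<close>)
  then show "glued a b {pt (s + w) 1, pt (s - w) 1} {pt 0 (-1)} \<inter> {x. pt 1 0 \<bullet> x \<le> 0}
      = convex hull {pt (-a) 0, pt (s - w) 1, pt 0 1, pt 0 (-1)}"
    by (simp add: inner_real2)
qed

lemma flat_top_glueable:
  assumes "0 < a" "0 < b" "\<bar>s\<bar> < w" "w + \<bar>s\<bar> < min a b"
  shows "glueable a b {pt (s + w) 1, pt (s - w) 1} {pt 0 (-1)}"
  using assms unfolding glueable_def by (auto intro!: exI[of _ 0])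

context sl2_valuation
begin

text \<open>A flat top keeps the section along the second axis fixed while it is sheared, which separates
  the contributions of the two endpoints of the first axis.\<close>
lemma shear_split_mixed:
  assumes pos: "0 < a" "0 < b" "0 < a'" "0 < b'"
    and D: "shear_split \<mu> a b k1 g1 h1" "shear_split \<mu> a' b' k2 g2 h2"
      "shear_split \<mu> a b' k3 g3 h3" "shear_split \<mu> a' b k4 g4 h4"
  shows "k1 + k2 = k3 + k4"
    "k1 = 0 \<Longrightarrow> k2 = 0 \<Longrightarrow> k3 = 0 \<Longrightarrow> k4 = 0 \<Longrightarrow>
      h1 (pt 0 (-1)) $ 2 + h2 (pt 0 (-1)) $ 2 = h3 (pt 0 (-1)) $ 2 + h4 (pt 0 (-1)) $ 2"
proof -
  define m where "m = min (min a b) (min a' b')"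
  have m: "m > 0" "m \<le> a" "m \<le> b" "m \<le> a'" "m \<le> b'" using pos by (auto simp: m_def)
  \<comment> \<open>Half-width \<open>m / 2\<close> and shear \<open>m / 4\<close> keep the flat top
    over the second axis and within all four diagonals, both before and after the shear.\<close>
  define w where "w = m / 2"
  define s where "s = m / 4"
  have sw: "s > 0" "s < w" "w + s < m" using m by (auto simp: w_def s_def)
  define F where "F a b s = \<mu> (glued a b {pt (s + w) 1, pt (s - w) 1} {pt 0 (-1)})" for a b s
  have exch: "F a b r + F a' b' r = F a b' r + F a' b r" if r: "r = 0 \<or> r = s" for r
  proof -
    have ok: "glued p q {pt (r + w) 1, pt (r - w) 1} {pt 0 (-1)} \<in> polytopes_o"
      and right: "glued p q {pt (r + w) 1, pt (r - w) 1} {pt 0 (-1)} \<inter> {x. pt 1 0 \<bullet> x \<ge> 0}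
        = convex hull {pt q 0, pt (r + w) 1, pt 0 1, pt 0 (-1)}"
      and left: "glued p q {pt (r + w) 1, pt (r - w) 1} {pt 0 (-1)} \<inter> {x. pt 1 0 \<bullet> x \<le> 0}
        = convex hull {pt (-p) 0, pt (r - w) 1, pt 0 1, pt 0 (-1)}" if "m \<le> p" "m \<le> q" for p q
    proof -
      have c: "0 < p" "0 < q" "\<bar>r\<bar> < w" "w + \<bar>r\<bar> < min p q" using that r m sw by auto
      show "glued p q {pt (r + w) 1, pt (r - w) 1} {pt 0 (-1)} \<in> polytopes_o"
        using glued_in_polytopes_o[OF flat_top_glueable[OF c]] .
      show "glued p q {pt (r + w) 1, pt (r - w) 1} {pt 0 (-1)} \<inter> {x. pt 1 0 \<bullet> x \<ge> 0}
        = convex hull {pt q 0, pt (r + w) 1, pt 0 1, pt 0 (-1)}"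
        "glued p q {pt (r + w) 1, pt (r - w) 1} {pt 0 (-1)} \<inter> {x. pt 1 0 \<bullet> x \<le> 0}
        = convex hull {pt (-p) 0, pt (r - w) 1, pt 0 1, pt 0 (-1)}"
        using flat_top_halves[OF c] .
    qed
    have "F a b r + F a' b' r = F a' b r + F a b' r"
      unfolding F_def
      by (rule valuation_exchange[OF valuation, where n="pt 1 0"]) (use m in \<open>simp_all only: ok right left\<close>)
    then show ?thesis by simp
  qed
  have step: "F p q s = shear s (F p q 0) + pt (k * s^2 / 2 - s * h (pt 0 (-1)) $ 2) (k * s)"
    if "shear_split \<mu> p q k g h" "p \<in> {a, a'}" "q \<in> {b, b'}" for p q k g h
  proof -
    have ok: "glueable p q {pt (0 + w) 1, pt (0 - w) 1} {pt 0 (-1)}" "glueable p q {pt (s + w) 1, pt (s - w) 1} {pt 0 (-1)}"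
      by (rule flat_top_glueable; use that m sw pos in auto)+
    have im: "shear s ` {pt (0 + w) 1, pt (0 - w) 1} = {pt (s + w) 1, pt (s - w) 1}"
      by (simp add: lin_pt add.commute)
    show ?thesis using glued_shear_upper[OF that(1) ok(1), of s] ok(2) unfolding im F_def by simp
  qed
  \<comment> \<open>The exchange identity holds before and after the shear. The sheared initial
    values cancel, and only the correction terms are left to be compared.\<close>
  have eq: "pt (k1 * s^2 / 2 - s * h1 (pt 0 (-1)) $ 2) (k1 * s) + pt (k2 * s^2 / 2 - s * h2 (pt 0 (-1)) $ 2) (k2 * s)
      = pt (k3 * s^2 / 2 - s * h3 (pt 0 (-1)) $ 2) (k3 * s) + pt (k4 * s^2 / 2 - s * h4 (pt 0 (-1)) $ 2) (k4 * s)" (is "?E = ?E'")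
  proof -
    have S: "shear s (F a b 0) + shear s (F a' b' 0) = shear s (F a b' 0) + shear s (F a' b 0)"
      using exch[of 0] by (metis lin_simps(1))
    have "(shear s (F a b 0) + shear s (F a' b' 0)) + ?E = F a b s + F a' b' s"
      by (simp add: step[OF D(1)] step[OF D(2)])
    also have "\<dots> = F a b' s + F a' b s" using exch by blast
    also have "\<dots> = (shear s (F a b' 0) + shear s (F a' b 0)) + ?E'"
      by (simp add: step[OF D(3)] step[OF D(4)])
    finally show ?thesis unfolding S by simp
  qed
  then have "(k1 + k2) * s = (k3 + k4) * s" by (simp add: real2_eq_iff distrib_right)
  then show "k1 + k2 = k3 + k4" using sw by simp
  assume "k1 = 0" "k2 = 0" "k3 = 0" "k4 = 0"
  then have "s * (h1 (pt 0 (-1)) $ 2 + h2 (pt 0 (-1)) $ 2) = s * (h3 (pt 0 (-1)) $ 2 + h4 (pt 0 (-1)) $ 2)"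
    using eq by (simp add: real2_eq_iff algebra_simps)
  then show "h1 (pt 0 (-1)) $ 2 + h2 (pt 0 (-1)) $ 2 = h3 (pt 0 (-1)) $ 2 + h4 (pt 0 (-1)) $ 2"
    using sw by simp
qed

end

text \<open>Expresses the shear coefficient without reference to a chosen splitting. In this form it
  is linear in \<open>\<mu>\<close>, so a twist can be removed by subtracting a multiple of another
  valuation.\<close>

definition twist :: "((real^2) set \<Rightarrow> real^2) \<Rightarrow> real \<Rightarrow> bool" where
  "twist \<mu> K \<longleftrightarrow> (\<forall>a b u v s. glueable a b {u} {v} \<longrightarrow> glueable a b {shear s u} {v} \<longrightarrow>
     \<mu> (glued a b {shear s u} {v}) $ 2 - \<mu> (glued a b {u} {v}) $ 2 = K * (1 / a^3 + 1 / b^3) * s)"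

context sl2_valuation
begin

text \<open>Diagonal matrices determine the coefficient for equal ends up to the factor
  \<open>k 1 1\<close>. The flat-top identity for the diagonals \<open>(a, b)\<close> and
  \<open>(b, a)\<close> against \<open>(a, a)\<close> and \<open>(b, b)\<close>, with the symmetry
  under reflection, expresses the general coefficient as the mean of these.\<close>

lemma twist_ex: "\<exists>K. twist \<mu> K"
proof -
  have "\<exists>k. \<forall>a b. 0 < a \<longrightarrow> 0 < b \<longrightarrow> (\<exists>g h. shear_split \<mu> a b (k a b) g h)"
    using shear_split_ex by metis
  then obtain k where k: "\<And>a b. 0 < a \<Longrightarrow> 0 < b \<Longrightarrow> \<exists>g h. shear_split \<mu> a b (k a b) g h"
    by blast
  have diag: "k a a = k 1 1 * (1 / a^3)" if "a > 0" for a
    using k[of 1 1] k[of a a] shear_split_scale[of 1 1 "k 1 1" _ _ a "k a a"] that by auto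
  have swap: "k b a = k a b" if "0 < a" "0 < b" for a b
    using k[of a b] k[of b a] shear_split_swap that by blast
  have kk: "k a b = k 1 1 / 2 * (1 / a^3 + 1 / b^3)" if ab: "0 < a" "0 < b" for a b
  proof -
    obtain g1 h1 g2 h2 g3 h3 g4 h4 where D: "shear_split \<mu> a b (k a b) g1 h1" "shear_split \<mu> b a (k b a) g2 h2"
      "shear_split \<mu> a a (k a a) g3 h3" "shear_split \<mu> b b (k b b) g4 h4"
      using k ab by metis
    have "k a b + k b a = k a a + k b b"
      by (rule shear_split_mixed(1)[OF ab(1,2) ab(2,1) D])
    then show ?thesis using diag[OF ab(1)] diag[OF ab(2)] swap[OF ab] by (simp add: algebra_simps)
  qed
  have "twist \<mu> (k 1 1 / 2)"
    unfolding twist_def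
  proof (intro allI impI)
    fix a b u v s assume ok: "glueable a b {u} {v}" "glueable a b {shear s u} {v}"
    then have pos: "0 < a" "0 < b" "u $ 2 > 0" by (auto simp: glueable_def)
    obtain g h where D: "shear_split \<mu> a b (k a b) g h" using k pos by blast
    show "\<mu> (glued a b {shear s u} {v}) $ 2 - \<mu> (glued a b {u} {v}) $ 2 = k 1 1 / 2 * (1 / a^3 + 1 / b^3) * s"
      using shear_splitD(1)[OF D ok(1)] shear_splitD(1)[OF D ok(2)] shear_splitD(2)[OF D pos(3), of s] kk[OF pos(1,2)]
      by simp
  qed
  then show ?thesis by blast
qed

lemma shear_split_twist:
  assumes "twist \<mu> K" "shear_split \<mu> a b k g h" "0 < a" "0 < b"
  shows "k = K * (1 / a^3 + 1 / b^3)"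
proof -
  define e where "e = min a b"
  have e: "e > 0" using assms by (simp add: e_def)
  have ok: "glueable a b {pt 0 1} {pt 0 (-e)}" "glueable a b {shear 1 (pt 0 1)} {pt 0 (-e)}"
    by (rule glueable_small; use assms e in \<open>simp add: e_def\<close>)+
  have "\<mu> (glued a b {shear 1 (pt 0 1)} {pt 0 (-e)}) $ 2 - \<mu> (glued a b {pt 0 1} {pt 0 (-e)}) $ 2
      = K * (1 / a^3 + 1 / b^3) * 1"
    using assms(1) ok unfolding twist_def by blast
  then show ?thesis
    using shear_splitD(1)[OF assms(2) ok(1)] shear_splitD(1)[OF assms(2) ok(2)]
      shear_splitD(2)[OF assms(2), of "pt 0 1" 1] by simp
qed

end

section \<open>Edge sums and triangles\<close>

definition det2 :: "real^2 \<Rightarrow> real^2 \<Rightarrow> real" where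
  "det2 p q = p $ 1 * q $ 2 - p $ 2 * q $ 1"

text \<open>The determinant is the SL(2) invariant of an ordered pair of vectors, so coefficients
  depending on it alone make the term equivariant.\<close>

definition edge_term :: "(real \<Rightarrow> real) \<Rightarrow> (real \<Rightarrow> real) \<Rightarrow> real^2 \<Rightarrow> real^2 \<Rightarrow> real^2" where
  "edge_term B1 B2 p q = B2 (det2 p q) *\<^sub>R p + B1 (det2 p q) *\<^sub>R q"

definition edge_sum :: "(real^2 \<Rightarrow> real^2 \<Rightarrow> real^2) \<Rightarrow> real \<Rightarrow> real \<Rightarrow> real^2 \<Rightarrow> real^2 \<Rightarrow> real^2" where
  "edge_sum E a b u v = E (pt b 0) u + E u (pt (-a) 0) + E (pt (-a) 0) v + E v (pt b 0)"

context sl2_valuation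
begin

text \<open>Without twist both summands commute with shears. Each is therefore a multiple of its
  vertex plus a vector along the first axis, both depending only on the height. The multiple is
  shown to separate into contributions of the two adjacent edges, and the leftover first coordinate
  is recovered by a quarter turn.\<close>

lemma edge_sum_ex:
  assumes tw: "twist \<mu> 0"
  obtains B1 B2 where
    "\<And>a b u v. glueable a b {u} {v} \<Longrightarrow> \<mu> (glued a b {u} {v}) = edge_sum (edge_term B1 B2) a b u v"
proof -
  have "\<exists>g h. shear_split \<mu> a b 0 g h" if "0 < a" "0 < b" for a b
    using shear_split_ex[OF that] shear_split_twist[OF tw _ that] by fastforce
  then obtain g h where D: "\<And>a b. 0 < a \<Longrightarrow> 0 < b \<Longrightarrow> shear_split \<mu> a b 0 (g a b) (h a b)"
    by metis
  define B where "B a b y = g a b (pt 0 y) $ 2 / y" for a b y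
  define C where "C a b y = - h a b (pt 0 (-y)) $ 2 / y" for a b y
  have gf: "g a b u = pt (g a b (pt 0 (u $ 2)) $ 1) 0 + B a b (u $ 2) *\<^sub>R u" if "0 < a" "0 < b" "u $ 2 > 0" for a b u
  proof -
    have "shear (u $ 1 / u $ 2) (pt 0 (u $ 2)) = u" using that by (simp add: real2_eq_iff)
    moreover have "pt 0 0 = 0" by (simp add: real2_eq_iff)
    ultimately have "g a b u = shear (u $ 1 / u $ 2) (g a b (pt 0 (u $ 2)))"
      using shear_splitD(2)[OF D[OF that(1,2)], of "pt 0 (u $ 2)" "u $ 1 / u $ 2"] that(3) by simp
    then show ?thesis using that by (simp add: real2_eq_iff B_def)
  qed
  have hf: "h a b v = pt (h a b (pt 0 (v $ 2)) $ 1) 0 + C a b (- v $ 2) *\<^sub>R v" if "0 < a" "0 < b" "v $ 2 < 0" for a b v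
  proof -
    have "shear (v $ 1 / v $ 2) (pt 0 (v $ 2)) = v" using that by (simp add: real2_eq_iff)
    moreover have "pt 0 0 = 0" by (simp add: real2_eq_iff)
    ultimately have "h a b v = shear (v $ 1 / v $ 2) (h a b (pt 0 (v $ 2)))"
      using shear_splitD(3)[OF D[OF that(1,2)], of "pt 0 (v $ 2)" "v $ 1 / v $ 2"] that(3) by simp
    then show ?thesis using that by (simp add: real2_eq_iff C_def)
  qed
  have gd: "g a b (pt x y) $ 1 = g a b (pt 0 y) $ 1 + B a b y * x" if "0 < a" "0 < b" "0 < y" for a b x y
    using arg_cong[OF gf[of a b "pt x y"], of "\<lambda>z. z $ 1"] that by simp
  have hd: "h a b (pt x (-y)) $ 1 = h a b (pt 0 (-y)) $ 1 + C a b y * x" if "0 < a" "0 < b" "0 < y" for a b x y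
    using arg_cong[OF hf[of a b "pt x (-y)"], of "\<lambda>z. z $ 1"] that by simp
  \<comment> \<open>A diagonal matrix preserves the products \<open>a * y\<close> and
    \<open>b * y\<close>, the determinants of the two upper edges. The coefficient of the upper
    vertex depends on these alone.\<close>
  have Bscale: "B (t * a) (t * b) (y / t) = B a b y" if pos: "0 < a" "0 < b" "0 < t" "0 < y" for a b t y
  proof -
    define e where "e = min a b"
    have e: "e > 0" using pos by (simp add: e_def)
    have ok: "glueable a b {pt 0 y} {pt 0 (-e)}" "glueable a b {pt y y} {pt 0 (-e)}"
      by (rule glueable_small; use pos e in \<open>simp add: e_def\<close>)+
    let ?L = "lin t 0 0 (1/t)"
    have ta: "0 < t * a" "0 < t * b" using pos by auto
    have "?L (g a b (pt y y) + h a b (pt 0 (-e))) = g (t * a) (t * b) (?L (pt y y)) + h (t * a) (t * b) (?L (pt 0 (-e)))"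
      using glued_diag[OF ok(2) pos(3)] shear_splitD(1)[OF D ok(2)]
        shear_splitD(1)[OF D glueable_diag[OF ok(2) pos(3)]] pos ta by simp
    moreover have "?L (g a b (pt 0 y) + h a b (pt 0 (-e))) = g (t * a) (t * b) (?L (pt 0 y)) + h (t * a) (t * b) (?L (pt 0 (-e)))"
      using glued_diag[OF ok(1) pos(3)] shear_splitD(1)[OF D ok(1)]
        shear_splitD(1)[OF D glueable_diag[OF ok(1) pos(3)]] pos ta by simp
    ultimately have "(?L (g a b (pt y y) - g a b (pt 0 y))) $ 1 = (g (t * a) (t * b) (?L (pt y y)) - g (t * a) (t * b) (?L (pt 0 y))) $ 1"
      by (simp add: lin_simps real2_eq_iff algebra_simps)
    then have "t * (g a b (pt y y) $ 1 - g a b (pt 0 y) $ 1) = g (t * a) (t * b) (pt (t * y) (y / t)) $ 1 - g (t * a) (t * b) (pt 0 (y / t)) $ 1"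
      by (simp add: lin_pt)
    then have "t * (B a b y * y) = B (t * a) (t * b) (y / t) * (t * y)"
      using gd[of a b y y] gd[of "t * a" "t * b" "y / t" "t * y"] pos by simp
    then show ?thesis using pos by (simp add: field_simps)
  qed
  have CB: "C a b y = B b a y" if pos: "0 < a" "0 < b" "0 < y" for a b y
  proof -
    define e where "e = min a b"
    have e: "e > 0" using pos by (simp add: e_def)
    have ok: "glueable a b {pt 0 e} {pt 0 (-y)}" "glueable a b {pt 0 e} {pt (-y) (-y)}"
      by (rule glueable_small_upper; use pos e in \<open>simp add: e_def\<close>)+
    have "- (g a b (pt 0 e) + h a b (pt (-y) (-y))) = g b a (- pt (-y) (-y)) + h b a (- pt 0 e)"
      using glued_uminus[OF ok(2)] shear_splitD(1)[OF D ok(2)]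
        shear_splitD(1)[OF D glueable_uminus[OF ok(2)]] pos by simp
    moreover have "- (g a b (pt 0 e) + h a b (pt 0 (-y))) = g b a (- pt 0 (-y)) + h b a (- pt 0 e)"
      using glued_uminus[OF ok(1)] shear_splitD(1)[OF D ok(1)]
        shear_splitD(1)[OF D glueable_uminus[OF ok(1)]] pos by simp
    ultimately have "(h a b (pt 0 (-y)) - h a b (pt (-y) (-y))) $ 1 = (g b a (- pt (-y) (-y)) - g b a (- pt 0 (-y))) $ 1"
      by (simp add: real2_eq_iff algebra_simps)
    moreover have "- pt (-y) (-y) = pt y y" "- pt 0 (-y) = pt 0 y" by (simp_all add: real2_eq_iff)
    ultimately have "C a b y * y = B b a y * y"
      using hd[of a b y "-y"] gd[of b a y y] pos by simp
    then show ?thesis using pos by simp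
  qed
  \<comment> \<open>The second flat-top identity, carried over from lower to upper vertices by the
    reflection, makes the dependence on the two ends of the diagonal additive.\<close>
  have mixed: "B a b 1 + B a' b' 1 = B a b' 1 + B a' b 1" if "0 < a" "0 < b" "0 < a'" "0 < b'" for a b a' b'
  proof -
    have "h b a (pt 0 (-1)) $ 2 + h b' a' (pt 0 (-1)) $ 2 = h b a' (pt 0 (-1)) $ 2 + h b' a (pt 0 (-1)) $ 2"
      by (rule shear_split_mixed(2)[OF _ _ _ _ D D D D]) (use that in auto)
    then have "C b a 1 + C b' a' 1 = C b a' 1 + C b' a 1" by (simp add: C_def)
    then show ?thesis using that by (simp add: CB)
  qed
  define B1 where "B1 x = B 1 x 1 - B 1 1 1" for x
  define B2 where "B2 x = B x 1 1" for x
  have BB: "B a b y = B1 (b * y) + B2 (a * y)" if pos: "0 < a" "0 < b" "0 < y" for a b y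
    using Bscale[of a b y y] mixed[of "a * y" "b * y" 1 1] pos by (simp add: B1_def B2_def mult.commute)
  \<comment> \<open>When both diagonals lie on the axes, a quarter turn exchanges their roles. The
    unknown first coordinate becomes, up to sign, a second coordinate of the turned quadrilateral,
    which the coefficients \<open>B\<close> and \<open>C\<close> already describe.\<close>
  have rhomb: "g a b (pt 0 y) $ 1 + h a b (pt 0 (-d)) $ 1 = b * B y d b - a * B d y a"
    if pos: "0 < a" "0 < b" "0 < y" "0 < d" for a b y d
  proof -
    have ok: "glueable d y {pt 0 a} {pt 0 (-b)}" "glueable a b {pt 0 y} {pt 0 (-d)}"
      by (rule glueable_small; use pos in simp)+
    have "lin 0 (-1) 1 0 ` ({pt y 0, pt (-d) 0} \<union> {pt 0 a} \<union> {pt 0 (-b)}) = {pt b 0, pt (-a) 0} \<union> {pt 0 y} \<union> {pt 0 (-d)}"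
      by (auto simp: lin_pt)
    then have "lin 0 (-1) 1 0 ` glued d y {pt 0 a} {pt 0 (-b)} = glued a b {pt 0 y} {pt 0 (-d)}"
      by (simp only: glued_def lin_image_hull)
    then have "\<mu> (glued a b {pt 0 y} {pt 0 (-d)}) = lin 0 (-1) 1 0 (\<mu> (glued d y {pt 0 a} {pt 0 (-b)}))"
      using lin_equivariant[OF glued_in_polytopes_o[OF ok(1)], of 0 0 "-1" 1] by simp
    then have "(g a b (pt 0 y) + h a b (pt 0 (-d))) $ 1 = - (g d y (pt 0 a) + h d y (pt 0 (-b))) $ 2"
      using shear_splitD(1)[OF D ok(1)] shear_splitD(1)[OF D ok(2)] pos by simp
    moreover have "g d y (pt 0 a) $ 2 = a * B d y a" "h d y (pt 0 (-b)) $ 2 = - b * C d y b"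
      using pos by (simp_all add: B_def C_def)
    ultimately show ?thesis using CB[of d y b] pos by simp
  qed
  have "\<mu> (glued a b {u} {v}) = edge_sum (edge_term B1 B2) a b u v" if ok: "glueable a b {u} {v}" for a b u v
  proof -
    have pos: "0 < a" "0 < b" "0 < u $ 2" "0 < - v $ 2" "v $ 2 < 0" using glueableD[OF ok] by auto
    have "\<mu> (glued a b {u} {v}) = g a b u + h a b v" using shear_splitD(1)[OF D ok] pos by simp
    also have "\<dots> = pt (g a b (pt 0 (u $ 2)) $ 1 + h a b (pt 0 (- (- v $ 2))) $ 1) 0 + B a b (u $ 2) *\<^sub>R u + B b a (- v $ 2) *\<^sub>R v"
      using gf[OF pos(1,2,3)] hf[OF pos(1,2,5)] CB[OF pos(1,2,4)] by (simp add: real2_eq_iff)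
    also have "\<dots> = edge_sum (edge_term B1 B2) a b u v"
      unfolding rhomb[OF pos(1,2,3,4)] BB[OF pos(1,2,3)] BB[OF pos(2,1,4)] BB[OF pos(3,4,2)] BB[OF pos(4,3,1)]
      by (simp add: edge_sum_def edge_term_def det2_def real2_eq_iff algebra_simps)
    finally show ?thesis .
  qed
  then show ?thesis using that by blast
qed

end

section \<open>Triangles as degenerate quadrilaterals\<close>

lemma det2_lin: "a * d - b * c = 1 \<Longrightarrow> det2 (lin a b c d p) (lin a b c d q) = det2 p q"
proof -
  assume *: "a * d - b * c = 1"
  have "det2 (lin a b c d p) (lin a b c d q) = (a * d - b * c) * det2 p q"
    by (simp add: det2_def algebra_simps)
  then show ?thesis using * by simp
qed

lemma edge_term_lin:
  "a * d - b * c = 1 \<Longrightarrow> edge_term B1 B2 (lin a b c d p) (lin a b c d q) = lin a b c d (edge_term B1 B2 p q)"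
  by (simp add: edge_term_def det2_lin lin_simps)

text \<open>The three inequalities say that the origin lies in the interior of the triangle and that its
  vertices are listed counter-clockwise.\<close>
definition around_zero :: "real^2 \<Rightarrow> real^2 \<Rightarrow> real^2 \<Rightarrow> bool" where
  "around_zero p q r \<longleftrightarrow> det2 p q > 0 \<and> det2 q r > 0 \<and> det2 r p > 0"

text \<open>By the linear relation of \<open>det2_cyclic\<close>, this is the point where the line
  from \<open>p\<close> through the origin leaves the triangle: it divides the edge from
  \<open>q\<close> to \<open>r\<close> with weights proportional to \<open>det2 r p\<close> and
  \<open>det2 p q\<close>.\<close>

definition opposite_point :: "real^2 \<Rightarrow> real^2 \<Rightarrow> real^2 \<Rightarrow> real^2" where
  "opposite_point p q r = (- det2 q r / (det2 r p + det2 p q)) *\<^sub>R p"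

lemma det2_cyclic: "det2 q r *\<^sub>R p + det2 r p *\<^sub>R q + det2 p q *\<^sub>R r = 0"
  by (simp add: real2_eq_iff det2_def algebra_simps)

text \<open>The diagonal from \<open>p\<close> ends on the opposite edge, so its second end is
  redundant as a vertex. \<open>L\<close> has determinant 1, takes the first unit vector to
  \<open>p\<close> and a point of the second axis to \<open>q\<close>; the coordinates of the two
  other points are then forced.\<close>

lemma triangle_eq_glued:
  assumes tri: "around_zero p q r"
  defines "D \<equiv> det2 p q" and "A \<equiv> det2 q r" and "B \<equiv> det2 r p"
  defines "L \<equiv> lin (p $ 1) (q $ 1 / D) (p $ 2) (q $ 2 / D)"
  shows "p $ 1 * (q $ 2 / D) - q $ 1 / D * p $ 2 = 1"
    "glueable (A / (B + D)) 1 {pt 0 D} {pt (- A / D) (- B)}"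
    "L (pt 1 0) = p" "L (pt 0 D) = q" "L (pt (- A / (B + D)) 0) = opposite_point p q r" "L (pt (- A / D) (- B)) = r"
    "L ` glued (A / (B + D)) 1 {pt 0 D} {pt (- A / D) (- B)} = convex hull {p, q, r}"
proof -
  have pos: "D > 0" "A > 0" "B > 0" using tri by (auto simp: around_zero_def D_def A_def B_def)
  show "p $ 1 * (q $ 2 / D) - q $ 1 / D * p $ 2 = 1"
    using pos(1) by (simp add: diff_divide_distrib[symmetric] D_def det2_def algebra_simps)
  have "\<exists>s. \<forall>x\<in>{pt 0 D} \<union> {pt (- A / D) (- B)}. x $ 1 + s * x $ 2 \<le> 1"
    using pos by (intro exI[of _ 0]) (auto intro: order_trans[of _ 0])
  moreover have "\<exists>s. \<forall>x\<in>{pt 0 D} \<union> {pt (- A / D) (- B)}. - (A / (B + D)) \<le> x $ 1 + s * x $ 2"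
  proof (intro exI[of _ "- (A / (B + D)) / D"] ballI)
    fix x assume x: "x \<in> {pt 0 D} \<union> {pt (- A / D) (- B)}"
    have "- A / D + A / (B + D) / D * B = - (A / (B + D))"
      using pos by (simp add: divide_simps) (simp add: algebra_simps)
    then show "- (A / (B + D)) \<le> x $ 1 + - (A / (B + D)) / D * x $ 2"
      using x pos by auto
  qed
  ultimately show "glueable (A / (B + D)) 1 {pt 0 D} {pt (- A / D) (- B)}"
    unfolding glueable_def using pos by (auto intro!: divide_pos_pos)
  show Lp: "L (pt 1 0) = p" and Lq: "L (pt 0 D) = q" using pos by (simp_all add: L_def real2_eq_iff)
  show Lx: "L (pt (- A / (B + D)) 0) = opposite_point p q r"
    using pos by (simp add: L_def real2_eq_iff opposite_point_def A_def B_def D_def)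
  have "A *\<^sub>R p + B *\<^sub>R q + D *\<^sub>R r = 0" using det2_cyclic by (simp add: A_def B_def D_def)
  then have "D * r $ 1 = - A * p $ 1 - B * q $ 1" "D * r $ 2 = - A * p $ 2 - B * q $ 2"
    by (auto simp: real2_eq_iff)
  then show Lr: "L (pt (- A / D) (- B)) = r"
    using pos by (simp add: L_def real2_eq_iff field_simps)
  have x: "opposite_point p q r \<in> convex hull {p, q, r}"
  proof -
    have "(B / (B + D)) *\<^sub>R q + (D / (B + D)) *\<^sub>R r \<in> convex hull {p, q, r}"
      using pos by (intro convexD[OF convex_convex_hull] hull_inc) (auto simp: add_divide_distrib[symmetric])
    moreover have "(B / (B + D)) *\<^sub>R q + (D / (B + D)) *\<^sub>R r = opposite_point p q r"
      using \<open>D * r $ 1 = _\<close> \<open>D * r $ 2 = _\<close> pos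
      by (simp add: real2_eq_iff opposite_point_def A_def[symmetric] B_def[symmetric] D_def[symmetric] divide_simps)
    ultimately show ?thesis by simp
  qed
  have "L ` glued (A / (B + D)) 1 {pt 0 D} {pt (- A / D) (- B)} = convex hull {p, opposite_point p q r, q, r}"
    using Lp Lq Lr Lx by (simp add: glued_def L_def lin_image_hull insert_commute)
  also have "\<dots> = convex hull {p, q, r}"
    using x hull_redundant[of "opposite_point p q r" convex "{p, q, r}"] by (simp add: insert_commute)
  finally show "L ` glued (A / (B + D)) 1 {pt 0 D} {pt (- A / D) (- B)} = convex hull {p, q, r}" .
qed

lemma triangle_in_polytopes_o:
  assumes "around_zero p q r"
  shows "convex hull {p, q, r} \<in> polytopes_o"
proof -
  note T = triangle_eq_glued[OF assms]
  show ?thesis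
    using polytopes_o_lin[OF glued_in_polytopes_o[OF T(2)] T(1)] unfolding T(7) .
qed

lemma around_zero_cyclic: "around_zero p q r \<Longrightarrow> around_zero q r p"
  by (auto simp: around_zero_def)

lemma det2_scaleR: "det2 (s *\<^sub>R p) q = s * det2 p q" "det2 p (s *\<^sub>R q) = s * det2 p q"
  by (simp_all add: det2_def algebra_simps)

lemma around_zero_scaleR: "t > 0 \<Longrightarrow> around_zero p q r \<Longrightarrow> around_zero (t *\<^sub>R p) q r"
  by (simp add: around_zero_def det2_scaleR)

section \<open>Additivity of edge terms under subdivision of an edge\<close>

locale edge_valuation = sl2_valuation +
  fixes B1 B2 :: "real \<Rightarrow> real"
  assumes edge_formula:
    "\<And>a b u v. glueable a b {u} {v} \<Longrightarrow> \<mu> (glued a b {u} {v}) = edge_sum (edge_term B1 B2) a b u v"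
begin

abbreviation "E \<equiv> edge_term B1 B2"

definition W :: "real^2 \<Rightarrow> real^2 \<Rightarrow> real^2 \<Rightarrow> real^2" where
  "W p q r = \<mu> (convex hull {p, q, r}) - E p q - E q r - E r p"

text \<open>As a quadrilateral with a diagonal from \<open>p\<close>, the triangle has the edge from
  \<open>q\<close> to \<open>r\<close> broken in two. The defect thus compares an edge with its
  subdivision, and \<open>p\<close> enters only through its ray, which fixes the division
  point.\<close>

lemma W_opposite:
  assumes "around_zero p q r"
  shows "W p q r = E q (opposite_point p q r) + E (opposite_point p q r) r - E q r"
proof -
  note T = triangle_eq_glued[OF assms]
  have "\<mu> (convex hull {p, q, r}) = E p q + E q (opposite_point p q r) + E (opposite_point p q r) r + E r p"
    using lin_equivariant[OF glued_in_polytopes_o[OF T(2)] T(1)]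
    unfolding T(7) edge_formula[OF T(2)] edge_sum_def lin_simps
    using T(3-6) by (simp add: edge_term_lin[OF T(1), symmetric])
  then show ?thesis by (simp add: W_def)
qed

lemma W_cyclic: "W q r p = W p q r"
  by (simp add: W_def insert_commute)

lemma W_scaleR1:
  assumes "around_zero p q r" "t > 0"
  shows "W (t *\<^sub>R p) q r = W p q r"
proof -
  have "opposite_point (t *\<^sub>R p) q r = opposite_point p q r"
  proof -
    have "t * det2 r p + t * det2 p q = t * (det2 r p + det2 p q)" by (simp add: algebra_simps)
    then show ?thesis using assms by (simp add: opposite_point_def det2_scaleR)
  qed
  then show ?thesis using W_opposite[OF assms(1)] W_opposite[OF around_zero_scaleR[OF assms(2,1)]] by simp
qed

lemma W_scaleR:
  assumes "around_zero p q r" "s > 0" "t > 0" "w > 0"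
  shows "W (s *\<^sub>R p) (t *\<^sub>R q) (w *\<^sub>R r) = W p q r"
proof -
  note cyc = around_zero_cyclic
  have 1: "around_zero (s *\<^sub>R p) q r" using assms by (simp add: around_zero_scaleR)
  have 2: "around_zero (t *\<^sub>R q) r (s *\<^sub>R p)" by (rule around_zero_scaleR[OF assms(3) cyc[OF 1]])
  have "W (s *\<^sub>R p) (t *\<^sub>R q) (w *\<^sub>R r) = W (w *\<^sub>R r) (s *\<^sub>R p) (t *\<^sub>R q)" by (rule W_cyclic)
  also have "\<dots> = W r (s *\<^sub>R p) (t *\<^sub>R q)" by (rule W_scaleR1[OF cyc[OF 2] assms(4)])
  also have "\<dots> = W (t *\<^sub>R q) r (s *\<^sub>R p)" by (rule W_cyclic)
  also have "\<dots> = W q r (s *\<^sub>R p)" by (rule W_scaleR1[OF cyc[OF 1] assms(3)])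
  also have "\<dots> = W (s *\<^sub>R p) q r" by (rule W_cyclic)
  also have "\<dots> = W p q r" by (rule W_scaleR1[OF assms(1,2)])
  finally show ?thesis .
qed

lemma W_lin:
  assumes "around_zero p q r" "a * d - b * c = 1"
  shows "W (lin a b c d p) (lin a b c d q) (lin a b c d r) = lin a b c d (W p q r)"
  using lin_equivariant_hull[OF triangle_in_polytopes_o[OF assms(1)] assms(2)]
  by (simp add: W_def edge_term_lin[OF assms(2)] lin_simps)

text \<open>The defect \<open>W\<close> only depends on the three rays spanned by the vertices. All such triples of rays are
  equivalent under the special linear group, and the cyclic permutation of one of them is realised
  by a matrix without nonzero fixed vectors.\<close>
lemma W_eq_0:
  assumes tri: "around_zero p q r"
  shows "W p q r = 0"
proof -
  define W0 where "W0 = W (pt 1 0) (pt 0 1) (pt (-1) (-1))"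
  have tri0: "around_zero (pt 1 0) (pt 0 1) (pt (-1) (-1))" by (simp add: around_zero_def det2_def)
  have "W (pt 0 1) (pt (-1) (-1)) (pt 1 0) = lin 0 (-1) 1 (-1) W0"
    using W_lin[OF tri0, of 0 "-1" "-1" 1] by (simp add: W0_def lin_pt)
  then have "W0 = lin 0 (-1) 1 (-1) W0" using W_cyclic by (simp add: W0_def)
  then have "W0 $ 1 = - W0 $ 2" "W0 $ 2 = W0 $ 1 - W0 $ 2" by (metis lin_nth mult_zero_left mult_minus_left mult_1 add_0 diff_conv_add_uminus)+
  then have W0: "W0 = 0" by (simp add: real2_eq_iff)
  \<comment> \<open>The determinants are the weights that make the rescaled vertices sum to zero,
    and \<open>l\<close> normalises the determinant of the first two to 1. The matrix with these two
    columns then carries the standard triple onto the rescaled one.\<close>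
  define l where "l = 1 / sqrt (det2 q r * det2 r p * det2 p q)"
  have pos: "det2 q r > 0" "det2 r p > 0" "det2 p q > 0" using tri by (auto simp: around_zero_def)
  then have l: "l > 0" "l^2 * (det2 q r * det2 r p * det2 p q) = 1"
    by (auto simp: l_def power_divide)
  define p' where "p' = (l * det2 q r) *\<^sub>R p"
  define q' where "q' = (l * det2 r p) *\<^sub>R q"
  define r' where "r' = (l * det2 p q) *\<^sub>R r"
  have "W p q r = W p' q' r'"
    unfolding p'_def q'_def r'_def using W_scaleR[OF tri] pos l by simp
  also have "\<dots> = lin (p' $ 1) (q' $ 1) (p' $ 2) (q' $ 2) W0"
  proof -
    have "det2 p' q' = l^2 * (det2 q r * det2 r p * det2 p q)"
      by (simp add: p'_def q'_def det2_scaleR power2_eq_square)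
    then have d: "p' $ 1 * q' $ 2 - q' $ 1 * p' $ 2 = 1" using l by (simp add: det2_def algebra_simps)
    have "p' + q' + r' = l *\<^sub>R (det2 q r *\<^sub>R p + det2 r p *\<^sub>R q + det2 p q *\<^sub>R r)"
      by (simp add: p'_def q'_def r'_def scaleR_add_right)
    then have "p' + q' + r' = 0" by (simp add: det2_cyclic)
    then have "r' $ 1 = - p' $ 1 - q' $ 1" "r' $ 2 = - p' $ 2 - q' $ 2"
      by (simp_all add: real2_eq_iff algebra_simps)
    then have "lin (p' $ 1) (q' $ 1) (p' $ 2) (q' $ 2) (pt 1 0) = p'" "lin (p' $ 1) (q' $ 1) (p' $ 2) (q' $ 2) (pt 0 1) = q'"
      "lin (p' $ 1) (q' $ 1) (p' $ 2) (q' $ 2) (pt (-1) (-1)) = r'"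
      by (simp_all add: real2_eq_iff)
    then show ?thesis using W_lin[OF tri0 d] by (simp add: W0_def)
  qed
  also have "\<dots> = 0" by (simp add: W0 real2_eq_iff)
  finally show ?thesis .
qed

text \<open>The edge from \<open>q\<close> to \<open>r\<close> lies on the line with first
  coordinate 1 and is divided at \<open>pt 1 0\<close> into pieces of determinants \<open>e\<close>
  and \<open>f\<close>. Vanishing of the defect says that the edge terms add up; the two equations
  are its two coordinates.\<close>

lemma edge_functional_equations:
  assumes "e > 0" "f > 0"
  shows "B2 e + B1 e + B2 f + B1 f = B2 (e + f) + B1 (e + f)"
    "e * B2 (e + f) - f * B1 (e + f) = e * B2 e - f * B1 f"
proof -
  define p where "p = pt (-1) 0"
  define q where "q = pt 1 (-e)"
  define r where "r = pt 1 f"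
  have d: "det2 q r = e + f" "det2 r p = f" "det2 p q = e" by (auto simp: p_def q_def r_def det2_def)
  have tri: "around_zero p q r" using d assms by (simp add: around_zero_def)
  have x: "opposite_point p q r = pt 1 0"
    unfolding opposite_point_def d using assms by (simp add: real2_eq_iff p_def add.commute divide_simps)
  have dx: "det2 q (pt 1 0) = e" "det2 (pt 1 0) r = f" by (auto simp: q_def r_def det2_def)
  have "E q (pt 1 0) + E (pt 1 0) r - E q r = 0"
    using W_opposite[OF tri] W_eq_0[OF tri] x by simp
  then have "(E q (pt 1 0) + E (pt 1 0) r - E q r) $ 1 = 0" "(E q (pt 1 0) + E (pt 1 0) r - E q r) $ 2 = 0" by auto
  then show "B2 e + B1 e + B2 f + B1 f = B2 (e + f) + B1 (e + f)"
    "e * B2 (e + f) - f * B1 (e + f) = e * B2 e - f * B1 f"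
    unfolding edge_term_def dx d by (auto simp: q_def r_def algebra_simps)
qed

end

section \<open>Solving the functional equation of the edge coefficients\<close>

lemma additive_on_positives_extends:
  fixes l :: "real \<Rightarrow> real"
  assumes add: "\<And>x y. x > 0 \<Longrightarrow> y > 0 \<Longrightarrow> l (x + y) = l x + l y"
  obtains F where "\<And>x y. F (x + y) = F x + F y" "\<And>x. x > 0 \<Longrightarrow> F x = l x"
proof -
  \<comment> \<open>Differences \<open>l (c + x) - l c\<close> do not depend on \<open>c\<close>
    while both arguments are positive. The offset \<open>\<bar>x\<bar> + 1\<close> guarantees this
    for every \<open>x\<close>.\<close>
  define F where "F x = l (\<bar>x\<bar> + 1 + x) - l (\<bar>x\<bar> + 1)" for x
  have F: "F x = l (c + x) - l c" if "c > 0" "c + x > 0" for x c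
  proof -
    have "l ((\<bar>x\<bar> + 1 + x) + c) = l ((c + x) + (\<bar>x\<bar> + 1))" by (simp add: algebra_simps)
    then show ?thesis using add[of "\<bar>x\<bar> + 1 + x" c] add[of "c + x" "\<bar>x\<bar> + 1"] that by (simp add: F_def)
  qed
  show ?thesis
  proof
    fix x y :: real
    define c where "c = \<bar>x\<bar> + \<bar>y\<bar> + 1"
    have "c > 0" "c + x > 0" "c + x + y > 0" by (auto simp: c_def)
    then show "F (x + y) = F x + F y" using F[of c "x + y"] F[of c x] F[of "c + x" y] by (simp add: add.assoc)
  next
    fix x :: real assume "x > 0"
    then show "F x = l x" using F[of 1 x] add[of 1 x] by simp
  qed
qed

context edge_valuation
begin

text \<open>Eliminating \<open>B1 (e + f)\<close> gives an equation whose other terms are symmetric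
  in \<open>e\<close> and \<open>f\<close>, which forces \<open>f * S e = e * S f\<close> and makes
  the sum \<open>S\<close> of the coefficients linear. After that, \<open>x * B2 x\<close> is
  additive up to the quadratic term \<open>k * x^2\<close>, and measurability completes the
  solution.\<close>

lemma edge_coefficients:
  obtains k c where "\<And>x. x > 0 \<Longrightarrow> B2 x = k * x + c" "\<And>x. x > 0 \<Longrightarrow> B1 x = k * x - c"
proof -
  define S where "S x = B1 x + B2 x" for x
  have a: "(e + f) * B2 (e + f) = e * B2 e + f * B2 f + f * S e" if "e > 0" "f > 0" for e f
  proof -
    have b1: "B1 (e + f) = B2 e + B1 e + B2 f + B1 f - B2 (e + f)"
      using edge_functional_equations(1)[OF that] by simp
    show ?thesis using edge_functional_equations(2)[OF that] unfolding b1 S_def by (simp add: algebra_simps)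
  qed
  have sym: "f * S e = e * S f" if "e > 0" "f > 0" for e f
    using a[OF that] a[OF that(2,1)] by (simp add: add.commute)
  have S: "S x = S 1 * x" if "x > 0" for x using sym[of x 1] that by simp
  define k where "k = S 1 / 2"
  define l where "l x = x * B2 x - k * x^2" for x
  have l: "l (x + y) = l x + l y" if "x > 0" "y > 0" for x y
    using a[OF that] S[OF that(1)] by (simp add: l_def k_def power2_eq_square algebra_simps)
  obtain F where F: "\<And>x y. F (x + y) = F x + F y" "\<And>x. x > 0 \<Longrightarrow> F x = l x"
    using additive_on_positives_extends[OF l] by metis
  have "F \<in> borel_measurable (restrict_space borel {1<..<2})"
  proof -
    \<comment> \<open>Moving the upper vertex from \<open>pt 0 1\<close> to \<open>pt 1 1\<close>
      changes no edge determinant, so the first coordinate of the value grows by exactly the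
      coefficient of that vertex. This exhibits \<open>B2\<close> as measurable up to a
      constant.\<close>
    define m where "m a = \<mu> (glued a 1 {pt 1 1} {pt 0 (-1)}) $ 1 - \<mu> (glued a 1 {pt 0 1} {pt 0 (-1)}) $ 1" for a
    have ok: "glueable a 1 {pt 1 1} {pt 0 (-1)}" "glueable a 1 {pt 0 1} {pt 0 (-1)}" if "a \<in> {1<..<2}" for a
      by (rule glueable_small; use that in simp)+
    have M: "m \<in> borel_measurable (restrict_space borel {1<..<2})"
      unfolding m_def using ok
      by (intro borel_measurable_diff measurable_quad_curves) (auto intro!: continuous_intros)
    have B2: "m a = B1 1 + B2 a" if a: "a \<in> {1<..<2}" for a
      unfolding m_def edge_formula[OF ok(1)[OF a]] edge_formula[OF ok(2)[OF a]]
      by (simp add: edge_sum_def edge_term_def det2_def algebra_simps)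
    have id: "(\<lambda>x. x) \<in> borel_measurable (restrict_space borel {1<..<2::real})"
      by (intro measurable_restrict_space1) auto
    have "(\<lambda>x. x * (m x - B1 1) - k * x^2) \<in> borel_measurable (restrict_space borel {1<..<2})"
      using M id by (intro borel_measurable_diff borel_measurable_times borel_measurable_power borel_measurable_const)
    moreover have "F x = x * (m x - B1 1) - k * x^2" if "x \<in> {1<..<2}" for x
      using F(2)[of x] B2[OF that] that by (simp add: l_def)
    ultimately show ?thesis
      by (subst measurable_cong[where g="\<lambda>x. x * (m x - B1 1) - k * x^2"]) (auto simp: space_restrict_space)
  qed
  then have Fl: "F x = F 1 * x" for x
    using additive_measurable_linear[OF F(1), of "{1<..<2}" x] by auto
  have b2: "B2 x = k * x + F 1" if "x > 0" for x
  proof -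
    have "x * B2 x = x * (k * x + F 1)"
      using Fl[of x] F(2)[OF that] by (simp add: l_def power2_eq_square algebra_simps)
    then show ?thesis using that by simp
  qed
  moreover have "B1 x = k * x - F 1" if "x > 0" for x
    using S[OF that] b2[OF that] by (simp add: S_def k_def)
  ultimately show ?thesis using that by blast
qed

end

text \<open>For \<open>det2 p q > 0\<close> this is six times the moment vector of the triangle with
  vertices 0, \<open>p\<close>, \<open>q\<close>, that is, six times the area
  \<open>det2 p q / 2\<close> times the centroid.\<close>

definition moment_edge :: "real^2 \<Rightarrow> real^2 \<Rightarrow> real^2" where
  "moment_edge p q = det2 p q *\<^sub>R (p + q)"

lemma (in sl2_valuation) twist_zero_formula:
  assumes "twist \<mu> 0"
  obtains k where
    "\<And>a b u v. glueable a b {u} {v} \<Longrightarrow> \<mu> (glued a b {u} {v}) = k *\<^sub>R edge_sum moment_edge a b u v"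
proof -
  obtain B1 B2 where B: "\<And>a b u v. glueable a b {u} {v} \<Longrightarrow> \<mu> (glued a b {u} {v}) = edge_sum (edge_term B1 B2) a b u v"
    using edge_sum_ex[OF assms] by blast
  interpret edge_valuation \<mu> B1 B2 by unfold_locales (rule B)
  obtain k c where kc: "\<And>x. x > 0 \<Longrightarrow> B2 x = k * x + c" "\<And>x. x > 0 \<Longrightarrow> B1 x = k * x - c"
    using edge_coefficients by blast
  \<comment> \<open>The \<open>c\<close> part is a difference of end points and cancels around the
    closed boundary of the quadrilateral.\<close>
  have E: "E p q = k *\<^sub>R moment_edge p q + c *\<^sub>R (p - q)" if "det2 p q > 0" for p q
    unfolding edge_term_def moment_edge_def kc(1)[OF that] kc(2)[OF that] by (simp add: real2_eq_iff algebra_simps)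
  show ?thesis
  proof
    fix a b u v assume ok: "glueable a b {u} {v}"
    then have pos: "0 < a" "0 < b" "u $ 2 > 0" "v $ 2 < 0" by (auto simp: glueable_def)
    then have "det2 (pt b 0) u > 0" "det2 u (pt (-a) 0) > 0" "det2 (pt (-a) 0) v > 0" "det2 v (pt b 0) > 0"
      by (auto simp: det2_def mult_pos_neg mult_neg_pos)
    then show "\<mu> (glued a b {u} {v}) = k *\<^sub>R edge_sum moment_edge a b u v"
      unfolding B[OF ok] edge_sum_def by (simp add: E algebra_simps)
  qed
qed

section \<open>Valuations vanishing on quadrilaterals\<close>

lemma axis_section_interval:
  assumes P: "P \<in> polytopes_o" and e: "e \<noteq> 0"
  obtains c d where "c > 0" "d > 0" "\<And>s. s *\<^sub>R e \<in> P \<longleftrightarrow> - c \<le> s \<and> s \<le> d"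
proof -
  define T where "T = (\<lambda>s. s *\<^sub>R e) -` P"
  note Pp = polytopes_oD[OF P]
  have lin: "linear (\<lambda>s. s *\<^sub>R e)" by (simp add: linear_scale_left)
  have "closed T" unfolding T_def
    by (intro continuous_closed_vimage Pp(4)) (auto intro!: continuous_intros)
  moreover have "bounded T"
  proof -
    obtain M where M: "\<And>x. x \<in> P \<Longrightarrow> norm x \<le> M" using compact_imp_bounded[OF Pp(3)] by (auto simp: bounded_iff)
    have "\<bar>s\<bar> \<le> M / norm e" if "s \<in> T" for s
      using M[of "s *\<^sub>R e"] that e by (simp add: T_def field_simps)
    then show ?thesis by (auto simp: bounded_iff intro!: exI[of _ "M / norm e"])
  qed
  moreover have "convex T" unfolding T_def using convex_linear_vimage[OF lin Pp(2)] .
  ultimately obtain c d where cd: "T = {c..d}"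
    using connected_compact_interval_1[of T] convex_connected[of T] compact_eq_bounded_closed[of T] by blast
  obtain t where t: "t > 0" "\<And>s. \<bar>s\<bar> \<le> t \<Longrightarrow> s *\<^sub>R e \<in> P" using zero_interior_absorbing[OF Pp(5)] by blast
  have "t \<in> T" "- t \<in> T" using t(1) t(2)[of t] t(2)[of "-t"] by (auto simp: T_def)
  then have "- c > 0" "d > 0" using t(1) cd by auto
  moreover have "s *\<^sub>R e \<in> P \<longleftrightarrow> - (- c) \<le> s \<and> s \<le> d" for s
    using cd by (auto simp: T_def)
  ultimately show ?thesis using that by blast
qed

text \<open>The segment from \<open>u\<close> to \<open>v\<close> crosses the first axis at a point
  \<open>z\<close> of \<open>Y\<close>, hence within the diagonal. The line through \<open>u\<close>
  and an end of the diagonal therefore has \<open>v\<close> on the correct side, and serves as the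
  witness that \<open>glueable\<close> asks for.\<close>

lemma quad_eq_glued:
  assumes Y: "Y \<in> polytopes_o" "u \<in> Y" "v \<in> Y" "u $ 2 > 0" "v $ 2 < 0"
    and hull: "Y = convex hull (insert u (insert v (Y \<inter> {x. x $ 2 = 0})))"
  obtains a b where "glueable a b {u} {v}" "Y = glued a b {u} {v}"
proof -
  have "pt 1 0 \<noteq> 0" by (simp add: real2_eq_iff)
  then obtain a b where ab: "a > 0" "b > 0" "\<And>s. s *\<^sub>R pt 1 0 \<in> Y \<longleftrightarrow> - a \<le> s \<and> s \<le> b"
    using axis_section_interval[OF Y(1)] by blast
  have axis: "x \<in> Y \<longleftrightarrow> - a \<le> x $ 1 \<and> x $ 1 \<le> b" if "x $ 2 = 0" for x
  proof -
    have "x $ 1 *\<^sub>R pt 1 0 = x" using that by (simp add: real2_eq_iff)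
    then show ?thesis using ab(3)[of "x $ 1"] by simp
  qed
  have ends: "pt b 0 \<in> Y" "pt (-a) 0 \<in> Y" using ab axis by auto
  define z where "z = (- v $ 2 / (u $ 2 - v $ 2)) *\<^sub>R u + (u $ 2 / (u $ 2 - v $ 2)) *\<^sub>R v"
  have "- v $ 2 / (u $ 2 - v $ 2) \<ge> 0" "u $ 2 / (u $ 2 - v $ 2) \<ge> 0"
    using Y divide_nonpos_pos[of "v $ 2" "u $ 2 - v $ 2"] by auto
  moreover have "- v $ 2 / (u $ 2 - v $ 2) + u $ 2 / (u $ 2 - v $ 2) = 1"
    using Y by (simp add: diff_divide_distrib[symmetric])
  ultimately have "z \<in> Y" unfolding z_def
    using Y polytopes_oD(2)[OF Y(1)] by (intro convexD)
  moreover have z2: "z $ 2 = 0" by (simp add: z_def)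
  ultimately have "- a \<le> z $ 1" "z $ 1 \<le> b" using axis by auto
  moreover have "(u $ 2 - v $ 2) * z $ 1 = - v $ 2 * u $ 1 + u $ 2 * v $ 1"
  proof -
    have "(- v $ 2 / (u $ 2 - v $ 2)) * u $ 1 + (u $ 2 / (u $ 2 - v $ 2)) * v $ 1
        = (- v $ 2 * u $ 1 + u $ 2 * v $ 1) / (u $ 2 - v $ 2)"
      by (simp add: diff_divide_distrib)
    then show ?thesis using Y by (simp add: z_def)
  qed
  ultimately have cross: "- v $ 2 * u $ 1 + u $ 2 * v $ 1 \<le> (u $ 2 - v $ 2) * b"
    "(u $ 2 - v $ 2) * (- a) \<le> - v $ 2 * u $ 1 + u $ 2 * v $ 1"
    using Y mult_left_mono[of "z $ 1" b "u $ 2 - v $ 2"] mult_left_mono[of "- a" "z $ 1" "u $ 2 - v $ 2"] by auto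
  have cert: "u $ 1 + (c - u $ 1) / u $ 2 * u $ 2 = c"
    "u $ 2 * (v $ 1 + (c - u $ 1) / u $ 2 * v $ 2) = u $ 2 * v $ 1 + (c - u $ 1) * v $ 2" for c
    using Y by (auto simp: distrib_left)
  have "u $ 2 * (v $ 1 + (b - u $ 1) / u $ 2 * v $ 2) \<le> u $ 2 * b"
    unfolding cert using cross(1) by (simp add: algebra_simps)
  then have "\<exists>s. \<forall>x\<in>{u} \<union> {v}. x $ 1 + s * x $ 2 \<le> b"
    using Y cert(1)[of b] by (intro exI[of _ "(b - u $ 1) / u $ 2"]) (auto simp: mult_le_cancel_left_pos)
  moreover have "u $ 2 * (- a) \<le> u $ 2 * (v $ 1 + (- a - u $ 1) / u $ 2 * v $ 2)"
    unfolding cert using cross(2) by (simp add: algebra_simps)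
  then have "- a \<le> v $ 1 + (- a - u $ 1) / u $ 2 * v $ 2" using Y(4) mult_le_cancel_left_pos by blast
  then have "\<exists>s. \<forall>x\<in>{u} \<union> {v}. - a \<le> x $ 1 + s * x $ 2"
    using Y cert(1)[of "-a"]
    by (intro exI[of _ "(- a - u $ 1) / u $ 2"]) auto
  ultimately have "glueable a b {u} {v}" unfolding glueable_def using ab Y by auto
  moreover have "Y = glued a b {u} {v}"
  proof
    show "glued a b {u} {v} \<subseteq> Y"
      unfolding glued_def using Y ends polytopes_oD(2)[OF Y(1)] by (intro hull_minimal) auto
    have "x \<in> glued a b {u} {v}" if "x \<in> Y \<inter> {x. x $ 2 = 0}" for x
    proof -
      have "pt (x $ 1) 0 \<in> convex hull ({pt b 0, pt (-a) 0} \<union> {u} \<union> {v})"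
        using that axis ab by (intro axis_segment_hull[of a b]) auto
      moreover have "pt (x $ 1) 0 = x" using that by (simp add: real2_eq_iff)
      ultimately show ?thesis by (simp add: glued_def)
    qed
    then have "insert u (insert v (Y \<inter> {x. x $ 2 = 0})) \<subseteq> glued a b {u} {v}"
      by (auto simp: glued_def intro: hull_inc)
    then have "convex hull (insert u (insert v (Y \<inter> {x. x $ 2 = 0}))) \<subseteq> glued a b {u} {v}"
      by (rule hull_minimal) (simp add: glued_def)
    then show "Y \<subseteq> glued a b {u} {v}" using hull by simp
  qed
  ultimately show ?thesis using that by blast
qed

locale quad_null_valuation = sl2_valuation +
  assumes quad_null: "\<And>a b u v. glueable a b {u} {v} \<Longrightarrow> \<mu> (glued a b {u} {v}) = 0"
begin

lemma quad_zero:
  assumes X: "X \<in> polytopes_o" "u \<in> X" "v \<in> X" "n \<bullet> u > 0" "n \<bullet> v < 0"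
    and hull: "X = convex hull (insert u (insert v (X \<inter> {x. n \<bullet> x = 0})))"
  shows "\<mu> X = 0"
proof -
  define c where "c = norm n"
  have c: "c > 0" using X by (auto simp: c_def)
  have cc: "n $ 1 * n $ 1 + n $ 2 * n $ 2 = c * c"
    by (simp add: c_def power2_eq_square[symmetric] dot_square_norm[symmetric] inner_real2)
  \<comment> \<open>\<open>K\<close> is the rotation that takes the direction of \<open>n\<close> to
    the positive second axis, and \<open>L\<close> is its inverse.\<close>
  define L where "L = lin (n $ 2 / c) (n $ 1 / c) (- n $ 1 / c) (n $ 2 / c)"
  define K where "K = lin (n $ 2 / c) (- (n $ 1 / c)) (- (- n $ 1 / c)) (n $ 2 / c)"
  have d: "(n $ 2 / c) * (n $ 2 / c) - (n $ 1 / c) * (- n $ 1 / c) = 1"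
    using c cc by (simp add: field_simps)
  have LK: "L (K x) = x" "K (L x) = x" for x
    using lin_inverse[OF d] by (simp_all add: L_def K_def)
  have K2: "K x $ 2 = (n \<bullet> x) / c" for x by (simp add: K_def inner_real2 add_divide_distrib)
  have Kd: "n $ 2 / c * (n $ 2 / c) - - (n $ 1 / c) * - (- n $ 1 / c) = 1" using d by simp
  define Y where "Y = K ` X"
  have Yo: "Y \<in> polytopes_o" unfolding Y_def K_def by (rule polytopes_o_lin[OF X(1) Kd])
  have "Y \<inter> {x. x $ 2 = 0} = K ` (X \<inter> {x. n \<bullet> x = 0})"
    using c K2 by (auto simp: Y_def)
  moreover have "Y = convex hull (insert (K u) (insert (K v) (K ` (X \<inter> {x. n \<bullet> x = 0}))))"
    unfolding Y_def by (subst hull) (simp add: K_def lin_image_hull)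
  ultimately have "Y = convex hull (insert (K u) (insert (K v) (Y \<inter> {x. x $ 2 = 0})))" by simp
  moreover have "K u \<in> Y" "K v \<in> Y" "K u $ 2 > 0" "K v $ 2 < 0"
    using X c by (auto simp: Y_def K2 divide_less_0_iff)
  ultimately obtain a b where ab: "glueable a b {K u} {K v}" "Y = glued a b {K u} {K v}"
    using quad_eq_glued[OF Yo] by metis
  have "X = L ` Y" unfolding Y_def by (simp add: image_image LK)
  then have "\<mu> X = L (\<mu> Y)" using lin_equivariant[OF Yo d] by (simp add: L_def)
  also have "\<dots> = 0" using quad_null[OF ab(1)] ab(2) by (simp add: L_def real2_eq_iff)
  finally show ?thesis .
qed

text \<open>The middle piece of a cut is spanned by the two apexes and the section with the line. It
  is thus of quadrilateral type and drops out.\<close>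

lemma cut_zero:
  assumes X: "X \<in> polytopes_o" and u: "u \<in> X" "n \<bullet> u > 0" and v: "v \<in> X" "n \<bullet> v < 0"
  shows "\<mu> X = \<mu> (convex hull (insert v (X \<inter> {x. n \<bullet> x \<ge> 0}))) + \<mu> (convex hull (insert u (X \<inter> {x. n \<bullet> x \<le> 0})))"
proof -
  note cut = valuation_cut[OF valuation X u v]
  let ?C = "convex hull (insert u (insert v (X \<inter> {x. n \<bullet> x = 0})))"
  have "?C \<subseteq> X" using u v polytopes_oD(2)[OF X] by (intro hull_minimal) auto
  then have "?C \<inter> {x. n \<bullet> x = 0} = X \<inter> {x. n \<bullet> x = 0}" by (auto intro: hull_inc)
  then have "\<mu> ?C = 0"
    using u v by (intro quad_zero[OF cut(3), of u v n]) (auto intro: hull_inc)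
  then show ?thesis using cut(4) by simp
qed

text \<open>If \<open>w\<close> is the only generator above the line, the piece of the cut that
  keeps the upper half is spanned by \<open>w\<close>, the section and \<open>v\<close>, so it
  vanishes as a quadrilateral. The value does not depend on what is above the line, and
  \<open>w\<close> may be traded for any \<open>u\<close> there.\<close>

lemma one_side_zero:
  assumes X: "X \<in> polytopes_o" "X = convex hull S" and w: "w \<in> X" "n \<bullet> w > 0" "\<And>x. x \<in> S \<Longrightarrow> n \<bullet> x > 0 \<Longrightarrow> x = w"
    and u: "u \<in> X" "n \<bullet> u > 0"
  shows "\<mu> X = \<mu> (convex hull (insert u (X \<inter> {x. n \<bullet> x \<le> 0})))"
proof -
  let ?X0 = "X \<inter> {x. n \<bullet> x = 0}"
  have n: "n \<noteq> 0" using u by auto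
  obtain t where t: "t > 0" "\<And>s. \<bar>s\<bar> \<le> t \<Longrightarrow> s *\<^sub>R n \<in> X"
    using zero_interior_absorbing[OF polytopes_oD(5)[OF X(1)], of n] by blast
  define v where "v = (- t) *\<^sub>R n"
  have v: "v \<in> X" "n \<bullet> v < 0" using t(1) t(2)[of "- t"] n by (auto simp: v_def)
  have up: "X \<inter> {x. n \<bullet> x \<ge> 0} = convex hull (insert w ?X0)"
    unfolding X(2)
  proof (rule hull_halfspace)
    show "insert w (convex hull S \<inter> {x. n \<bullet> x = 0}) \<subseteq> convex hull S" using w X by auto
  qed (use w in \<open>auto intro: hull_inc\<close>)
  define G where "G = convex hull (insert v (X \<inter> {x. n \<bullet> x \<ge> 0}))"
  have Go: "G \<in> polytopes_o" unfolding G_def by (rule valuation_cut(1)[OF valuation X(1) u v])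
  have GX: "G \<subseteq> X" unfolding G_def using v polytopes_oD(2)[OF X(1)] by (intro hull_minimal) auto
  have G0: "G \<inter> {x. n \<bullet> x = 0} = ?X0" using GX by (auto simp: G_def intro: hull_inc)
  have "G = convex hull (insert w (insert v ?X0))"
  proof -
    have "G = convex hull ({v} \<union> convex hull (insert w ?X0))" using up by (simp add: G_def)
    also have "\<dots> = convex hull ({v} \<union> insert w ?X0)" by (rule hull_Un_right[symmetric])
    finally show ?thesis by (simp add: insert_commute)
  qed
  then have "G = convex hull (insert w (insert v (G \<inter> {x. n \<bullet> x = 0})))" unfolding G0 .
  moreover have "w \<in> G" "v \<in> G" using w by (auto simp: G_def intro: hull_inc)
  ultimately have "\<mu> G = 0" using w v by (intro quad_zero[OF Go, of w v n])
  then show ?thesis using cut_zero[OF X(1) u v] by (simp add: G_def)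
qed

end

section \<open>Polygons with a single vertex below the first axis\<close>

definition upper_hull :: "real \<Rightarrow> real \<Rightarrow> (real^2) set \<Rightarrow> real^2 \<Rightarrow> (real^2) set" where
  "upper_hull a b A v = convex hull ({pt b 0, pt (-a) 0} \<union> A \<union> {v})"

text \<open>The section condition is imposed on the hull itself instead of being certified by lines,
  because in this form it passes to every hull contained in a given one.\<close>

definition upper_ok :: "real \<Rightarrow> real \<Rightarrow> (real^2) set \<Rightarrow> real^2 \<Rightarrow> bool" where
  "upper_ok a b A v \<longleftrightarrow> 0 < a \<and> 0 < b \<and> finite A \<and> A \<noteq> {} \<and> (\<forall>x\<in>A. x $ 2 > 0) \<and> v $ 2 < 0 \<and>
     (\<forall>x\<in>upper_hull a b A v. x $ 2 = 0 \<longrightarrow> - a \<le> x $ 1 \<and> x $ 1 \<le> b)"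

lemma upper_okD:
  assumes "upper_ok a b A v"
  shows "0 < a" "0 < b" "finite A" "A \<noteq> {}" "\<And>x. x \<in> A \<Longrightarrow> x $ 2 > 0" "v $ 2 < 0"
  using assms by (simp_all add: upper_ok_def)

lemma upper_hull_in_o:
  assumes "upper_ok a b A v"
  shows "upper_hull a b A v \<in> polytopes_o"
proof -
  obtain u where "u \<in> A" using assms by (auto simp: upper_ok_def)
  then show ?thesis using assms unfolding upper_hull_def
    by (intro hull_in_polytopes_o[of a b _ u v]) (auto simp: upper_ok_def)
qed

lemma upper_hull_upper:
  assumes "upper_ok a b A v"
  shows "upper_hull a b A v \<inter> {x. pt 0 (-1) \<bullet> x \<le> 0} = convex hull ({pt b 0, pt (-a) 0} \<union> A)"
proof -
  have "upper_hull a b A v \<inter> {x. pt 0 1 \<bullet> x \<ge> 0} = convex hull ({pt b 0, pt (-a) 0} \<union> A)"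
    unfolding upper_hull_def
  proof (rule hull_halfspace)
    fix x assume "x \<in> convex hull ({pt b 0, pt (-a) 0} \<union> A \<union> {v})" "pt 0 1 \<bullet> x = 0"
    then have "x \<in> upper_hull a b A v" "x $ 2 = 0" by (auto simp: upper_hull_def inner_real2)
    then have "- a \<le> x $ 1" "x $ 1 \<le> b" "pt (x $ 1) 0 = x" using assms by (auto simp: upper_ok_def real2_eq_iff)
    then show "x \<in> convex hull ({pt b 0, pt (-a) 0} \<union> A)"
      using axis_segment_hull[of a b "x $ 1" "{pt b 0, pt (-a) 0} \<union> A"] assms by (auto simp: upper_ok_def)
  qed (use assms in \<open>auto simp: upper_ok_def inner_real2 intro: hull_inc\<close>)
  then show ?thesis by (simp add: inner_real2)
qed

lemma upper_ok_subset:
  assumes "upper_ok a b A v" "upper_hull a b A' v' \<subseteq> upper_hull a b A v" "finite A'" "A' \<noteq> {}" "\<And>x. x \<in> A' \<Longrightarrow> x $ 2 > 0" "v' $ 2 < 0"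
  shows "upper_ok a b A' v'"
proof -
  have "\<forall>x\<in>upper_hull a b A' v'. x $ 2 = 0 \<longrightarrow> - a \<le> x $ 1 \<and> x $ 1 \<le> b"
    using assms(1,2) unfolding upper_ok_def by (meson subsetD)
  then show ?thesis using assms unfolding upper_ok_def by simp
qed

lemma upper_hull_base:
  assumes "upper_ok a b A v"
  shows "pt b 0 \<in> upper_hull a b A v" "pt (-a) 0 \<in> upper_hull a b A v" "v \<in> upper_hull a b A v"
    "A \<subseteq> upper_hull a b A v" "0 \<in> upper_hull a b A v" "convex (upper_hull a b A v)"
proof -
  have "{pt b 0, pt (-a) 0} \<union> A \<union> {v} \<subseteq> upper_hull a b A v"
    unfolding upper_hull_def by (rule hull_subset)
  then show "pt b 0 \<in> upper_hull a b A v" "pt (-a) 0 \<in> upper_hull a b A v" "v \<in> upper_hull a b A v"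
    "A \<subseteq> upper_hull a b A v" by auto
  show "0 \<in> upper_hull a b A v" "convex (upper_hull a b A v)"
    using polytopes_oD(2,6)[OF upper_hull_in_o[OF assms]] by auto
qed

lemma upper_hull_subsetI:
  assumes "upper_ok a b A v" "A' \<subseteq> upper_hull a b A v" "v' \<in> upper_hull a b A v"
  shows "upper_hull a b A' v' \<subseteq> upper_hull a b A v"
proof -
  have "{pt b 0, pt (-a) 0} \<union> A' \<union> {v'} \<subseteq> upper_hull a b A v"
    using assms(2,3) upper_hull_base(1,2)[OF assms(1)] by auto
  then show ?thesis
    unfolding upper_hull_def[of a b A' v'] using upper_hull_base(6)[OF assms(1)] by (rule hull_minimal)
qed

lemma upper_ok_mono:
  assumes "upper_ok a b A v" "A' \<subseteq> upper_hull a b A v" "v' \<in> upper_hull a b A v"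
    "finite A'" "A' \<noteq> {}" "\<And>x. x \<in> A' \<Longrightarrow> x $ 2 > 0" "v' $ 2 < 0"
  shows "upper_ok a b A' v'"
  using upper_ok_subset[OF assms(1) upper_hull_subsetI[OF assms(1-3)]] assms by blast

lemma upper_ok_remove:
  assumes "upper_ok a b A v" "A' \<subseteq> A" "A' \<noteq> {}"
  shows "upper_ok a b A' v"
  using assms upper_okD[OF assms(1)] upper_hull_base(3,4)[OF assms(1)]
  by (intro upper_ok_mono[OF assms(1)]) (auto intro: finite_subset)

context quad_null_valuation
begin

text \<open>The only generator below the first axis is \<open>v\<close>, so it may be traded for any
  other point of the polygon below the axis.\<close>

lemma swap_lower:
  assumes ok: "upper_ok a b A v" and v': "v' \<in> upper_hull a b A v" "v' $ 2 < 0"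
  shows "upper_ok a b A v'" "\<mu> (upper_hull a b A v) = \<mu> (upper_hull a b A v')"
proof -
  show "upper_ok a b A v'"
    using upper_okD[OF ok] v' upper_hull_base(4)[OF ok] by (intro upper_ok_mono[OF ok]) auto
  have "\<mu> (upper_hull a b A v) = \<mu> (convex hull (insert v' (upper_hull a b A v \<inter> {x. pt 0 (-1) \<bullet> x \<le> 0})))"
  proof (rule one_side_zero[OF upper_hull_in_o[OF ok] upper_hull_def, of v])
    fix x assume "x \<in> {pt b 0, pt (-a) 0} \<union> A \<union> {v}" "pt 0 (-1) \<bullet> x > 0"
    then show "x = v" using upper_okD(5)[OF ok, of x] by (auto simp: inner_real2)
  qed (use upper_okD[OF ok] v' upper_hull_base[OF ok] in \<open>auto simp: inner_real2\<close>)
  also have "\<dots> = \<mu> (convex hull ({v'} \<union> convex hull ({pt b 0, pt (-a) 0} \<union> A)))"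
    unfolding upper_hull_upper[OF ok] by simp
  also have "\<dots> = \<mu> (convex hull ({v'} \<union> ({pt b 0, pt (-a) 0} \<union> A)))"
    by (simp only: hull_Un_right[symmetric])
  also have "\<dots> = \<mu> (upper_hull a b A v')" by (simp add: upper_hull_def insert_commute)
  finally show "\<mu> (upper_hull a b A v) = \<mu> (upper_hull a b A v')" .
qed

lemma drop_redundant:
  assumes ok: "upper_ok a b A v" and y: "y \<in> A" "y \<in> upper_hull a b (A - {y}) v" and ne: "A - {y} \<noteq> {}"
  shows "upper_ok a b (A - {y}) v" "upper_hull a b A v = upper_hull a b (A - {y}) v"
proof -
  show "upper_ok a b (A - {y}) v" using ne by (intro upper_ok_remove[OF ok]) auto
  have "{pt b 0, pt (-a) 0} \<union> A \<union> {v} = insert y ({pt b 0, pt (-a) 0} \<union> (A - {y}) \<union> {v})"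
    using y by auto
  then show "upper_hull a b A v = upper_hull a b (A - {y}) v"
    using y(2) unfolding upper_hull_def by (simp only: hull_redundant)
qed

lemma single_zero:
  assumes "upper_ok a b {u} v"
  shows "\<mu> (upper_hull a b {u} v) = 0"
proof (rule quad_zero[OF upper_hull_in_o[OF assms], of u v "pt 0 1"])
  let ?X = "upper_hull a b {u} v"
  note B = upper_hull_base[OF assms]
  show "?X = convex hull (insert u (insert v (?X \<inter> {x. pt 0 1 \<bullet> x = 0})))"
  proof
    show "convex hull (insert u (insert v (?X \<inter> {x. pt 0 1 \<bullet> x = 0}))) \<subseteq> ?X"
      using B by (intro hull_minimal) auto
    have "{pt b 0, pt (-a) 0} \<union> {u} \<union> {v} \<subseteq> convex hull (insert u (insert v (?X \<inter> {x. pt 0 1 \<bullet> x = 0})))"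
      using B by (auto intro!: hull_inc simp: inner_real2)
    then show "?X \<subseteq> convex hull (insert u (insert v (?X \<inter> {x. pt 0 1 \<bullet> x = 0})))"
      unfolding upper_hull_def[of a b "{u}" v] by (intro hull_minimal) auto
  qed
qed (use upper_okD[OF assms] upper_hull_base[OF assms] in \<open>auto simp: inner_real2\<close>)

lemma same_ray_redundant:
  assumes ok: "upper_ok a b A v" and xy: "x \<in> A" "y \<in> A" "x \<noteq> y" "det2 x y = 0"
  obtains z where "z \<in> A" "z \<in> upper_hull a b (A - {z}) v" "A - {z} \<noteq> {}"
proof -
  note goal = that
  have key: thesis if xy: "x \<in> A" "y \<in> A" "x \<noteq> y" "det2 x y = 0" "y $ 2 \<le> x $ 2" for x y
  proof -
    have p: "x $ 2 > 0" "y $ 2 > 0" using upper_okD[OF ok] xy by auto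
    define t where "t = y $ 2 / x $ 2"
    have t: "0 \<le> t" "t \<le> 1" using p xy by (auto simp: t_def)
    have "y = t *\<^sub>R x" using p xy by (simp add: real2_eq_iff t_def det2_def field_simps)
    then have y: "y = t *\<^sub>R x + (1 - t) *\<^sub>R 0" by simp
    have ne: "A - {y} \<noteq> {}" using xy by auto
    have "upper_ok a b (A - {y}) v" using ne by (intro upper_ok_remove[OF ok]) auto
    note B = upper_hull_base[OF this]
    have "x \<in> upper_hull a b (A - {y}) v" using B(4) xy by auto
    then have "t *\<^sub>R x + (1 - t) *\<^sub>R 0 \<in> upper_hull a b (A - {y}) v"
      using t B by (intro convexD) auto
    then have "y \<in> upper_hull a b (A - {y}) v" using y by simp
    then show thesis using goal[of y] xy(2) ne by blast
  qed
  show thesis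
  proof (cases "y $ 2 \<le> x $ 2")
    case True then show ?thesis using key[of x y] xy by blast
  next
    case False
    have "det2 y x = 0" using xy(4) by (simp add: det2_def algebra_simps)
    then show ?thesis using key[of y x] xy False by auto
  qed
qed

lemma small_multiple_in_upper_hull:
  assumes "upper_ok a b A v"
  obtains d where "d > 0" "\<And>s. 0 < s \<Longrightarrow> s \<le> d \<Longrightarrow> (- s) *\<^sub>R x \<in> upper_hull a b A v"
proof -
  obtain t where t: "t > 0" "\<And>s. \<bar>s\<bar> \<le> t \<Longrightarrow> s *\<^sub>R x \<in> upper_hull a b A v"
    using zero_interior_absorbing[OF polytopes_oD(5)[OF upper_hull_in_o[OF assms]]] by blast
  show ?thesis by (rule that[OF t(1)], rule t(2)) simp
qed

text \<open>With the lower vertex moved to the ray opposite \<open>e\<close>, the line through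
  \<open>e\<close> and the origin meets the polygon in the segment from that vertex to the boundary
  point \<open>r *\<^sub>R e\<close>. Cutting along this line yields two hulls of the same kind, one
  with the upper points on either side of \<open>e\<close>.\<close>

lemma split_middle:
  assumes ok: "upper_ok a b A v" and e: "e \<in> A"
  obtains v' r where "r > 0" "v' $ 2 < 0"
    "upper_ok a b (insert (r *\<^sub>R e) {x \<in> A. det2 e x > 0}) v'"
    "upper_ok a b (insert (r *\<^sub>R e) {x \<in> A. det2 e x < 0}) v'"
    "\<mu> (upper_hull a b A v) = \<mu> (upper_hull a b (insert (r *\<^sub>R e) {x \<in> A. det2 e x > 0}) v')
      + \<mu> (upper_hull a b (insert (r *\<^sub>R e) {x \<in> A. det2 e x < 0}) v')"
proof -
  note okD = upper_okD[OF ok]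
  have e2: "e $ 2 > 0" using okD e by auto
  obtain d where d: "d > 0" "(- d) *\<^sub>R e \<in> upper_hull a b A v"
    using small_multiple_in_upper_hull[OF ok, of e] by (metis order_refl)
  define v' where "v' = (- d) *\<^sub>R e"
  have v'2: "v' $ 2 < 0" using d e2 by (simp add: v'_def)
  have ok': "upper_ok a b A v'" and eq: "\<mu> (upper_hull a b A v) = \<mu> (upper_hull a b A v')"
    using swap_lower[OF ok, of v'] d v'2 by (auto simp: v'_def)
  define X where "X = upper_hull a b A v'"
  note Xo = upper_hull_in_o[OF ok', folded X_def]
  note B = upper_hull_base[OF ok', folded X_def]
  define n where "n = pt (- e $ 2) (e $ 1)"
  have n: "n \<bullet> x = det2 e x" for x by (simp add: n_def det2_def inner_real2)
  have "e \<noteq> 0" using e2 by auto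
  then obtain c r where cr: "c > 0" "r > 0" "\<And>s. s *\<^sub>R e \<in> X \<longleftrightarrow> - c \<le> s \<and> s \<le> r"
    using axis_section_interval[OF Xo] by blast
  define E where "E = r *\<^sub>R e"
  have E: "E \<in> X" "E $ 2 > 0" "det2 e E = 0" using cr e2 by (auto simp: E_def det2_def)
  have bound: "- d * e $ 2 \<le> x $ 2" if "x \<in> X" for x
  proof -
    have "pt 0 (-1) \<bullet> x \<le> d * e $ 2"
    proof (rule halfplane_hull)
      show "x \<in> convex hull ({pt b 0, pt (-a) 0} \<union> A \<union> {v'})" using that by (simp add: X_def upper_hull_def)
      fix y assume "y \<in> {pt b 0, pt (-a) 0} \<union> A \<union> {v'}"
      moreover have "d * e $ 2 > 0" using d e2 by simp
      moreover have "y $ 2 > 0" if "y \<in> A" using okD that by auto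
      ultimately show "pt 0 (-1) \<bullet> y \<le> d * e $ 2" by (auto simp: inner_real2 v'_def)
    qed
    then show ?thesis by (simp add: inner_real2)
  qed
  have sec: "x \<in> convex hull {E, v'}" if x: "x \<in> X" "det2 e x = 0" for x
  proof -
    define s where "s = x $ 2 / e $ 2"
    have xs: "x = s *\<^sub>R e" using x(2) e2 by (simp add: real2_eq_iff s_def det2_def field_simps)
    have "s *\<^sub>R e \<in> X" using x(1) xs by simp
    then have s1: "s \<le> r" using cr(3) by blast
    have "- d * e $ 2 \<le> s * e $ 2" using bound[OF x(1)] e2 by (simp add: s_def)
    then have s: "s \<le> r" "- d \<le> s" using s1 e2 by (simp_all only: mult_le_cancel_right_pos)
    have "((s + d) / (r + d)) *\<^sub>R E + ((r - s) / (r + d)) *\<^sub>R v' \<in> convex hull {E, v'}"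
      using s cr(1,2) d(1)
      by (intro convexD[OF convex_convex_hull] hull_inc) (simp_all add: add_divide_distrib[symmetric])
    moreover have "((s + d) / (r + d)) *\<^sub>R E + ((r - s) / (r + d)) *\<^sub>R v' = x"
    proof -
      have "(s + d) / (r + d) * r + (r - s) / (r + d) * (- d) = s"
        using cr(2) d(1) by (simp add: divide_simps) (simp add: algebra_simps)
      then show ?thesis
        unfolding xs E_def v'_def by (simp only: scaleR_scaleR scaleR_add_left[symmetric])
    qed
    ultimately show ?thesis by simp
  qed
  have pq: "det2 e (pt (-a) 0) > 0" "det2 e (pt b 0) < 0" using okD e2 by (auto simp: det2_def)
  have half: "X \<inter> {x. s * det2 e x \<ge> 0} = convex hull (insert p (insert E (insert v' {x \<in> A. s * det2 e x > 0})))"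
    if s: "s = 1 \<and> p = pt (-a) 0 \<or> s = -1 \<and> p = pt b 0" for s p
  proof -
    have sn: "s * det2 e x = (s *\<^sub>R n) \<bullet> x" for x by (simp add: n)
    have "X \<inter> {x. (s *\<^sub>R n) \<bullet> x \<ge> 0} = convex hull (insert p (insert E (insert v' {x \<in> A. s * det2 e x > 0})))"
      unfolding X_def upper_hull_def
    proof (rule hull_halfspace)
      fix x assume "x \<in> convex hull ({pt b 0, pt (-a) 0} \<union> A \<union> {v'})" "(s *\<^sub>R n) \<bullet> x = 0"
      then have "x \<in> convex hull {E, v'}" using s n by (intro sec) (auto simp: X_def upper_hull_def)
      moreover have "convex hull {E, v'} \<subseteq> convex hull (insert p (insert E (insert v' {x \<in> A. s * det2 e x > 0})))"
        by (intro hull_mono) auto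
      ultimately show "x \<in> convex hull (insert p (insert E (insert v' {x \<in> A. s * det2 e x > 0})))" by auto
    next
      show "insert p (insert E (insert v' {x \<in> A. s * det2 e x > 0})) \<subseteq> convex hull ({pt b 0, pt (-a) 0} \<union> A \<union> {v'})"
        using E(1) B s by (auto simp: X_def upper_hull_def)
    next
      fix x assume "x \<in> insert p (insert E (insert v' {x \<in> A. s * det2 e x > 0}))"
      moreover have "det2 e v' = 0" by (simp add: v'_def det2_def)
      ultimately show "(s *\<^sub>R n) \<bullet> x \<ge> 0" unfolding sn[symmetric] using s pq E(3) by auto
    next
      fix x assume "x \<in> {pt b 0, pt (-a) 0} \<union> A \<union> {v'}" "(s *\<^sub>R n) \<bullet> x > 0"
      then show "x \<in> insert p (insert E (insert v' {x \<in> A. s * det2 e x > 0}))"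
        unfolding sn[symmetric] using s pq by auto
    qed
    then show ?thesis unfolding sn .
  qed
  have up: "X \<inter> {x. n \<bullet> x \<ge> 0} = convex hull (insert (pt (-a) 0) (insert E (insert v' {x \<in> A. det2 e x > 0})))"
    using half[of 1 "pt (-a) 0"] by (simp add: n)
  have down: "X \<inter> {x. n \<bullet> x \<le> 0} = convex hull (insert (pt b 0) (insert E (insert v' {x \<in> A. det2 e x < 0})))"
    using half[of "-1" "pt b 0"] by (simp add: n)
  have ins: "convex hull (insert p (convex hull S)) = convex hull (insert p S)" for p and S :: "(real^2) set"
    using hull_Un_right[of convex "{p}" S] by simp
  \<comment> \<open>The ends of the diagonal serve as apexes of the cut: each half regains the end
    it lost and has its full section on the first axis again.\<close>
  have "\<mu> X = \<mu> (convex hull (insert (pt b 0) (X \<inter> {x. n \<bullet> x \<ge> 0}))) + \<mu> (convex hull (insert (pt (-a) 0) (X \<inter> {x. n \<bullet> x \<le> 0})))"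
    using pq B by (intro cut_zero[OF Xo]) (auto simp: n)
  also have "convex hull (insert (pt b 0) (X \<inter> {x. n \<bullet> x \<ge> 0})) = upper_hull a b (insert E {x \<in> A. det2 e x > 0}) v'"
    unfolding up ins upper_hull_def by (simp add: insert_commute)
  also have "convex hull (insert (pt (-a) 0) (X \<inter> {x. n \<bullet> x \<le> 0})) = upper_hull a b (insert E {x \<in> A. det2 e x < 0}) v'"
    unfolding down ins upper_hull_def by (simp add: insert_commute)
  finally have "\<mu> (upper_hull a b A v) = \<mu> (upper_hull a b (insert E {x \<in> A. det2 e x > 0}) v')
      + \<mu> (upper_hull a b (insert E {x \<in> A. det2 e x < 0}) v')" using eq by (simp add: X_def)
  moreover have "upper_ok a b (insert E {x \<in> A. det2 e x > 0}) v'" "upper_ok a b (insert E {x \<in> A. det2 e x < 0}) v'"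
    by (rule upper_ok_mono[OF ok', folded X_def]; use E B okD v'2 in auto)+
  ultimately show ?thesis using that[OF cr(2) v'2] by (simp add: E_def)
qed

end

section \<open>Two upper vertices, and the induction over their number\<close>

context quad_null_valuation
begin

text \<open>The inequalities place both ends of the diagonal on the origin's side of the line
  through \<open>e\<close> and \<open>f\<close>. Once the lower vertex is moved to the ray opposite
  \<open>f\<close>, the line through \<open>f\<close> and the origin has the single vertex
  \<open>p\<close> on one side. Trading \<open>p\<close> for a point \<open>w\<close> on the ray
  opposite \<open>e\<close> produces a quadrilateral with diagonal from \<open>w\<close> to
  \<open>e\<close> through the origin.\<close>

lemma pair_zero_aux:
  assumes ok: "upper_ok a b {e, f} v" and D0: "det2 e f > 0"
    and red: "a * e $ 2 \<le> det2 e f + a * f $ 2" "b * f $ 2 \<le> det2 e f + b * e $ 2"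
  shows "\<mu> (upper_hull a b {e, f} v) = 0"
proof -
  note okD = upper_okD[OF ok]
  define D where "D = det2 e f"
  have D: "D > 0" using D0 by (simp add: D_def)
  have ef: "e $ 2 > 0" "f $ 2 > 0" using okD by auto
  define p q where "p = pt (-a) 0" and "q = pt b 0"
  \<comment> \<open>Up to the factor \<open>D\<close> this is the dual basis of \<open>e\<close>,
    \<open>f\<close>. The sum \<open>ne + nf\<close> takes the value \<open>D\<close> on the line
    through \<open>e\<close> and \<open>f\<close>.\<close>
  define ne nf where "ne = pt (f $ 2) (- f $ 1)" and "nf = pt (- e $ 2) (e $ 1)"
  have ne: "ne \<bullet> e = D" "ne \<bullet> f = 0" "nf \<bullet> e = 0" "nf \<bullet> f = D"
    by (simp_all add: ne_def nf_def inner_real2 D_def det2_def)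
  define \<alpha> \<beta> c where "\<alpha> = b * f $ 2 / D" and "\<beta> = b * e $ 2 / D" and "c = a / b"
  have pos: "\<alpha> > 0" "\<beta> > 0" "c > 0" using okD ef D by (simp_all add: \<alpha>_def \<beta>_def c_def)
  have "ne \<bullet> q = b * f $ 2" "nf \<bullet> q = - b * e $ 2" "ne \<bullet> p = - a * f $ 2" "nf \<bullet> p = a * e $ 2"
    by (simp_all add: ne_def nf_def inner_real2 p_def q_def)
  then have pq: "ne \<bullet> q = \<alpha> * D" "nf \<bullet> q = - \<beta> * D" "ne \<bullet> p = - c * \<alpha> * D" "nf \<bullet> p = c * \<beta> * D"
    using D okD by (simp_all add: \<alpha>_def \<beta>_def c_def)
  have coord: "x = (ne \<bullet> x / D) *\<^sub>R e + (nf \<bullet> x / D) *\<^sub>R f" for x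
  proof -
    have "D *\<^sub>R x = (ne \<bullet> x) *\<^sub>R e + (nf \<bullet> x) *\<^sub>R f"
      by (simp add: real2_eq_iff ne_def nf_def inner_real2 D_def det2_def algebra_simps)
    then have "x = (1 / D) *\<^sub>R ((ne \<bullet> x) *\<^sub>R e + (nf \<bullet> x) *\<^sub>R f)" using D by (metis divide_self_if less_irrefl scaleR_one scaleR_scaleR times_divide_eq_left mult_1)
    then show ?thesis by (simp add: scaleR_add_right)
  qed
  have q: "q = \<alpha> *\<^sub>R e - \<beta> *\<^sub>R f" using coord[of q] pq D by simp
  have red': "c * \<beta> * D - c * \<alpha> * D \<le> D" "\<alpha> * D - \<beta> * D \<le> D"
    using red D okD by (simp_all add: \<alpha>_def \<beta>_def c_def D_def)
  obtain d0 where d0: "d0 > 0" "\<And>s. 0 < s \<Longrightarrow> s \<le> d0 \<Longrightarrow> (- s) *\<^sub>R f \<in> upper_hull a b {e, f} v"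
    using small_multiple_in_upper_hull[OF ok, of f] by blast
  define \<delta> where "\<delta> = min d0 (\<beta> / 2)"
  have \<delta>: "\<delta> > 0" "\<delta> \<le> d0" "\<delta> < \<beta>" using d0(1) pos by (auto simp: \<delta>_def)
  define v' where "v' = (- \<delta>) *\<^sub>R f"
  have v'2: "v' $ 2 < 0" using \<delta> ef by (simp add: v'_def)
  have v'in: "v' \<in> upper_hull a b {e, f} v" unfolding v'_def using d0(2) \<delta> by blast
  have ok': "upper_ok a b {e, f} v'" and eq: "\<mu> (upper_hull a b {e, f} v) = \<mu> (upper_hull a b {e, f} v')"
    using swap_lower[OF ok v'in v'2] by auto
  \<comment> \<open>The factor puts \<open>w\<close> on the line through \<open>q\<close> and
    \<open>v'\<close>, so that \<open>v'\<close> lies between them and the new polygon agrees with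
    the old one on the side of \<open>q\<close>. It is positive because
    \<open>\<delta> < \<beta>\<close>.\<close>
  define \<delta>' where "\<delta>' = \<delta> * \<alpha> / (\<beta> - \<delta>)"
  have \<delta>': "\<delta>' > 0" "\<delta>' * (\<beta> - \<delta>) = \<delta> * \<alpha>" using \<delta> pos by (auto simp: \<delta>'_def)
  define w where "w = (- \<delta>') *\<^sub>R e"
  define S where "S = {q, p, e, f, v'}"
  define S' where "S' = {w, q, e, f}"
  define X where "X = upper_hull a b {e, f} v'"
  define Y where "Y = convex hull S'"
  have XS: "X = convex hull S" by (simp add: X_def upper_hull_def S_def p_def q_def insert_commute)
  have Xo: "X \<in> polytopes_o" unfolding X_def by (rule upper_hull_in_o[OF ok'])
  have v'Y: "v' \<in> Y"
  proof -
    have "(1 - \<delta> / \<beta>) *\<^sub>R w + (\<delta> / \<beta>) *\<^sub>R q \<in> Y"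
      unfolding Y_def using \<delta> pos by (intro convexD[OF convex_convex_hull] hull_inc) (auto simp: S'_def)
    moreover have "(1 - \<delta> / \<beta>) *\<^sub>R w + (\<delta> / \<beta>) *\<^sub>R q = v'"
    proof -
      have "(1 - \<delta> / \<beta>) * \<delta>' = \<delta> / \<beta> * \<alpha>" using \<delta>'(2) pos by (simp add: field_simps)
      then have "(1 - \<delta> / \<beta>) *\<^sub>R w = - ((\<delta> / \<beta> * \<alpha>) *\<^sub>R e)" by (simp add: w_def)
      then show ?thesis using pos by (simp add: q v'_def scaleR_diff_right)
    qed
    ultimately show ?thesis by simp
  qed
  \<comment> \<open>With this slope, \<open>\<kappa> *\<^sub>R ne - nf\<close> equals
    \<open>\<delta> * D\<close> on the line through \<open>q\<close>, \<open>v'\<close> and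
    \<open>w\<close>. Together with \<open>ne + nf\<close> it confines the section of both hulls
    with the line through \<open>f\<close> to the segment from \<open>v'\<close> to
    \<open>f\<close>.\<close>
  define \<kappa> where "\<kappa> = (\<delta> - \<beta>) / \<alpha>"
  have \<kappa>: "\<kappa> < 0" "\<kappa> * \<alpha> = \<delta> - \<beta>" using \<delta> pos by (auto simp: \<kappa>_def divide_neg_pos)
  have bounds: "(ne + nf) \<bullet> x \<le> D" "(\<kappa> *\<^sub>R ne - nf) \<bullet> x \<le> \<delta> * D" if "x \<in> S \<union> S'" for x
  proof -
    have \<delta>D: "\<delta> * D > 0" "\<delta>' * D > 0" using \<delta> \<delta>' D by auto
    have "x = q \<or> x = p \<or> x = e \<or> x = f \<or> x = v' \<or> x = w" using that by (auto simp: S_def S'_def)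
    then show "(ne + nf) \<bullet> x \<le> D"
      using red' D \<delta>D by (auto simp: inner_add_left pq ne v'_def w_def)
    have "\<kappa> * (\<alpha> * D) + \<beta> * D = \<delta> * D"
      using \<kappa>(2) by (simp add: mult.assoc[symmetric] left_diff_distrib)
    moreover have "\<kappa> * (- c * \<alpha> * D) - c * \<beta> * D = - c * (\<delta> * D)"
    proof -
      have "\<kappa> * (- c * \<alpha> * D) = - c * D * (\<kappa> * \<alpha>)" by simp
      then show ?thesis unfolding \<kappa>(2) by (simp add: algebra_simps)
    qed
    moreover have "c * (\<delta> * D) > 0" "\<kappa> \<le> \<delta>" using pos \<delta>D \<kappa> \<delta> by auto
    moreover have "\<kappa> * (- \<delta>' * D) = \<delta> * D"
    proof -
      have "\<kappa> * (- \<delta>' * D) = (\<delta>' * (\<beta> - \<delta>)) / \<alpha> * D" by (simp add: \<kappa>_def divide_simps) (simp add: algebra_simps)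
      then show ?thesis unfolding \<delta>'(2) using pos by simp
    qed
    ultimately show "(\<kappa> *\<^sub>R ne - nf) \<bullet> x \<le> \<delta> * D"
      using \<open>x = q \<or> _\<close> D \<delta>D by (auto simp: inner_diff_left pq ne v'_def w_def)
  qed
  have sec: "x \<in> convex hull {q, e, f, v'}" if "x \<in> convex hull S \<or> x \<in> convex hull S'" "ne \<bullet> x = 0" for x
  proof -
    have "(ne + nf) \<bullet> x \<le> D" "(\<kappa> *\<^sub>R ne - nf) \<bullet> x \<le> \<delta> * D"
      using that(1) bounds halfplane_hull[of S _ _ x] halfplane_hull[of S' _ _ x] by blast+
    then have s: "nf \<bullet> x \<le> D" "- \<delta> * D \<le> nf \<bullet> x" using that(2) by (simp_all add: inner_add_left inner_diff_left)
    define s where "s = nf \<bullet> x / D"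
    have xs: "x = s *\<^sub>R f" using coord[of x] that(2) by (simp add: s_def)
    have s: "s \<le> 1" "- \<delta> \<le> s" using s D by (auto simp: s_def pos_le_divide_eq)
    have "((s + \<delta>) / (1 + \<delta>)) *\<^sub>R f + ((1 - s) / (1 + \<delta>)) *\<^sub>R v' \<in> convex hull {q, e, f, v'}"
      using s \<delta> by (intro convexD[OF convex_convex_hull] hull_inc) (simp_all add: add_divide_distrib[symmetric])
    moreover have "((s + \<delta>) / (1 + \<delta>)) *\<^sub>R f + ((1 - s) / (1 + \<delta>)) *\<^sub>R v' = x"
    proof -
      have "(s + \<delta>) / (1 + \<delta>) + (1 - s) / (1 + \<delta>) * (- \<delta>) = s"
        using \<delta>(1) by (simp add: divide_simps) (simp add: algebra_simps)
      then show ?thesis unfolding xs v'_def by (simp only: scaleR_scaleR scaleR_add_left[symmetric])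
    qed
    ultimately show ?thesis by simp
  qed
  have sgn: "ne \<bullet> q > 0" "ne \<bullet> e > 0" "ne \<bullet> f = 0" "ne \<bullet> v' = 0" "ne \<bullet> p < 0" "ne \<bullet> w < 0"
    using pos D \<delta>' by (auto simp: pq ne v'_def w_def)
  have XR: "X \<inter> {x. ne \<bullet> x \<ge> 0} = convex hull {q, e, f, v'}"
    unfolding XS
  proof (rule hull_halfspace)
    show "{q, e, f, v'} \<subseteq> convex hull S" by (auto simp: S_def intro: hull_inc)
    show "x \<in> {q, e, f, v'}" if "x \<in> S" "ne \<bullet> x > 0" for x using that sgn by (auto simp: S_def)
  qed (use sec sgn in auto)
  have YR: "Y \<inter> {x. ne \<bullet> x \<ge> 0} = convex hull {q, e, f, v'}"
    unfolding Y_def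
  proof (rule hull_halfspace)
    show "{q, e, f, v'} \<subseteq> convex hull S'" using v'Y unfolding Y_def by (auto simp: S'_def intro: hull_inc)
    show "x \<in> {q, e, f, v'}" if "x \<in> S'" "ne \<bullet> x > 0" for x using that sgn by (auto simp: S'_def)
  qed (use sec sgn in auto)
  have S'Y: "w \<in> Y" "q \<in> Y" "e \<in> Y" "f \<in> Y" unfolding Y_def by (auto simp: S'_def intro: hull_inc)
  have seg: "s *\<^sub>R e \<in> Y" if "- \<delta>' \<le> s" "s \<le> 1" for s
  proof -
    have "((s + \<delta>') / (1 + \<delta>')) *\<^sub>R e + ((1 - s) / (1 + \<delta>')) *\<^sub>R w \<in> Y"
      unfolding Y_def using that \<delta>' S'Y[unfolded Y_def]
      by (intro convexD[OF convex_convex_hull]) (simp_all add: add_divide_distrib[symmetric])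
    moreover have "((s + \<delta>') / (1 + \<delta>')) *\<^sub>R e + ((1 - s) / (1 + \<delta>')) *\<^sub>R w = s *\<^sub>R e"
    proof -
      have "(s + \<delta>') / (1 + \<delta>') + (1 - s) / (1 + \<delta>') * (- \<delta>') = s"
        using \<delta>'(1) by (simp add: divide_simps) (simp add: algebra_simps)
      then show ?thesis unfolding w_def by (simp only: scaleR_scaleR scaleR_add_left[symmetric])
    qed
    ultimately show ?thesis by simp
  qed
  have nfq: "nf \<bullet> f > 0" "nf \<bullet> q < 0" using ne pq D pos by auto
  have "0 \<in> interior Y"
  proof (rule zero_interior_two_sidedI[OF _ _ S'Y(4,2) nfq])
    show "convex Y" by (simp add: Y_def)
    show "0 \<in> Y" using seg[of 0] \<delta>' by simp
    fix y assume y: "nf \<bullet> y = 0"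
    define k where "k = ne \<bullet> y / D"
    have yk: "y = k *\<^sub>R e" using coord[of y] y by (simp add: k_def)
    define t where "t = min 1 \<delta>' / (\<bar>k\<bar> + 1)"
    have t: "t > 0" using \<delta>' by (simp add: t_def add_nonneg_pos)
    have "\<bar>t * k\<bar> \<le> min 1 \<delta>'"
    proof -
      have "\<bar>t * k\<bar> = min 1 \<delta>' * (\<bar>k\<bar> / (\<bar>k\<bar> + 1))" using \<delta>' by (simp add: t_def abs_mult)
      also have "\<dots> \<le> min 1 \<delta>' * 1" using \<delta>' by (intro mult_left_mono) (auto simp: divide_le_eq)
      finally show ?thesis by simp
    qed
    then have "(t * k) *\<^sub>R e \<in> Y" by (intro seg) auto
    then show "\<exists>t>0. t *\<^sub>R y \<in> Y" using t yk by auto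
  qed
  then have Yo: "Y \<in> polytopes_o" using polytope_convex_hull[of S'] by (simp add: polytopes_o_def Y_def S'_def)
  have "0 \<in> interior (X \<inter> Y)" using polytopes_oD(5)[OF Xo] polytopes_oD(5)[OF Yo] by simp
  then obtain t where t: "t > 0" "\<And>s. \<bar>s\<bar> \<le> t \<Longrightarrow> s *\<^sub>R e \<in> X \<inter> Y" using zero_interior_absorbing by blast
  define x0 where "x0 = (- t) *\<^sub>R e"
  have x0: "x0 \<in> X" "x0 \<in> Y" "(- ne) \<bullet> x0 > 0" using t(1) t(2)[of "-t"] ne D by (auto simp: x0_def)
  \<comment> \<open>Both polygons have one generator beyond the line and the same half on its other
    side. Trading these generators for the common point \<open>x0\<close> makes the two polygons
    equal.\<close>
  have "\<mu> X = \<mu> (convex hull (insert x0 (X \<inter> {x. (- ne) \<bullet> x \<le> 0})))"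
  proof (rule one_side_zero[OF Xo XS, of p])
    show "p \<in> X" unfolding XS by (auto simp: S_def intro: hull_inc)
  qed (use sgn x0 in \<open>auto simp: S_def\<close>)
  also have "\<dots> = \<mu> (convex hull (insert x0 (Y \<inter> {x. (- ne) \<bullet> x \<le> 0})))" using XR YR by simp
  also have "\<dots> = \<mu> Y"
    by (rule one_side_zero[OF Yo Y_def, of w, symmetric]) (use sgn x0 S'Y in \<open>auto simp: S'_def\<close>)
  also have "\<mu> Y = 0"
  proof (rule quad_zero[OF Yo S'Y(4,2) nfq])
    show "Y = convex hull (insert f (insert q (Y \<inter> {x. nf \<bullet> x = 0})))"
    proof
      show "convex hull (insert f (insert q (Y \<inter> {x. nf \<bullet> x = 0}))) \<subseteq> Y"
        using S'Y polytopes_oD(2)[OF Yo] by (intro hull_minimal) auto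
      have "S' \<subseteq> convex hull (insert f (insert q (Y \<inter> {x. nf \<bullet> x = 0})))"
        using S'Y ne by (auto simp: S'_def w_def intro!: hull_inc)
      then show "Y \<subseteq> convex hull (insert f (insert q (Y \<inter> {x. nf \<bullet> x = 0})))"
        unfolding Y_def[of] by (rule hull_minimal) simp
    qed
  qed
  finally show ?thesis using eq by (simp add: X_def)
qed

text \<open>If one of the two inequalities fails, one upper vertex lies in the triangle spanned by
  the origin, the other upper vertex and an end of the diagonal. It is then redundant, and a polygon
  with a single upper vertex remains.\<close>

lemma pair_zero:
  assumes ok: "upper_ok a b {e, f} v" and D: "det2 e f > 0"
  shows "\<mu> (upper_hull a b {e, f} v) = 0"
proof -
  note okD = upper_okD[OF ok]
  have ef: "e $ 2 > 0" "f $ 2 > 0" using okD by auto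
  have nn: "a * f $ 2 > 0" "b * e $ 2 > 0" using okD ef by simp_all
  have ne: "e \<noteq> f" using D by (auto simp: det2_def)
  have drop: ?thesis if zx: "z \<in> {e, f}" "x \<in> {e, f}" "z \<noteq> x"
    and t: "\<tau> \<ge> 1" "0 \<le> \<omega>" "\<omega> \<le> 1" "\<tau> *\<^sub>R z = \<omega> *\<^sub>R r + (1 - \<omega>) *\<^sub>R x" "r \<in> {pt b 0, pt (-a) 0}" for z x r \<tau> \<omega>
  proof -
    have A: "{e, f} - {z} = {x}" using zx by auto
    have okx: "upper_ok a b {x} v" using zx by (intro upper_ok_remove[OF ok]) auto
    note B = upper_hull_base[OF okx]
    have "\<omega> *\<^sub>R r + (1 - \<omega>) *\<^sub>R x \<in> upper_hull a b {x} v" using B t(2,3,5) by (intro convexD) auto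
    then have "\<tau> *\<^sub>R z \<in> upper_hull a b {x} v" using t(4) by simp
    then have "(1 / \<tau>) *\<^sub>R (\<tau> *\<^sub>R z) + (1 - 1 / \<tau>) *\<^sub>R 0 \<in> upper_hull a b {x} v"
      using B(5,6) t(1) by (intro convexD) auto
    then have "z \<in> upper_hull a b {x} v" using t(1) by simp
    then have "upper_hull a b {e, f} v = upper_hull a b {x} v"
      using drop_redundant(2)[OF ok, of z] zx A by simp
    then show ?thesis using single_zero[OF okx] by simp
  qed
  consider "a * e $ 2 > det2 e f + a * f $ 2" | "b * f $ 2 > det2 e f + b * e $ 2"
    | "a * e $ 2 \<le> det2 e f + a * f $ 2" "b * f $ 2 \<le> det2 e f + b * e $ 2" by linarith
  then show ?thesis
  proof cases
    case 1
    \<comment> \<open>\<open>N\<close> is the sum of the weights of \<open>pt (-a) 0\<close> and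
      \<open>e\<close> in the linear relation that expresses \<open>(a * e $ 2) *\<^sub>R f\<close>.
      Dividing by it gives a convex combination which is a multiple of \<open>f\<close> by a factor
      of at least 1.\<close>
    define N where "N = det2 e f + a * f $ 2"
    have N: "N > 0" using D okD ef by (simp add: N_def add_pos_pos)
    have "N *\<^sub>R ((a * e $ 2 / N) *\<^sub>R f) = N *\<^sub>R ((det2 e f / N) *\<^sub>R pt (-a) 0 + (1 - det2 e f / N) *\<^sub>R e)"
    proof -
      have "N * (1 - det2 e f / N) = a * f $ 2" using N by (simp add: right_diff_distrib) (simp add: N_def)
      then have "N *\<^sub>R ((det2 e f / N) *\<^sub>R pt (-a) 0 + (1 - det2 e f / N) *\<^sub>R e) = det2 e f *\<^sub>R pt (-a) 0 + (a * f $ 2) *\<^sub>R e"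
        using N by (simp add: scaleR_add_right)
      moreover have "det2 e f *\<^sub>R pt (-a) 0 + (a * f $ 2) *\<^sub>R e = (a * e $ 2) *\<^sub>R f"
        by (simp add: real2_eq_iff det2_def algebra_simps)
      ultimately show ?thesis using N by simp
    qed
    then have "(a * e $ 2 / N) *\<^sub>R f = (det2 e f / N) *\<^sub>R pt (-a) 0 + (1 - det2 e f / N) *\<^sub>R e"
      unfolding scaleR_cancel_left using N by blast
    moreover have "a * e $ 2 / N \<ge> 1" "0 \<le> det2 e f / N" "det2 e f / N \<le> 1"
      using 1 N D nn by (auto simp: N_def divide_simps)
    ultimately show ?thesis using drop[of f e "a * e $ 2 / N" "det2 e f / N" "pt (-a) 0"] ne by auto
  next
    case 2
    define N where "N = det2 e f + b * e $ 2"
    have N: "N > 0" using D okD ef by (simp add: N_def add_pos_pos)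
    have "N *\<^sub>R ((b * f $ 2 / N) *\<^sub>R e) = N *\<^sub>R ((det2 e f / N) *\<^sub>R pt b 0 + (1 - det2 e f / N) *\<^sub>R f)"
    proof -
      have "N * (1 - det2 e f / N) = b * e $ 2" using N by (simp add: right_diff_distrib) (simp add: N_def)
      then have "N *\<^sub>R ((det2 e f / N) *\<^sub>R pt b 0 + (1 - det2 e f / N) *\<^sub>R f) = det2 e f *\<^sub>R pt b 0 + (b * e $ 2) *\<^sub>R f"
        using N by (simp add: scaleR_add_right)
      moreover have "det2 e f *\<^sub>R pt b 0 + (b * e $ 2) *\<^sub>R f = (b * f $ 2) *\<^sub>R e"
        by (simp add: real2_eq_iff det2_def algebra_simps)
      ultimately show ?thesis using N by simp
    qed
    then have "(b * f $ 2 / N) *\<^sub>R e = (det2 e f / N) *\<^sub>R pt b 0 + (1 - det2 e f / N) *\<^sub>R f"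
      unfolding scaleR_cancel_left using N by blast
    moreover have "b * f $ 2 / N \<ge> 1" "0 \<le> det2 e f / N" "det2 e f / N \<le> 1"
      using 2 N D nn by (auto simp: N_def divide_simps)
    ultimately show ?thesis using drop[of e f "b * f $ 2 / N" "det2 e f / N" "pt b 0"] ne by auto
  next
    case 3
    then show ?thesis using pair_zero_aux[OF ok D] by blast
  qed
qed

text \<open>Of two upper points on one ray the shorter is redundant, and an upper point with others
  on both sides splits the polygon into two with fewer upper points. If neither situation occurs,
  there are at most two upper points.\<close>

lemma upper_zero:
  assumes "upper_ok a b A v"
  shows "\<mu> (upper_hull a b A v) = 0"
  using assms
proof (induction "card A" arbitrary: A v rule: less_induct)
  case less
  note ok = less.prems
  note okD = upper_okD[OF ok]
  have swap: "det2 y x = - det2 x y" for x y by (simp add: det2_def)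
  have fin: "card A' < card A" if "A' \<subseteq> A" "x \<in> A" "x \<notin> A'" for A' x
    using that okD(3) by (metis psubsetI psubset_card_mono)
  consider x y where "x \<in> A" "y \<in> A" "x \<noteq> y" "det2 x y = 0"
    | e x y where "e \<in> A" "x \<in> A" "y \<in> A" "det2 e x > 0" "det2 e y < 0"
    | "\<And>x y. x \<in> A \<Longrightarrow> y \<in> A \<Longrightarrow> x \<noteq> y \<Longrightarrow> det2 x y \<noteq> 0"
      "\<And>e x y. e \<in> A \<Longrightarrow> x \<in> A \<Longrightarrow> y \<in> A \<Longrightarrow> det2 e x > 0 \<Longrightarrow> \<not> det2 e y < 0" by metis
  then show ?case
  proof cases
    case 1
    then obtain z where z: "z \<in> A" "z \<in> upper_hull a b (A - {z}) v" "A - {z} \<noteq> {}"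
      using same_ray_redundant[OF ok] by metis
    then show ?thesis
      using drop_redundant[OF ok z] less.hyps[of "A - {z}" v] fin[of "A - {z}" z] by auto
  next
    case 2
    obtain v' r where "r > 0" "v' $ 2 < 0" and S: "upper_ok a b (insert (r *\<^sub>R e) {x \<in> A. det2 e x > 0}) v'"
      "upper_ok a b (insert (r *\<^sub>R e) {x \<in> A. det2 e x < 0}) v'"
      "\<mu> (upper_hull a b A v) = \<mu> (upper_hull a b (insert (r *\<^sub>R e) {x \<in> A. det2 e x > 0}) v')
        + \<mu> (upper_hull a b (insert (r *\<^sub>R e) {x \<in> A. det2 e x < 0}) v')"
      by (rule split_middle[OF ok 2(1)])
    have ee: "det2 e e = 0" by (simp add: det2_def)
    \<comment> \<open>A piece loses \<open>e\<close> and at least one point \<open>w\<close> of the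
      other side, and gains only the rescaled \<open>e\<close>.\<close>
    have less: "card (insert z A') < card A" if "A' \<subseteq> A - {e, w}" "w \<in> A" "w \<noteq> e" for z w A'
    proof -
      have f: "finite A'" using that okD(3) by (auto intro: finite_subset)
      have "card (insert z A') \<le> Suc (card A')" using f by (simp add: card_insert_if)
      also have "\<dots> \<le> Suc (card (A - {e, w}))" using that okD(3) by (simp add: card_mono)
      also have "\<dots> < card A"
      proof -
        have "card (A - {e, w}) = card A - 2" using that 2(1) okD(3) by (subst card_Diff_subset) auto
        moreover have "card A \<ge> 2" using card_mono[of A "{e, w}"] that 2(1) okD(3) by auto
        ultimately show ?thesis by simp
      qed
      finally show ?thesis .
    qed
    have "card (insert (r *\<^sub>R e) {x \<in> A. det2 e x > 0}) < card A"
      using 2 ee by (intro less[of _ y]) auto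
    moreover have "card (insert (r *\<^sub>R e) {x \<in> A. det2 e x < 0}) < card A"
      using 2 ee by (intro less[of _ x]) auto
    ultimately show ?thesis using less.hyps S by simp
  next
    case 3
    obtain x where x: "x \<in> A" using okD by auto
    show ?thesis
    proof (cases "A = {x}")
      case True
      then show ?thesis using single_zero ok by simp
    next
      case False
      then obtain y where y: "y \<in> A" "y \<noteq> x" using x by auto
      obtain e f where ef: "e \<in> A" "f \<in> A" "det2 e f > 0"
      proof (cases "det2 x y > 0")
        case True then show ?thesis using that x y by blast
      next
        case False
        then have "det2 y x > 0" using 3(1)[OF x y(1)] y swap[of y x] by auto
        then show ?thesis using that x y by blast
      qed
      have "A = {e, f}"
      proof (rule ccontr)
        assume "A \<noteq> {e, f}"
        then obtain z where z: "z \<in> A" "z \<noteq> e" "z \<noteq> f" using ef by auto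
        \<comment> \<open>By the signs that follow, a third point \<open>z\<close> would have
          \<open>e\<close> and \<open>f\<close> on different sides, which is the excluded splitting
          case.\<close>
        have "det2 e z > 0" using 3(2)[OF ef(1,2) z(1) ef(3)] 3(1)[OF ef(1) z(1)] z by auto
        moreover have "\<not> det2 f z > 0"
          using 3(2)[OF ef(2) z(1) ef(1)] ef(3) swap[of e f] by auto
        moreover have "det2 f z \<noteq> 0" using 3(1)[OF ef(2) z(1)] z(3) by blast
        ultimately have "det2 z f > 0" "det2 z e < 0" using swap[of z f] swap[of z e] by linarith+
        then show False using 3(2)[OF z(1) ef(2,1)] by blast
      qed
      then show ?thesis using pair_zero ok ef by simp
    qed
  qed
qed

text \<open>One cut along the first axis leaves two polygons that have a single apex on one side of
  it. The central reflection brings the one with its apex above into the form with a single lower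
  vertex.\<close>

lemma zero_of_quad_null:
  assumes P: "P \<in> polytopes_o"
  shows "\<mu> P = 0"
proof -
  note Pp = polytopes_oD[OF P]
  obtain S where S: "finite S" "P = convex hull S" using Pp(1) by (auto simp: polytope_def)
  have "pt 1 0 \<noteq> 0" by (simp add: real2_eq_iff)
  then obtain a b where ab: "a > 0" "b > 0" "\<And>s. s *\<^sub>R pt 1 0 \<in> P \<longleftrightarrow> - a \<le> s \<and> s \<le> b"
    using axis_section_interval[OF P] by blast
  have axis: "x \<in> P \<longleftrightarrow> - a \<le> x $ 1 \<and> x $ 1 \<le> b" if "x $ 2 = 0" for x
  proof -
    have "x $ 1 *\<^sub>R pt 1 0 = x" using that by (simp add: real2_eq_iff)
    then show ?thesis using ab(3)[of "x $ 1"] by simp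
  qed
  have ends: "pt b 0 \<in> P" "pt (-a) 0 \<in> P" using ab axis by auto
  have vertex: "\<exists>u\<in>S. m \<bullet> u > 0" if "m \<noteq> 0" for m
  proof (rule ccontr)
    assume neg: "\<not> ?thesis"
    obtain t where t: "t > 0" "\<And>s. \<bar>s\<bar> \<le> t \<Longrightarrow> s *\<^sub>R m \<in> P" using zero_interior_absorbing[OF Pp(5)] by blast
    have "t *\<^sub>R m \<in> convex hull S" using t(1) t(2)[of t] S by simp
    moreover have "m \<bullet> x \<le> 0" if "x \<in> S" for x using neg that by (meson not_less)
    ultimately have "m \<bullet> (t *\<^sub>R m) \<le> 0" using halfplane_hull by blast
    moreover have "m \<bullet> m > 0" using that by simp
    ultimately show False using t(1) by (simp add: mult_le_0_iff)
  qed
  obtain u where u: "u \<in> S" "u $ 2 > 0" using vertex[of "pt 0 1"] by (auto simp: real2_eq_iff inner_real2)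
  obtain v where v: "v \<in> S" "v $ 2 < 0" using vertex[of "pt 0 (-1)"] by (auto simp: real2_eq_iff inner_real2)
  have uvP: "u \<in> P" "v \<in> P" using u v S by (auto intro: hull_inc)
  have part: "P \<inter> {x. pt 0 s \<bullet> x \<ge> 0} = convex hull ({pt b 0, pt (-a) 0} \<union> {x \<in> S. s * x $ 2 > 0})"
    if s: "s \<noteq> 0" for s
    unfolding S(2)
  proof (rule hull_halfspace)
    fix x assume x: "x \<in> convex hull S" "pt 0 s \<bullet> x = 0"
    then have "x $ 2 = 0" "x \<in> P" using s S by (auto simp: inner_real2)
    then have "pt (x $ 1) 0 \<in> convex hull ({pt b 0, pt (-a) 0} \<union> {x \<in> S. s * x $ 2 > 0})"
      using axis ab by (intro axis_segment_hull[of a b]) auto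
    moreover have "pt (x $ 1) 0 = x" using \<open>x $ 2 = 0\<close> by (simp add: real2_eq_iff)
    ultimately show "x \<in> convex hull ({pt b 0, pt (-a) 0} \<union> {x \<in> S. s * x $ 2 > 0})" by simp
  qed (use ends S in \<open>auto simp: inner_real2 intro: hull_inc\<close>)
  have upP: "P \<inter> {x. pt 0 1 \<bullet> x \<ge> 0} = convex hull ({pt b 0, pt (-a) 0} \<union> {x \<in> S. x $ 2 > 0})"
    using part[of 1] by simp
  have downP: "P \<inter> {x. pt 0 1 \<bullet> x \<le> 0} = convex hull ({pt b 0, pt (-a) 0} \<union> {x \<in> S. x $ 2 < 0})"
    using part[of "-1"] by (simp add: inner_real2)
  have ins: "convex hull (insert p (convex hull T)) = convex hull (insert p T)" for p and T :: "(real^2) set"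
    using hull_Un_right[of convex "{p}" T] by simp
  have "\<mu> P = \<mu> (convex hull (insert v (P \<inter> {x. pt 0 1 \<bullet> x \<ge> 0}))) + \<mu> (convex hull (insert u (P \<inter> {x. pt 0 1 \<bullet> x \<le> 0})))"
    using u v uvP by (intro cut_zero[OF P]) (auto simp: inner_real2)
  also have "\<mu> (convex hull (insert v (P \<inter> {x. pt 0 1 \<bullet> x \<ge> 0}))) = 0"
  proof -
    have e: "convex hull (insert v (P \<inter> {x. pt 0 1 \<bullet> x \<ge> 0})) = upper_hull a b {x \<in> S. x $ 2 > 0} v"
      unfolding upP ins by (simp add: upper_hull_def insert_commute)
    have "upper_hull a b {x \<in> S. x $ 2 > 0} v \<subseteq> P"
      unfolding e[symmetric] using uvP Pp(2) by (intro hull_minimal) auto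
    then have "upper_ok a b {x \<in> S. x $ 2 > 0} v"
      unfolding upper_ok_def using ab(1,2) S(1) u v axis by auto
    then show ?thesis unfolding e by (rule upper_zero)
  qed
  also have "\<mu> (convex hull (insert u (P \<inter> {x. pt 0 1 \<bullet> x \<le> 0}))) = 0"
  proof -
    define Q where "Q = convex hull (insert u (P \<inter> {x. pt 0 1 \<bullet> x \<le> 0}))"
    have QP: "Q \<subseteq> P" unfolding Q_def using uvP Pp(2) by (intro hull_minimal) auto
    have Qo: "Q \<in> polytopes_o"
      unfolding Q_def using u v uvP by (intro valuation_cut(2)[OF valuation P _ _ uvP(2)]) (auto simp: inner_real2)
    have m: "lin (-1) 0 0 (-1) x = - x" for x by (simp add: real2_eq_iff)
    have mp: "- pt x y = pt (- x) (- y)" for x y by (simp add: real2_eq_iff)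
    have "lin (-1) 0 0 (-1) ` Q = convex hull (lin (-1) 0 0 (-1) ` (insert u ({pt b 0, pt (-a) 0} \<union> {x \<in> S. x $ 2 < 0})))"
      unfolding Q_def downP ins lin_image_hull ..
    also have "\<dots> = upper_hull b a (uminus ` {x \<in> S. x $ 2 < 0}) (- u)"
      unfolding upper_hull_def m by (rule arg_cong[where f="\<lambda>T. convex hull T"]) (auto simp: mp)
    finally have e: "lin (-1) 0 0 (-1) ` Q = upper_hull b a (uminus ` {x \<in> S. x $ 2 < 0}) (- u)" .
    have "upper_ok b a (uminus ` {x \<in> S. x $ 2 < 0}) (- u)"
      unfolding upper_ok_def e[symmetric] m using ab(1,2) S(1) u v axis QP by fastforce
    then have "\<mu> (lin (-1) 0 0 (-1) ` Q) = 0" unfolding e by (rule upper_zero)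
    then have "- \<mu> Q = 0" using lin_equivariant[OF Qo, of "-1" "-1" 0 0] by (simp add: m)
    then show ?thesis by (simp add: Q_def)
  qed
  finally show ?thesis by simp
qed

end

section \<open>Moment vectors\<close>

lemma absolutely_integrable_id_compact:
  fixes P :: "(real^2) set"
  assumes "compact P"
  shows "(\<lambda>x. x) absolutely_integrable_on P"
proof -
  have "integrable lborel (\<lambda>x. indicator P x *\<^sub>R x)"
    using assms by (intro borel_integrable_compact) auto
  then have "integrable lebesgue (\<lambda>x. indicator P x *\<^sub>R x)"
    by (simp add: integrable_completion)
  then show ?thesis by (simp add: set_integrable_def)
qed

lemma moment_eq_lebesgue_integral:
  assumes "compact P"
  shows "moment P = (\<integral>x. indicator P x *\<^sub>R x \<partial>lebesgue)"
    "integrable lebesgue (\<lambda>x. indicator P x *\<^sub>R (x :: real^2))"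
proof -
  note ai = absolutely_integrable_id_compact[OF assms]
  show "moment P = (\<integral>x. indicator P x *\<^sub>R x \<partial>lebesgue)"
    using set_lebesgue_integral_eq_integral(2)[OF ai]
    unfolding moment_def set_lebesgue_integral_def by (rule sym)
  show "integrable lebesgue (\<lambda>x. indicator P x *\<^sub>R (x :: real^2))"
    using ai unfolding set_integrable_def .
qed

lemma moment_additive:
  assumes "compact P" "compact Q"
  shows "moment (P \<union> Q) + moment (P \<inter> Q) = moment P + moment Q"
proof -
  note M = moment_eq_lebesgue_integral
  have c: "compact (P \<union> Q)" "compact (P \<inter> Q)" using assms by (auto intro: compact_Un compact_Int)
  have "moment (P \<union> Q) + moment (P \<inter> Q) = (\<integral>x. indicator (P \<union> Q) x *\<^sub>R x + indicator (P \<inter> Q) x *\<^sub>R x \<partial>lebesgue)"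
    using M[OF c(1)] M[OF c(2)] by simp
  also have "\<dots> = (\<integral>x. indicator P x *\<^sub>R x + indicator Q x *\<^sub>R x \<partial>lebesgue)"
    by (rule Bochner_Integration.integral_cong) (auto simp: indicator_def)
  also have "\<dots> = moment P + moment Q"
    using M[OF assms(1)] M[OF assms(2)] by simp
  finally show ?thesis .
qed

lemma moment_lin:
  assumes "compact P"
  shows "moment (lin a b c d ` P) = \<bar>a * d - b * c\<bar> *\<^sub>R lin a b c d (moment P)"
proof -
  let ?L = "lin a b c d"
  have cL: "continuous_on P ?L" by (rule linear_continuous_on) (simp add: linear_conv_bounded_linear[symmetric] linear_lin)
  have ai: "(\<lambda>x. x) absolutely_integrable_on ?L ` P"
    using assms cL by (intro absolutely_integrable_id_compact compact_continuous_image)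
  have det: "det (matrix ?L) = a * d - b * c"
    by (simp add: det_2 matrix_def axis_def)
  have "moment (?L ` P) = \<bar>a * d - b * c\<bar> *\<^sub>R integral P ((\<lambda>x. x) \<circ> ?L)"
    unfolding moment_def det[symmetric] using ai by (intro integral_change_of_variables_linear linear_lin) auto
  also have "integral P ((\<lambda>x. x) \<circ> ?L) = ?L (moment P)"
  proof -
    have "(\<lambda>x. x) integrable_on P"
      using absolutely_integrable_id_compact[OF assms] set_lebesgue_integral_eq_integral(1) by blast
    then show ?thesis
      using integral_linear[of "\<lambda>x. x" P ?L] linear_lin by (simp add: moment_def o_def linear_conv_bounded_linear)
  qed
  finally show ?thesis .
qed

section \<open>Continuity of moment vectors in the Hausdorff metric\<close>

lemma hausdist_upper:
  fixes K L :: "(real^2) set"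
  shows "compact K \<Longrightarrow> x \<in> K \<Longrightarrow> infdist x L \<le> hausdist K L"
    "compact L \<Longrightarrow> x \<in> L \<Longrightarrow> infdist x K \<le> hausdist K L"
proof -
  have bdd: "bdd_above ((\<lambda>x. infdist x B) ` A)" if "compact A" for A B :: "(real^2) set"
    using that by (intro bounded_imp_bdd_above compact_imp_bounded compact_continuous_image continuous_on_infdist) auto
  show "infdist x L \<le> hausdist K L" if "compact K" "x \<in> K"
    using cSUP_upper[OF that(2) bdd[OF that(1), of L]] by (simp add: hausdist_def)
  show "infdist x K \<le> hausdist K L" if "compact L" "x \<in> L"
    using cSUP_upper[OF that(2) bdd[OF that(1), of K]] by (simp add: hausdist_def)
qed

lemma hausdist_near:
  assumes KL: "K \<in> polytopes_o" "L \<in> polytopes_o" "hausdist K L < d"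
  shows "x \<in> K \<Longrightarrow> \<exists>y\<in>L. dist x y < d" "x \<in> L \<Longrightarrow> \<exists>y\<in>K. dist x y < d"
proof -
  have near: "\<exists>y\<in>B. dist x y < d" if "infdist x B < d" "B \<noteq> {}" for B :: "(real^2) set"
    using that by (auto simp: infdist_notempty cInf_less_iff)
  show "\<exists>y\<in>L. dist x y < d" if "x \<in> K"
    using hausdist_upper(1)[OF polytopes_oD(3)[OF KL(1)] that, of L] KL(3) polytopes_oD(6)[OF KL(2)]
    by (intro near) auto
  show "\<exists>y\<in>K. dist x y < d" if "x \<in> L"
    using hausdist_upper(2)[OF polytopes_oD(3)[OF KL(2)] that, of K] KL(3) polytopes_oD(6)[OF KL(1)]
    by (intro near) auto
qed

text \<open>If \<open>x\<close> were outside \<open>L\<close>, some line would separate them. A walk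
  of length \<open>d / 2\<close> from \<open>x\<close> away from that line stays in \<open>K\<close>
  and ends farther than \<open>d / 2\<close> from every point of \<open>L\<close>.\<close>

lemma hausdist_ball_imp_mem:
  assumes KL: "K \<in> polytopes_o" "L \<in> polytopes_o" "hausdist K L < d / 2" and b: "ball x d \<subseteq> K" "d > 0"
  shows "x \<in> L"
proof (rule ccontr)
  assume "x \<notin> L"
  then obtain a \<beta> where ab: "a \<bullet> x < \<beta>" "\<And>z. z \<in> L \<Longrightarrow> a \<bullet> z > \<beta>"
    using separating_hyperplane_closed_point[of L x] polytopes_oD(2,4)[OF KL(2)] by blast
  then have a: "a \<noteq> 0" using polytopes_oD(6)[OF KL(2)] by force
  define y where "y = x - (d / 2 / norm a) *\<^sub>R a"
  have "dist x y = d / 2" using a b by (simp add: y_def dist_norm)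
  then have "y \<in> K" using b by auto
  then obtain z where z: "z \<in> L" "dist y z < d / 2" using hausdist_near(1)[OF KL] by blast
  have "a \<bullet> (z - y) = a \<bullet> z - a \<bullet> x + d / 2 * norm a"
    using a by (simp add: y_def inner_diff_right dot_square_norm power2_eq_square)
  also have "\<dots> > d / 2 * norm a" using ab(1) ab(2)[OF z(1)] by simp
  finally have "d / 2 * norm a < a \<bullet> (z - y)" .
  also have "\<dots> \<le> norm a * norm (z - y)" by (rule norm_cauchy_schwarz)
  also have "\<dots> < norm a * (d / 2)"
    using a z(2) by (intro mult_strict_left_mono) (auto simp: dist_norm norm_minus_commute)
  finally show False by simp
qed

text \<open>Dominated convergence; the boundary of a convex body is a null set.\<close>
lemma moment_hausdorff_continuous:
  assumes K: "K \<in> polytopes_o" "convex (F K)" and cpt: "\<And>L. L \<in> polytopes_o \<Longrightarrow> compact (F L)"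
    and bound: "\<delta> > 0" "\<And>L. L \<in> polytopes_o \<Longrightarrow> hausdist K L < \<delta> \<Longrightarrow> F L \<subseteq> cball 0 R"
    and inside: "\<And>x. x \<in> interior (F K) \<Longrightarrow> \<exists>d>0. \<forall>L\<in>polytopes_o. hausdist K L < d \<longrightarrow> x \<in> F L"
    and outside: "\<And>x. x \<notin> F K \<Longrightarrow> \<exists>d>0. \<forall>L\<in>polytopes_o. hausdist K L < d \<longrightarrow> x \<notin> F L"
    and e: "e > 0"
  shows "\<exists>d>0. \<forall>L\<in>polytopes_o. hausdist K L < d \<longrightarrow> dist (moment (F L)) (moment (F K)) < e"
proof (rule ccontr)
  assume neg: "\<not> ?thesis"
  have "\<exists>L\<in>polytopes_o. hausdist K L < \<delta> / real (Suc n) \<and> \<not> dist (moment (F L)) (moment (F K)) < e" for n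
  proof -
    have "\<delta> / real (Suc n) > 0" using bound by simp
    then show ?thesis using neg by blast
  qed
  then obtain L where L: "\<And>n. L n \<in> polytopes_o" "\<And>n. hausdist K (L n) < \<delta> / real (Suc n)"
    "\<And>n. \<not> dist (moment (F (L n))) (moment (F K)) < e" by metis
  have ev: "\<forall>\<^sub>F n in sequentially. hausdist K (L n) < d" if "d > 0" for d
  proof -
    have "(\<lambda>n. \<delta> / real (Suc n)) \<longlonglongrightarrow> 0" using LIMSEQ_Suc[OF lim_const_over_n[of \<delta>]] by simp
    then have "\<forall>\<^sub>F n in sequentially. \<delta> / real (Suc n) < d" using that order_tendstoD(2) by blast
    then show ?thesis by (rule eventually_mono) (use L(2) in \<open>blast intro: less_trans\<close>)
  qed
  have FLR: "F (L n) \<subseteq> cball 0 R" for n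
  proof -
    have "\<delta> / real (Suc n) \<le> \<delta>" using bound(1) by (simp add: divide_le_eq)
    then show ?thesis using bound(2)[OF L(1)] L(2)[of n] by (meson less_le_trans)
  qed
  have "(\<lambda>n. \<integral>x. indicator (F (L n)) x *\<^sub>R x \<partial>lebesgue) \<longlonglongrightarrow> (\<integral>x. indicator (F K) x *\<^sub>R x \<partial>lebesgue)"
  proof (rule integral_dominated_convergence)
    show "(\<lambda>x. indicator (F K) x *\<^sub>R x) \<in> borel_measurable lebesgue"
      using moment_eq_lebesgue_integral(2)[OF cpt[OF K(1)]] by auto
    show "(\<lambda>x. indicator (F (L n)) x *\<^sub>R x) \<in> borel_measurable lebesgue" for n
      using moment_eq_lebesgue_integral(2)[OF cpt[OF L(1)]] by auto
    define w where "w = (\<lambda>x. indicator (cball (0::real^2) R) x *\<^sub>R R)"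
    have "integrable lborel w"
      unfolding w_def by (intro borel_integrable_compact) auto
    then have "integrable lebesgue w" by (simp add: integrable_completion)
    then show "integrable lebesgue (\<lambda>x. indicator (cball (0::real^2) R) x *\<^sub>R R)"
      by (simp only: w_def)
    show "AE x in lebesgue. norm (indicator (F (L n)) x *\<^sub>R x) \<le> indicator (cball 0 R) x *\<^sub>R R" for n
    proof (intro AE_I2)
      fix x :: "real^2"
      show "norm (indicator (F (L n)) x *\<^sub>R x) \<le> indicator (cball 0 R) x *\<^sub>R R"
      proof (cases "x \<in> F (L n)")
        case True
        then have "norm x \<le> R" using FLR[of n] by auto
        then show ?thesis using True by simp
      next
        case False
        then show ?thesis using order_trans[OF norm_ge_zero, of x R] by (auto simp: indicator_def)
      qed
    qed
    have "frontier (F K) \<in> null_sets lebesgue"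
      using negligible_convex_frontier[OF K(2)] negligible_iff_null_sets by blast
    then have "AE x in lebesgue. x \<notin> frontier (F K)" by (rule AE_not_in)
    then show "AE x in lebesgue. (\<lambda>n. indicator (F (L n)) x *\<^sub>R x) \<longlonglongrightarrow> indicator (F K) x *\<^sub>R x"
    proof (rule AE_mp, intro AE_I2 impI)
      fix x assume x: "x \<notin> frontier (F K)"
      have "\<forall>\<^sub>F n in sequentially. indicator (F (L n)) x *\<^sub>R x = indicator (F K) x *\<^sub>R x"
      proof (cases "x \<in> F K")
        case True
        then have "x \<in> interior (F K)" using x closure_subset by (auto simp: frontier_def)
        then obtain d where "d > 0" "\<forall>L\<in>polytopes_o. hausdist K L < d \<longrightarrow> x \<in> F L" using inside by blast
        then have "\<forall>\<^sub>F n in sequentially. x \<in> F (L n)"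
          using L(1) by (intro eventually_mono[OF ev[of d]]) auto
        then show ?thesis by (rule eventually_mono) (use True in simp)
      next
        case False
        then obtain d where "d > 0" "\<forall>L\<in>polytopes_o. hausdist K L < d \<longrightarrow> x \<notin> F L" using outside by blast
        then have "\<forall>\<^sub>F n in sequentially. x \<notin> F (L n)"
          using L(1) by (intro eventually_mono[OF ev[of d]]) auto
        then show ?thesis by (rule eventually_mono) (use False in simp)
      qed
      then show "(\<lambda>n. indicator (F (L n)) x *\<^sub>R x) \<longlonglongrightarrow> indicator (F K) x *\<^sub>R x"
        by (rule tendsto_eventually)
    qed
  qed
  then have "(\<lambda>n. moment (F (L n))) \<longlonglongrightarrow> moment (F K)"
    using moment_eq_lebesgue_integral(1)[OF cpt] L(1) K(1) by simp
  then have "\<forall>\<^sub>F n in sequentially. dist (moment (F (L n))) (moment (F K)) < e" using e tendstoD by blast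
  then show False using L(3) eventually_happens[of _ sequentially] by auto
qed

lemma measurable_hausdorff_continuous:
  fixes f :: "(real^2) set \<Rightarrow> real^2"
  assumes "\<And>K e. K \<in> polytopes_o \<Longrightarrow> e > 0 \<Longrightarrow>
    \<exists>d>0. \<forall>L\<in>polytopes_o. hausdist K L < d \<longrightarrow> dist (f L) (f K) < e"
  shows "f \<in> measurable polytopes_o_borel borel"
proof (rule borel_measurableI)
  fix S :: "(real^2) set" assume S: "open S"
  have "hausdorff_open (f -` S \<inter> polytopes_o)"
    unfolding hausdorff_open_def
  proof (intro conjI ballI)
    fix K assume K: "K \<in> f -` S \<inter> polytopes_o"
    then obtain e where "e > 0" "\<And>y. dist y (f K) < e \<Longrightarrow> y \<in> S" using S by (auto simp: open_dist)
    then show "\<exists>e>0. \<forall>L\<in>polytopes_o. hausdist K L < e \<longrightarrow> L \<in> f -` S \<inter> polytopes_o"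
      using assms[of K e] K by fastforce
  qed auto
  moreover have "sets polytopes_o_borel = sigma_sets polytopes_o {U. hausdorff_open U}"
    unfolding polytopes_o_borel_def by (rule sets_measure_of) (auto simp: hausdorff_open_def)
  ultimately show "f -` S \<inter> space polytopes_o_borel \<in> sets polytopes_o_borel"
    by (auto intro: sigma_sets.Basic)
qed

text \<open>The factor 2 leaves a ball of radius \<open>r\<close> inside \<open>K\<close> around
  every point of the ball of radius \<open>r\<close>, so that polygons close to \<open>K\<close>
  still contain the latter.\<close>

lemma polytopes_o_ball:
  assumes "K \<in> polytopes_o"
  obtains r where "r > 0" "ball 0 (2 * r) \<subseteq> K"
proof -
  obtain d where "d > 0" "ball 0 d \<subseteq> K" using polytopes_oD(5)[OF assms] mem_interior by blast
  then show ?thesis using that[of "d / 2"] by simp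
qed

lemma matrix_eq_lin:
  fixes A :: "real^2^2"
  shows "(\<lambda>x. A *v x) = lin (A $ 1 $ 1) (A $ 1 $ 2) (A $ 2 $ 1) (A $ 2 $ 2)"
    "det A = A $ 1 $ 1 * A $ 2 $ 2 - A $ 1 $ 2 * A $ 2 $ 1"
proof -
  show "(\<lambda>x. A *v x) = lin (A $ 1 $ 1) (A $ 1 $ 2) (A $ 2 $ 1) (A $ 2 $ 2)"
    by (rule ext) (simp add: real2_eq_iff matrix_vector_mult_def sum_2)
  show "det A = A $ 1 $ 1 * A $ 2 $ 2 - A $ 1 $ 2 * A $ 2 $ 1" by (rule det_2)
qed

lemma sl2_valuationI:
  assumes "valuation_on polytopes_o \<mu>" "\<mu> \<in> measurable polytopes_o_borel borel"
    and "\<And>a b c d P. a * d - b * c = 1 \<Longrightarrow> P \<in> polytopes_o \<Longrightarrow> \<mu> (lin a b c d ` P) = lin a b c d (\<mu> P)"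
  shows "sl2_valuation \<mu>"
proof
  fix A :: "real^2^2" and P :: "(real^2) set" assume A: "det A = 1" and P: "P \<in> polytopes_o"
  then show "\<mu> ((\<lambda>x. A *v x) ` P) = A *v \<mu> P"
    using assms(3)[of "A $ 1 $ 1" "A $ 2 $ 2" "A $ 1 $ 2" "A $ 2 $ 1" P]
    unfolding matrix_eq_lin(2) matrix_eq_lin(1)[of A] by (metis matrix_eq_lin(1))
qed (use assms in auto)

lemma sl2_valuation_moment: "sl2_valuation moment"
proof (rule sl2_valuationI)
  show "valuation_on polytopes_o moment"
    unfolding valuation_on_def using moment_additive polytopes_oD(3) by blast
  show "moment \<in> measurable polytopes_o_borel borel"
  proof (rule measurable_hausdorff_continuous)
    fix K e assume K: "K \<in> polytopes_o" and e: "(e::real) > 0"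
    obtain R where R: "\<And>x. x \<in> K \<Longrightarrow> norm x \<le> R"
      using polytopes_oD(3)[OF K] compact_imp_bounded bounded_iff by metis
    show "\<exists>d>0. \<forall>L\<in>polytopes_o. hausdist K L < d \<longrightarrow> dist (moment L) (moment K) < e"
    proof (rule moment_hausdorff_continuous[where F="\<lambda>L. L" and \<delta>=1 and R="R + 1", OF K])
      fix L assume L: "L \<in> polytopes_o" "hausdist K L < 1"
      show "L \<subseteq> cball 0 (R + 1)"
      proof
        fix x assume "x \<in> L"
        then obtain y where "y \<in> K" "dist x y < 1" using hausdist_near(2)[OF K L] by blast
        then show "x \<in> cball 0 (R + 1)" using R[of y] norm_triangle_ineq2[of x y] by (simp add: dist_norm)
      qed
    next
      fix x assume "x \<in> interior K"
      then obtain d where "d > 0" "ball x d \<subseteq> K" using mem_interior by blast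
      then show "\<exists>d>0. \<forall>L\<in>polytopes_o. hausdist K L < d \<longrightarrow> x \<in> L"
        using hausdist_ball_imp_mem[OF K] by (intro exI[of _ "d / 2"]) auto
    next
      fix x assume "x \<notin> K"
      then obtain d where d: "d > 0" "ball x d \<subseteq> - K"
        using polytopes_oD(4)[OF K] by (metis ComplI open_Compl open_contains_ball)
      then have "\<forall>L\<in>polytopes_o. hausdist K L < d \<longrightarrow> x \<notin> L"
        using hausdist_near(2)[OF K] by (meson ComplD mem_ball subsetD)
      then show "\<exists>d>0. \<forall>L\<in>polytopes_o. hausdist K L < d \<longrightarrow> x \<notin> L" using d by blast
    qed (use polytopes_oD(2)[OF K] polytopes_oD(3) e in simp_all)
  qed
  show "moment (lin a b c d ` P) = lin a b c d (moment P)" if "a * d - b * c = 1" "P \<in> polytopes_o" for a b c d P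
    using moment_lin[OF polytopes_oD(3)[OF that(2)], of a b c d] that by simp
qed

section \<open>Polar bodies and their moment vectors\<close>

lemma polar_props:
  assumes K: "ball 0 r \<subseteq> K" "r > 0"
  shows "polar K \<subseteq> cball 0 (1 / r)" "closed (polar K)" "convex (polar K)" "compact (polar K)"
proof -
  have P: "polar K = (\<Inter>x\<in>K. {y. x \<bullet> y \<le> 1})" by (auto simp: polar_def inner_commute)
  show c: "closed (polar K)" unfolding P by (intro closed_INT ballI closed_halfspace_le)
  show "convex (polar K)" unfolding P by (intro convex_INT convex_halfspace_le)
  show b: "polar K \<subseteq> cball 0 (1 / r)"
  proof
    fix y assume y: "y \<in> polar K"
    show "y \<in> cball 0 (1 / r)"
    proof (rule ccontr)
      assume "y \<notin> cball 0 (1 / r)"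
      then have n: "norm y > 1 / r" by simp
      then have n0: "norm y > 0" using K(2) by (meson less_trans zero_less_divide_1_iff)
      \<comment> \<open>A point on the ray of \<open>y\<close> whose inner product with
        \<open>y\<close> is halfway between 1 and \<open>norm y * r\<close>: large enough to violate
        polarity, small enough for the point to have norm below \<open>r\<close>.\<close>
      define x where "x = (1 / (norm y * norm y)) *\<^sub>R ((1 + (norm y * r - 1) / 2) *\<^sub>R y)"
      have nr: "norm y * r > 1" using n K(2) by (simp add: divide_less_eq)
      have "norm x = (1 + (norm y * r - 1) / 2) / norm y" using n0 nr by (simp add: x_def)
      also have "\<dots> < r"
      proof -
        have "1 + (z - 1) / 2 < z" if "1 < z" for z :: real using that by (simp add: field_simps)
        from this[OF nr] have "1 + (norm y * r - 1) / 2 < norm y * r" .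
        then show ?thesis using n0 by (simp add: pos_divide_less_eq mult.commute)
      qed
      finally have "x \<in> K" using K by auto
      then have "y \<bullet> x \<le> 1" using y by (auto simp: polar_def)
      moreover have "y \<bullet> x = 1 + (norm y * r - 1) / 2"
        using n0 by (simp add: x_def dot_square_norm power2_eq_square)
      ultimately show False using nr by simp
    qed
  qed
  show "compact (polar K)" using b c bounded_subset[OF bounded_cball b] compact_eq_bounded_closed by blast
qed

lemma polytopes_o_polar:
  assumes "K \<in> polytopes_o"
  shows "convex (polar K)" "compact (polar K)"
proof -
  obtain r where "r > 0" "ball 0 (2 * r) \<subseteq> K" using polytopes_o_ball[OF assms] by blast
  then show "convex (polar K)" "compact (polar K)" using polar_props(3,4)[of "2 * r" K] by auto
qed

lemma polar_Un: "polar (P \<union> Q) = polar P \<inter> polar Q"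
  by (auto simp: polar_def)

text \<open>If \<open>y\<close> exceeds 1 at some \<open>p\<close> in \<open>P\<close> and at some
  \<open>q\<close> in \<open>Q\<close>, it does so on the whole segment between them. This connected
  segment is covered by the two closed sets, so it contains a point of their intersection.\<close>

lemma polar_Int:
  assumes "closed P" "closed Q" "convex (P \<union> Q)"
  shows "polar (P \<inter> Q) = polar P \<union> polar Q"
proof
  show "polar P \<union> polar Q \<subseteq> polar (P \<inter> Q)" by (auto simp: polar_def)
  show "polar (P \<inter> Q) \<subseteq> polar P \<union> polar Q"
  proof (rule ccontr)
    assume "\<not> ?thesis"
    then obtain y where y: "y \<in> polar (P \<inter> Q)" "y \<notin> polar P" "y \<notin> polar Q" by blast
    then obtain p q where pq: "p \<in> P" "y \<bullet> p > 1" "q \<in> Q" "y \<bullet> q > 1" by (auto simp: polar_def not_le)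
    let ?S = "closed_segment p q"
    have "?S \<subseteq> P \<union> Q" using pq assms(3) by (meson UnI1 UnI2 closed_segment_subset)
    moreover have "connected ?S" by simp
    ultimately have "P \<inter> Q \<inter> ?S \<noteq> {}"
      using assms(1,2) pq connected_closed[of ?S] by (metis IntI empty_iff ends_in_segment)
    then obtain w where w: "w \<in> P" "w \<in> Q" "w \<in> ?S" by blast
    have "?S \<subseteq> {z. y \<bullet> z > 1}" using pq convex_halfspace_gt[of 1 y] by (intro closed_segment_subset) auto
    then show False using w y(1) by (force simp: polar_def)
  qed
qed

text \<open>Passing the matrix to the other side of the inner product replaces it by its transpose
  \<open>lin a c b d\<close>, so the polar body transforms by the inverse transpose.\<close>

lemma polar_lin:
  assumes "a * d - b * c \<noteq> 0"
  defines "D \<equiv> a * d - b * c"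
  shows "polar (lin a b c d ` P) = lin (d / D) (- c / D) (- b / D) (a / D) ` polar P"
proof -
  have D: "D \<noteq> 0" using assms by simp
  have adj: "y \<bullet> lin a b c d x = lin a c b d y \<bullet> x" for x y by (simp add: inner_real2 algebra_simps)
  have i: "lin (d / D) (- c / D) (- b / D) (a / D) (lin a c b d y) = y" for y
  proof -
    have "d * (a * y$1 + c * y$2) - c * (b * y$1 + d * y$2) = D * y$1"
      "a * (b * y$1 + d * y$2) - b * (a * y$1 + c * y$2) = D * y$2"
      by (simp_all add: D_def algebra_simps)
    then show ?thesis using D by (simp add: real2_eq_iff diff_divide_distrib[symmetric])
  qed
  have j: "lin a c b d (lin (d / D) (- c / D) (- b / D) (a / D) y) = y" for y
  proof -
    have "a * (d * y$1 - c * y$2) + c * (a * y$2 - b * y$1) = D * y$1"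
      "b * (d * y$1 - c * y$2) + d * (a * y$2 - b * y$1) = D * y$2"
      by (simp_all add: D_def algebra_simps)
    then show ?thesis using D by (simp add: real2_eq_iff diff_divide_distrib[symmetric] add_divide_distrib[symmetric])
  qed
  have iff: "y \<in> polar (lin a b c d ` P) \<longleftrightarrow> lin a c b d y \<in> polar P" for y
    by (auto simp: polar_def adj)
  show ?thesis
  proof (intro set_eqI iffI)
    fix y assume "y \<in> polar (lin a b c d ` P)"
    then have "lin a c b d y \<in> polar P" by (simp only: iff)
    then have "lin (d / D) (- c / D) (- b / D) (a / D) (lin a c b d y) \<in> lin (d / D) (- c / D) (- b / D) (a / D) ` polar P"
      by (rule imageI)
    then show "y \<in> lin (d / D) (- c / D) (- b / D) (a / D) ` polar P" by (simp only: i)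
  next
    fix y assume "y \<in> lin (d / D) (- c / D) (- b / D) (a / D) ` polar P"
    then obtain z where "z \<in> polar P" "y = lin (d / D) (- c / D) (- b / D) (a / D) z" by (rule imageE)
    then show "y \<in> polar (lin a b c d ` P)" by (simp only: iff j)
  qed
qed

lemma rot90_eq_lin: "rot90 = lin 0 (-1) 1 0"
  by (simp add: fun_eq_iff rot90_def lin_def pt_def)

abbreviation (input) polar_moment :: "(real^2) set \<Rightarrow> real^2" where
  "polar_moment P \<equiv> rot90 (moment (polar P))"

text \<open>Polarity interchanges union and intersection when the union is convex, which preserves
  the valuation property. For determinant 1 the moment vector of the polar body transforms by the
  inverse transpose, and in the plane the quarter turn conjugates the inverse transpose to the
  matrix itself.\<close>

lemma sl2_valuation_polar_moment: "sl2_valuation polar_moment"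
proof (rule sl2_valuationI)
  show "valuation_on polytopes_o polar_moment"
    unfolding valuation_on_def
  proof (intro allI impI)
    fix K L assume KL: "K \<in> polytopes_o" "L \<in> polytopes_o" "K \<union> L \<in> polytopes_o" "K \<inter> L \<in> polytopes_o"
    have "moment (polar K \<union> polar L) + moment (polar K \<inter> polar L) = moment (polar K) + moment (polar L)"
      using KL by (intro moment_additive polytopes_o_polar)
    moreover have "polar (K \<inter> L) = polar K \<union> polar L"
      using KL polytopes_oD by (intro polar_Int)
    ultimately have "moment (polar (K \<union> L)) + moment (polar (K \<inter> L)) = moment (polar K) + moment (polar L)"
      by (simp add: polar_Un add.commute)
    then show "polar_moment (K \<union> L) + polar_moment (K \<inter> L) = polar_moment K + polar_moment L"
      unfolding rot90_eq_lin lin_simps(1)[symmetric] by simp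
  qed
  have "(\<lambda>P. moment (polar P)) \<in> measurable polytopes_o_borel borel"
  proof (rule measurable_hausdorff_continuous)
    fix K e assume K: "K \<in> polytopes_o" and e: "(e::real) > 0"
    obtain r where r: "r > 0" "ball 0 (2 * r) \<subseteq> K" using polytopes_o_ball[OF K] by blast
    show "\<exists>d>0. \<forall>L\<in>polytopes_o. hausdist K L < d \<longrightarrow> dist (moment (polar L)) (moment (polar K)) < e"
    proof (rule moment_hausdorff_continuous[where F=polar and \<delta>="r / 2" and R="1 / r", OF K])
      fix L assume L: "L \<in> polytopes_o" "hausdist K L < r / 2"
      have "ball 0 r \<subseteq> L"
      proof
        fix x assume "x \<in> ball (0::real^2) r"
        then have "ball x r \<subseteq> ball 0 (2 * r)" by (intro ball_subset_ball_iff[THEN iffD2]) auto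
        then show "x \<in> L" using hausdist_ball_imp_mem[OF K L] r by blast
      qed
      then show "polar L \<subseteq> cball 0 (1 / r)" using polar_props(1) r by blast
    next
      fix y assume y: "y \<in> interior (polar K)"
      \<comment> \<open>An interior point of the polar body can be dilated by \<open>1 + t\<close>.
        The slack \<open>1 - 1 / (1 + t)\<close> gained in the inequalities absorbs the displacement
        of points of a nearby polygon.\<close>
      obtain t where t: "t > 0" "(1 + t) *\<^sub>R y \<in> polar K"
      proof -
        obtain d where d: "d > 0" "ball y d \<subseteq> polar K" using y mem_interior by blast
        define t where "t = d / (norm y + 1) / 2"
        have "t > 0" using d by (simp add: t_def add_nonneg_pos)
        moreover have "dist y ((1 + t) *\<^sub>R y) < d"
        proof -
          have "dist y ((1 + t) *\<^sub>R y) = t * norm y" using \<open>t > 0\<close> by (simp add: dist_norm scaleR_add_left)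
          also have "\<dots> = d / 2 * (norm y / (norm y + 1))" by (simp add: t_def)
          also have "\<dots> \<le> d / 2 * 1" using d by (intro mult_left_mono) (auto simp: divide_le_eq add_nonneg_pos)
          finally show ?thesis using d by simp
        qed
        ultimately show ?thesis using that d by auto
      qed
      define d where "d = (1 - 1 / (1 + t)) / (norm y + 1)"
      have d: "d > 0" using t by (simp add: d_def add_nonneg_pos)
      have "y \<in> polar L" if L: "L \<in> polytopes_o" "hausdist K L < d" for L
        unfolding polar_def
      proof (intro CollectI ballI)
        fix x assume "x \<in> L"
        then obtain z where z: "z \<in> K" "dist x z < d" using hausdist_near(2)[OF K L] by blast
        have "(1 + t) * (y \<bullet> z) \<le> 1" using t(2) z by (auto simp: polar_def)
        then have "y \<bullet> z \<le> 1 / (1 + t)" using t(1) by (simp add: field_simps)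
        moreover have "y \<bullet> (x - z) \<le> norm y * d"
          using norm_cauchy_schwarz[of y "x - z"] z(2) mult_left_mono[of "norm (x - z)" d "norm y"] by (simp add: dist_norm)
        moreover have "norm y * d \<le> 1 - 1 / (1 + t)"
        proof -
          have "norm y * d \<le> (norm y + 1) * d" using d by (intro mult_right_mono) auto
          also have "\<dots> = 1 - 1 / (1 + t)" by (simp add: d_def add_nonneg_eq_0_iff)
          finally show ?thesis .
        qed
        ultimately show "y \<bullet> x \<le> 1" by (simp add: inner_diff_right)
      qed
      then show "\<exists>d>0. \<forall>L\<in>polytopes_o. hausdist K L < d \<longrightarrow> y \<in> polar L" using d by blast
    next
      fix y assume "y \<notin> polar K"
      then obtain x where x: "x \<in> K" "y \<bullet> x > 1" by (auto simp: polar_def not_le)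
      define d where "d = (y \<bullet> x - 1) / (norm y + 1)"
      have d: "d > 0" using x by (simp add: d_def add_nonneg_pos)
      have "y \<notin> polar L" if L: "L \<in> polytopes_o" "hausdist K L < d" for L
      proof -
        obtain z where z: "z \<in> L" "dist x z < d" using hausdist_near(1)[OF K L x(1)] by blast
        have "y \<bullet> (x - z) \<le> norm y * norm (x - z)" by (rule norm_cauchy_schwarz)
        also have "\<dots> \<le> norm y * d" using z(2) by (intro mult_left_mono) (auto simp: dist_norm)
        also have "\<dots> < (norm y + 1) * d" using d by simp
        also have "\<dots> = y \<bullet> x - 1" by (simp add: d_def add_nonneg_eq_0_iff)
        finally have "y \<bullet> z > 1" by (simp add: inner_diff_right)
        then show ?thesis using z(1) by (auto simp: polar_def not_le)
      qed
      then show "\<exists>d>0. \<forall>L\<in>polytopes_o. hausdist K L < d \<longrightarrow> y \<notin> polar L" using d by blast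
    qed (use polytopes_o_polar(1)[OF K] polytopes_o_polar(2) e r(1) in simp_all)
  qed
  moreover have "rot90 \<in> borel_measurable borel"
    unfolding rot90_eq_lin
    by (intro borel_measurable_continuous_onI linear_continuous_on) (simp add: linear_conv_bounded_linear[symmetric] linear_lin)
  ultimately show "polar_moment \<in> measurable polytopes_o_borel borel"
    by (rule measurable_compose)
  show "polar_moment (lin a b c d ` P) = lin a b c d (polar_moment P)" if "a * d - b * c = 1" "P \<in> polytopes_o" for a b c d P
  proof -
    have "polar (lin a b c d ` P) = lin d (- c) (- b) a ` polar P"
      using polar_lin[of a d b c P] that(1) by simp
    moreover have "moment (lin d (- c) (- b) a ` polar P) = lin d (- c) (- b) a (moment (polar P))"
      using moment_lin[OF polytopes_o_polar(2)[OF that(2)], of d "-c" "-b" a] that(1) by (simp add: mult.commute)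
    ultimately show ?thesis by (simp add: rot90_eq_lin real2_eq_iff algebra_simps)
  qed
qed

section \<open>The classification\<close>

lemma sl2_valuation_lincomb:
  assumes "sl2_valuation \<mu>" "sl2_valuation \<nu>"
  shows "sl2_valuation (\<lambda>P. s *\<^sub>R \<mu> P + t *\<^sub>R \<nu> P)"
proof (rule sl2_valuationI)
  interpret \<mu>: sl2_valuation \<mu> by fact
  interpret \<nu>: sl2_valuation \<nu> by fact
  show "valuation_on polytopes_o (\<lambda>P. s *\<^sub>R \<mu> P + t *\<^sub>R \<nu> P)"
    unfolding valuation_on_def
  proof (intro allI impI)
    fix K L assume KL: "K \<in> polytopes_o" "L \<in> polytopes_o" "K \<union> L \<in> polytopes_o" "K \<inter> L \<in> polytopes_o"
    have e: "\<mu> (K \<union> L) + \<mu> (K \<inter> L) = \<mu> K + \<mu> L" "\<nu> (K \<union> L) + \<nu> (K \<inter> L) = \<nu> K + \<nu> L"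
      using KL \<mu>.valuation \<nu>.valuation by (simp_all add: valuation_on_def)
    have "s *\<^sub>R \<mu> (K \<union> L) + t *\<^sub>R \<nu> (K \<union> L) + (s *\<^sub>R \<mu> (K \<inter> L) + t *\<^sub>R \<nu> (K \<inter> L))
        = s *\<^sub>R (\<mu> (K \<union> L) + \<mu> (K \<inter> L)) + t *\<^sub>R (\<nu> (K \<union> L) + \<nu> (K \<inter> L))"
      by (simp add: scaleR_add_right)
    also have "\<dots> = s *\<^sub>R \<mu> K + t *\<^sub>R \<nu> K + (s *\<^sub>R \<mu> L + t *\<^sub>R \<nu> L)"
      unfolding e by (simp add: scaleR_add_right)
    finally show "s *\<^sub>R \<mu> (K \<union> L) + t *\<^sub>R \<nu> (K \<union> L) + (s *\<^sub>R \<mu> (K \<inter> L) + t *\<^sub>R \<nu> (K \<inter> L))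
        = s *\<^sub>R \<mu> K + t *\<^sub>R \<nu> K + (s *\<^sub>R \<mu> L + t *\<^sub>R \<nu> L)" .
  qed
  show "(\<lambda>P. s *\<^sub>R \<mu> P + t *\<^sub>R \<nu> P) \<in> measurable polytopes_o_borel borel"
    using \<mu>.measurable \<nu>.measurable by (intro borel_measurable_add borel_measurable_scaleR) auto
  show "s *\<^sub>R \<mu> (lin a b c d ` P) + t *\<^sub>R \<nu> (lin a b c d ` P) = lin a b c d (s *\<^sub>R \<mu> P + t *\<^sub>R \<nu> P)"
    if "a * d - b * c = 1" "P \<in> polytopes_o" for a b c d P
    using \<mu>.lin_equivariant[OF that(2,1)] \<nu>.lin_equivariant[OF that(2,1)] by (simp add: lin_simps)
qed

lemma sl2_valuation_diff:
  assumes "sl2_valuation \<mu>" "sl2_valuation \<nu>"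
  shows "sl2_valuation (\<lambda>P. \<mu> P - c *\<^sub>R \<nu> P)"
  using sl2_valuation_lincomb[OF assms, of 1 "- c"] by simp

lemma twist_diff:
  assumes "twist \<mu> K" "twist \<nu> L"
  shows "twist (\<lambda>P. \<mu> P - c *\<^sub>R \<nu> P) (K - c * L)"
  unfolding twist_def
proof (intro allI impI)
  fix a b u v s assume ok: "glueable a b {u} {v}" "glueable a b {shear s u} {v}"
  let ?X = "glued a b {shear s u} {v}" and ?Y = "glued a b {u} {v}"
  define z where "z = (1 / a^3 + 1 / b^3) * s"
  have "\<mu> ?X $ 2 - \<mu> ?Y $ 2 = K * z" "\<nu> ?X $ 2 - \<nu> ?Y $ 2 = L * z"
    using assms ok unfolding twist_def z_def mult.assoc[symmetric] by blast+
  moreover have "(\<mu> ?X - c *\<^sub>R \<nu> ?X) $ 2 - (\<mu> ?Y - c *\<^sub>R \<nu> ?Y) $ 2 = (\<mu> ?X $ 2 - \<mu> ?Y $ 2) - c * (\<nu> ?X $ 2 - \<nu> ?Y $ 2)"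
    by (simp add: algebra_simps)
  ultimately have "(\<mu> ?X - c *\<^sub>R \<nu> ?X) $ 2 - (\<mu> ?Y - c *\<^sub>R \<nu> ?Y) $ 2 = (K - c * L) * z"
    by (simp add: algebra_simps)
  then show "(\<mu> ?X - c *\<^sub>R \<nu> ?X) $ 2 - (\<mu> ?Y - c *\<^sub>R \<nu> ?Y) $ 2 = (K - c * L) * (1 / a^3 + 1 / b^3) * s"
    unfolding z_def by (simp only: mult.assoc)
qed

text \<open>The box splits into a square symmetric about the origin, with moment vector 0, and a
  rectangle on which the first coordinate is at least 1.\<close>

lemma moment_box_nonzero:
  defines "B \<equiv> cbox (pt (-1) (-1)) (pt 2 1)"
  shows "B \<in> polytopes_o" "moment B \<noteq> 0"
proof -
  have "0 \<in> interior B" by (simp add: B_def interior_cbox mem_box_cart forall_2)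
  then show "B \<in> polytopes_o" by (simp add: polytopes_o_def B_def polytope_interval)
  define C where "C = cbox (pt (-1) (-1)) (pt 1 1)"
  define D where "D = cbox (pt 1 (-1)) (pt 2 1)"
  have mem: "x \<in> cbox (pt a b) (pt c d) \<longleftrightarrow> a \<le> x $ 1 \<and> x $ 1 \<le> c \<and> b \<le> x $ 2 \<and> x $ 2 \<le> d" for x a b c d
    by (auto simp: mem_box_cart forall_2)
  have BCD: "C \<union> D = B" by (auto simp: B_def C_def D_def mem)
  have neg: "negligible (C \<inter> D)"
    by (rule negligible_subset[OF negligible_hyperplane[of "pt 1 0" 1]])
      (auto simp: C_def D_def mem inner_real2 real2_eq_iff)
  have "moment (C \<inter> D) = 0"
    unfolding moment_def by (rule integral_unique, rule has_integral_negligible[OF neg]) auto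
  moreover have "moment C = 0"
  proof -
    have "lin (-1) 0 0 (-1) ` C = C"
    proof -
      have "x \<in> C \<Longrightarrow> lin (-1) 0 0 (-1) x \<in> C" "lin (-1) 0 0 (-1) (lin (-1) 0 0 (-1) x) = x" for x
        by (auto simp: C_def mem real2_eq_iff)
      then show ?thesis by (auto simp: image_iff) (metis)
    qed
    moreover have "lin (-1) 0 0 (-1) (moment C) = - moment C" by (simp add: real2_eq_iff)
    moreover have "compact C" by (simp add: C_def)
    ultimately have "moment C = - moment C" using moment_lin[of C "-1" 0 0 "-1"] by simp
    then show ?thesis by (simp add: real2_eq_iff)
  qed
  moreover have "moment (C \<union> D) + moment (C \<inter> D) = moment C + moment D"
    by (rule moment_additive) (auto simp: C_def D_def)
  ultimately have "moment B = moment D" using BCD by simp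
  moreover have "moment D $ 1 > 0"
  proof -
    have io: "(\<lambda>x. x) integrable_on D"
      unfolding D_def by (intro integrable_continuous) (auto intro: continuous_intros)
    have "cbox (pt 1 (-1)) (pt 2 1) \<noteq> {}" by (simp add: interval_ne_empty_cart forall_2)
    then have "measure lborel D > 0" unfolding D_def by (simp add: content_cbox_cart UNIV_2)
    also have "measure lborel D = integral D (\<lambda>x. 1)" by (simp add: D_def)
    also have "\<dots> \<le> integral D (\<lambda>x. x $ 1)"
    proof (rule integral_le)
      show "(\<lambda>x. x $ 1) integrable_on D" unfolding D_def by (intro integrable_continuous continuous_intros)
    qed (auto simp: D_def mem)
    also have "\<dots> = moment D $ 1" unfolding moment_def using io by (rule integral_component_eq_cart)
    finally show ?thesis .
  qed
  ultimately show "moment B \<noteq> 0" by auto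
qed

lemma polar_convex_hull: "polar (convex hull S) = polar S"
proof
  show "polar (convex hull S) \<subseteq> polar S" by (auto simp: polar_def hull_inc)
  show "polar S \<subseteq> polar (convex hull S)"
    unfolding polar_def by (intro subsetI CollectI ballI, rule halfplane_hull) auto
qed

text \<open>The vertices are chosen so that the polar body is the box with nonzero moment vector:
  the ends at distance \<open>1/2\<close> and 1 on the first axis give its bounds 2 and -1.\<close>

lemma polar_moment_nonzero: "polar_moment (glued 1 (1/2) {pt 0 1} {pt 0 (-1)}) \<noteq> 0"
proof -
  have "polar (glued 1 (1/2) {pt 0 1} {pt 0 (-1)}) = cbox (pt (-1) (-1)) (pt 2 1)"
    unfolding glued_def polar_convex_hull
    by (auto simp: polar_def inner_real2 mem_box_cart forall_2)
  then show ?thesis using moment_box_nonzero(2) by (auto simp: rot90_eq_lin real2_eq_iff)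
qed

lemma moment_scale2:
  assumes "P \<in> polytopes_o"
  shows "moment (lin 2 0 0 2 ` P) = 8 *\<^sub>R moment P" "polar_moment (lin 2 0 0 2 ` P) = (1/8) *\<^sub>R polar_moment P"
proof -
  show "moment (lin 2 0 0 2 ` P) = 8 *\<^sub>R moment P"
    using moment_lin[OF polytopes_oD(3)[OF assms], of 2 0 0 2] by (simp add: real2_eq_iff)
  have "polar (lin 2 0 0 2 ` P) = lin (1/2) 0 0 (1/2) ` polar P" using polar_lin[of 2 2 0 0 P] by simp
  then show "polar_moment (lin 2 0 0 2 ` P) = (1/8) *\<^sub>R polar_moment P"
    using moment_lin[OF polytopes_o_polar(2)[OF assms], of "1/2" 0 0 "1/2"] by (simp add: real2_eq_iff rot90_eq_lin)
qed

lemma glued_scale2: "lin 2 0 0 2 ` glued a b {u} {v} = glued (2 * a) (2 * b) {2 *\<^sub>R u} {2 *\<^sub>R v}"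
proof -
  have "lin 2 0 0 2 x = 2 *\<^sub>R x" for x by (simp add: real2_eq_iff)
  moreover have "2 *\<^sub>R pt x y = pt (2 * x) (2 * y)" for x y by (simp add: real2_eq_iff)
  ultimately show ?thesis unfolding glued_def lin_image_hull by simp
qed

text \<open>Doubling commutes with shears and multiplies moment vectors by 8, so it would multiply
  the difference \<open>K * 2\<close> by 8. The twist formula for the doubled diagonal gives
  \<open>K / 4\<close> instead, hence \<open>K = 0\<close>.\<close>

lemma twist_moment: "twist moment 0"
proof -
  interpret sl2_valuation moment by (rule sl2_valuation_moment)
  obtain K where K: "twist moment K" using twist_ex by blast
  have ok: "glueable 1 1 {pt 0 1} {pt 0 (-1)}" "glueable 1 1 {shear 1 (pt 0 1)} {pt 0 (-1)}"
    "glueable 2 2 {pt 0 2} {pt 0 (-2)}" "glueable 2 2 {shear 1 (pt 0 2)} {pt 0 (-2)}"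
    by (rule glueable_small; simp)+
  have "moment (glued 1 1 {shear 1 (pt 0 1)} {pt 0 (-1)}) $ 2 - moment (glued 1 1 {pt 0 1} {pt 0 (-1)}) $ 2 = K * 2"
    using K[unfolded twist_def, rule_format, OF ok(1,2)] by simp
  moreover have "moment (glued 2 2 {shear 1 (pt 0 2)} {pt 0 (-2)}) $ 2 - moment (glued 2 2 {pt 0 2} {pt 0 (-2)}) $ 2 = K / 4"
    using K[unfolded twist_def, rule_format, OF ok(3,4)] by simp
  moreover have "2 *\<^sub>R pt 0 1 = pt 0 2" "2 *\<^sub>R pt 0 (-1) = pt 0 (-2)" "2 *\<^sub>R shear 1 (pt 0 1) = shear 1 (pt 0 2)"
    by (simp_all add: real2_eq_iff)
  ultimately have "K / 4 = 8 * (K * 2)"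
    using moment_scale2(1)[OF glued_in_polytopes_o[OF ok(1)]] moment_scale2(1)[OF glued_in_polytopes_o[OF ok(2)]]
    unfolding glued_scale2 by (simp add: algebra_simps)
  then show ?thesis using K by simp
qed

text \<open>On quadrilaterals both \<open>\<mu>\<close> and the moment vector are multiples of the
  same edge sum. The factor \<open>m\<close> of the moment vector is nonzero, as otherwise it would
  vanish on every polygon, including the box. Subtracting \<open>k / m\<close> times the moment
  vector therefore gives a valuation that is null on quadrilaterals, hence everywhere.\<close>

lemma twist_zero_unique:
  assumes \<mu>: "sl2_valuation \<mu>" "twist \<mu> 0"
  obtains c where "\<And>P. P \<in> polytopes_o \<Longrightarrow> \<mu> P = c *\<^sub>R moment P"
proof -
  obtain k where k: "\<And>a b u v. glueable a b {u} {v} \<Longrightarrow> \<mu> (glued a b {u} {v}) = k *\<^sub>R edge_sum moment_edge a b u v"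
    using sl2_valuation.twist_zero_formula[OF \<mu>] by blast
  obtain m where m: "\<And>a b u v. glueable a b {u} {v} \<Longrightarrow> moment (glued a b {u} {v}) = m *\<^sub>R edge_sum moment_edge a b u v"
    using sl2_valuation.twist_zero_formula[OF sl2_valuation_moment twist_moment] by blast
  have "m \<noteq> 0"
  proof
    assume "m = 0"
    then interpret quad_null_valuation moment
      using m sl2_valuation_moment by (simp add: quad_null_valuation_def quad_null_valuation_axioms_def)
    show False using zero_of_quad_null moment_box_nonzero by blast
  qed
  have "quad_null_valuation (\<lambda>P. \<mu> P - (k / m) *\<^sub>R moment P)"
    using sl2_valuation_diff[OF \<mu>(1) sl2_valuation_moment, of "k / m"] \<open>m \<noteq> 0\<close>
    by (simp add: quad_null_valuation_def quad_null_valuation_axioms_def k m)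
  then interpret quad_null_valuation "\<lambda>P. \<mu> P - (k / m) *\<^sub>R moment P" .
  show ?thesis using that[of "k / m"] zero_of_quad_null by (metis eq_iff_diff_eq_0)
qed

text \<open>With zero twist the polar moment would be a multiple of the moment vector. Doubling
  multiplies the one by 1/8 and the other by 8, so it would vanish even on the quadrilateral whose
  polar body is the box.\<close>

lemma twist_polar_moment_nonzero: "\<not> twist polar_moment 0"
proof
  assume "twist polar_moment 0"
  then obtain c where c: "\<And>P. P \<in> polytopes_o \<Longrightarrow> polar_moment P = c *\<^sub>R moment P"
    using twist_zero_unique[OF sl2_valuation_polar_moment] by blast
  let ?P = "glued 1 (1/2) {pt 0 1} {pt 0 (-1)}"
  have ok: "glueable 1 (1/2) {pt 0 1} {pt 0 (-1)}" "glueable (2 * 1) (2 * (1/2)) {2 *\<^sub>R pt 0 1} {2 *\<^sub>R pt 0 (-1)}"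
  proof -
    have "2 *\<^sub>R pt 0 1 = pt 0 2" "2 *\<^sub>R pt 0 (-1) = pt 0 (-2)" by (simp_all add: real2_eq_iff)
    then show "glueable 1 (1/2) {pt 0 1} {pt 0 (-1)}" "glueable (2 * 1) (2 * (1/2)) {2 *\<^sub>R pt 0 1} {2 *\<^sub>R pt 0 (-1)}"
      using glueable_small[of 1 "1/2" "pt 0 1" 1] glueable_small[of 2 1 "pt 0 2" 2] by simp_all
  qed
  have P: "?P \<in> polytopes_o" "lin 2 0 0 2 ` ?P \<in> polytopes_o"
    unfolding glued_scale2 using glued_in_polytopes_o ok by blast+
  have "(1/8) *\<^sub>R (c *\<^sub>R moment ?P) = c *\<^sub>R (8 *\<^sub>R moment ?P)"
    using c[OF P(2)] c[OF P(1)] moment_scale2[OF P(1)] by simp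
  then have "c *\<^sub>R moment ?P = 0" by (auto simp: real2_eq_iff)
  then show False using c[OF P(1)] polar_moment_nonzero by simp
qed

theorem theorem1p3:
  fixes \<mu> :: "(real^2) set \<Rightarrow> real^2"
  shows "(valuation_on polytopes_o \<mu> \<and> \<mu> \<in> measurable polytopes_o_borel borel \<and>
          (\<forall>A :: real^2^2. det A = 1 \<longrightarrow>
             (\<forall>P\<in>polytopes_o. \<mu> ((\<lambda>x. A *v x) ` P) = A *v \<mu> P)))
     \<longleftrightarrow> (\<exists>k1 k2 :: real. \<forall>P\<in>polytopes_o.
            \<mu> P = k1 *\<^sub>R moment P + k2 *\<^sub>R rot90 (moment (polar P)))"
proof
  assume L: "valuation_on polytopes_o \<mu> \<and> \<mu> \<in> measurable polytopes_o_borel borel \<and>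
          (\<forall>A :: real^2^2. det A = 1 \<longrightarrow>
             (\<forall>P\<in>polytopes_o. \<mu> ((\<lambda>x. A *v x) ` P) = A *v \<mu> P))"
  then have \<mu>: "sl2_valuation \<mu>" by (simp add: sl2_valuation_def)
  obtain K where K: "twist \<mu> K" using sl2_valuation.twist_ex[OF \<mu>] by blast
  obtain M where M: "twist polar_moment M" using sl2_valuation.twist_ex[OF sl2_valuation_polar_moment] by blast
  have "M \<noteq> 0" using M twist_polar_moment_nonzero by metis
  \<comment> \<open>Twists subtract linearly, so the multiple \<open>K / M\<close> leaves a
    valuation without twist, which must be a multiple of the moment vector.\<close>
  then have "twist (\<lambda>P. \<mu> P - (K / M) *\<^sub>R polar_moment P) 0"
    using twist_diff[OF K M, of "K / M"] by simp
  then obtain c where "\<And>P. P \<in> polytopes_o \<Longrightarrow> \<mu> P - (K / M) *\<^sub>R polar_moment P = c *\<^sub>R moment P"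
    using twist_zero_unique[OF sl2_valuation_diff[OF \<mu> sl2_valuation_polar_moment]] by blast
  then have "\<forall>P\<in>polytopes_o. \<mu> P = c *\<^sub>R moment P + (K / M) *\<^sub>R polar_moment P"
    by (simp add: diff_eq_eq)
  then show "\<exists>k1 k2 :: real. \<forall>P\<in>polytopes_o. \<mu> P = k1 *\<^sub>R moment P + k2 *\<^sub>R rot90 (moment (polar P))"
    by blast
next
  assume "\<exists>k1 k2 :: real. \<forall>P\<in>polytopes_o. \<mu> P = k1 *\<^sub>R moment P + k2 *\<^sub>R rot90 (moment (polar P))"
  then obtain k1 k2 where k: "\<And>P. P \<in> polytopes_o \<Longrightarrow> \<mu> P = k1 *\<^sub>R moment P + k2 *\<^sub>R polar_moment P" by blast
  interpret \<nu>: sl2_valuation "\<lambda>P. k1 *\<^sub>R moment P + k2 *\<^sub>R polar_moment P"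
    by (rule sl2_valuation_lincomb[OF sl2_valuation_moment sl2_valuation_polar_moment])
  show "valuation_on polytopes_o \<mu> \<and> \<mu> \<in> measurable polytopes_o_borel borel \<and>
          (\<forall>A :: real^2^2. det A = 1 \<longrightarrow>
             (\<forall>P\<in>polytopes_o. \<mu> ((\<lambda>x. A *v x) ` P) = A *v \<mu> P))"
  proof (intro conjI allI impI ballI)
    show "valuation_on polytopes_o \<mu>"
      using \<nu>.valuation unfolding valuation_on_def by (simp add: k)
    show "\<mu> \<in> measurable polytopes_o_borel borel"
      using \<nu>.measurable by (subst measurable_cong[OF k]) simp_all
    fix A :: "real^2^2" and P :: "(real^2) set" assume A: "det A = 1" and P: "P \<in> polytopes_o"
    have "(\<lambda>x. A *v x) ` P \<in> polytopes_o"
      using polytopes_o_lin[OF P] A unfolding matrix_eq_lin by blast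
    then show "\<mu> ((\<lambda>x. A *v x) ` P) = A *v \<mu> P"
      using \<nu>.equivariant[OF A P] k P by simp
  qed
qed

end
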